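(* For each $n\ge 1$ let $C_n$ be a conjugacy class of the symmetric group $S_n$, and let $\alpha_1(C_n)$ denote the fraction of fixed points of each element of $C_n$ (i.e. the number of fixed points of any element of $C_n$ divided by $n$). Suppose that $\pi_n$ is chosen uniformly at random from $C_n$ and that $\alpha_1(C_n)\to\alpha$ as $n\to\infty$ for some $\alpha\in[0,1]$. Then, as $n\to\infty$, \[ \frac{p(\pi_n)-\frac{1-\alpha_1(C_n)^3}{3}\,n}{\sqrt{n}} \] converges in distribution to the normal distribution $\mathcal{N}\!\left(0,\ \tfrac{2}{45}+\tfrac19\alpha^3-\tfrac35\alpha^5+\tfrac49\alpha^6\right)$.
   Context: For $\pi\in S_n$ (viewed as the word $\pi(1)\pi(2)\cdots\pi(n)$), $\pi$ has a peak at position $i$, where $1<i<n$, if $\pi(i-1)<\pi(i)>\pi(i+1)$; $p(\pi)$ denotes the number of peaks of $\pi$. *)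

theory Defs
  imports "HOL-Probability.Probability" "HOL-Combinatorics.Permutations"
begin

text \<open>Permutations of S_n are bijections p of {1..n} (p permutes {1..n}), viewed
  as the word p(1) p(2) ... p(n).\<close>

definition peaks :: "nat \<Rightarrow> (nat \<Rightarrow> nat) \<Rightarrow> nat" where
  "peaks n p = card {i. 1 < i \<and> i < n \<and> p (i - 1) < p i \<and> p (i + 1) < p i}"

definition fixed_points :: "nat \<Rightarrow> (nat \<Rightarrow> nat) \<Rightarrow> nat" where
  "fixed_points n p = card {i \<in> {1..n}. p i = i}"

definition conj_class :: "nat \<Rightarrow> (nat \<Rightarrow> nat) set \<Rightarrow> bool" where
  "conj_class n C \<longleftrightarrow> (\<exists>p. p permutes {1..n} \<and>
      C = {\<sigma> \<circ> p \<circ> inv \<sigma> | \<sigma>. \<sigma> permutes {1..n}})"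

text \<open>alpha_1(C): fraction of fixed points of (any, hence some) element of C.\<close>
definition alpha1 :: "nat \<Rightarrow> (nat \<Rightarrow> nat) set \<Rightarrow> real" where
  "alpha1 n C = real (fixed_points n (SOME p. p \<in> C)) / real n"

definition normal_measure :: "real \<Rightarrow> real measure" where
  "normal_measure v = (if v = 0 then return borel 0
                       else density lborel (normal_density 0 (sqrt v)))"

end

theory Submission
  imports Defs "HOL-Computational_Algebra.Formal_Power_Series" "HOL-Complex_Analysis.Great_Picard"
begin

text \<open>
  The generating function of the peak number over a conjugacy class is obtained from counting words.
  Take \<open>2 * a\<close> letters, odd letters being allowed to repeat along ascents and even letters along
  descents. The number of weakly increasing words compatible with a permutation depends only on its
  number \<open>k\<close> of peaks (Stembridge's enriched P-partitions); normalised by \<open>n! / (2 * a) ^ n\<close> it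
  satisfies a three-term recurrence, and with \<open>e = 1 / (2 * a)\<^sup>2\<close> of order \<open>n powr (- 5 / 2)\<close> it behaves like
  \<open>exp (e * (n ^ 3 / 3 - k * n\<^sup>2) + e\<^sup>2 * n ^ 5 * q (k / n))\<close> for the quadratic polynomial
  \<open>q x = - 3 / 10 + 3 / 2 * x - 2 * x\<^sup>2\<close>. So averaging this weight over the
  class is an exponential tilt of the peak number on the scale \<open>sqrt n\<close>.

  On the other hand the sum over all conjugates \<open>\<sigma> p \<sigma>\<^sup>-\<^sup>1\<close> counts pairs of a labelling of the points and a
  linear order that \<open>p\<close> respects on points with equal labels. Inserting a cycle of length \<open>i \<ge> 2\<close> into
  such a pair multiplies the count by \<open>(2 * a) ^ i\<close> up to a negligible error, because the order of
  generic points is forced by the signed lexicographic order of their words. Hence only the \<open>m\<close> fixed points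
  matter, and they contribute the weight of the identity of \<open>S_m\<close>. Comparing both sides gives
  the limit of the Laplace transform for every \<open>s > 0\<close>. Analytic continuation to the half plane and a second
  moment bound at its boundary turn this into convergence of characteristic functions.
\<close>

section \<open>Enriched words and peaks\<close>

text \<open>The exponent -5/2 is forced: the tilt \<open>e * n\<^sup>2\<close> per peak has to be of
  order \<open>n powr (- 1 / 2)\<close>. At that size \<open>e\<^sup>2 * n ^ 5\<close> stays bounded
  and feeds the variance, while the next order \<open>e ^ 3 * n ^ 7\<close> vanishes. There are then
  about \<open>n powr (5 / 4)\<close> letters, enough for the errors of all cycles together,
  \<open>n\<^sup>2 * e\<close> and \<open>n * sqrt e\<close>, to vanish. A fixed point cannot be
  removed like this: its relative error bound is of order \<open>n / K\<close>, and the sum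
  \<open>n\<^sup>2 / K\<close> diverges. Two obstacles shape the analysis. The value
  \<open>q (k / n)\<close> is still random, so a law of large numbers is needed first; it comes from
  the same identity at the smaller scale \<open>e = \<tau> / n ^ 3\<close>. And \<open>e\<close> is
  positive, so only one side of the Laplace transform is accessible and the continuity theorem for
  transforms finite around 0 does not apply. The limit variance is
  \<open>- 2 * q x - 3 / 5 * \<alpha> ^ 5\<close> at \<open>x = (1 - \<alpha> ^ 3) / 3\<close>; its
  last term comes from the identity on the fixed points. Stembridge's signed letters -1 < 1 < -2 < 2
  < ... are coded as 0, 1, 2, 3, ..., with the parity carrying the sign.\<close>

definition enriched :: "nat \<Rightarrow> (nat \<Rightarrow> nat) \<Rightarrow> nat \<Rightarrow> (nat \<Rightarrow> nat) set" where
  "enriched n \<pi> k = {s \<in> {1..n} \<rightarrow>\<^sub>E {..<k}. \<forall>i\<in>{1..<n}.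
     s i < s (Suc i) \<or> s i = s (Suc i) \<and> (odd (s i) \<longleftrightarrow> \<pi> i < \<pi> (Suc i))}"

lemma finite_enriched [simp]: "finite (enriched n \<pi> k)"
proof -
  have "enriched n \<pi> k \<subseteq> {1..n} \<rightarrow>\<^sub>E {..<k}" by (auto simp: enriched_def)
  thus ?thesis by (rule finite_subset) (intro finite_PiE; simp)
qed

lemma enriched_mono_idx:
  assumes "s \<in> enriched n \<pi> k" "1 \<le> i" "i \<le> j" "j \<le> n"
  shows "s i \<le> s j"
  using assms(3,4)
proof (induction j rule: dec_induct)
  case (step m)
  have "m \<in> {1..<n}" using step assms(2) by auto
  then have "s m \<le> s (Suc m)" using assms(1) unfolding enriched_def by force
  then show ?case using step by auto
qed simp

text \<open>Words are weakly increasing, so the last letter bounds all others: the shorter word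
  stays below \<open>k\<close>, or below \<open>Suc k\<close> when \<open>k\<close> may repeat at
  position \<open>n\<close>. Alphabets of odd size arise here even if the original one is
  even.\<close>

lemma enriched_Suc:
  assumes "n \<ge> 1"
  shows "{s \<in> enriched (Suc n) \<pi> K. s (Suc n) = k} = (if k < K then
     (\<lambda>s. s(Suc n := k)) ` enriched n \<pi> (if odd k \<longleftrightarrow> \<pi> n < \<pi> (Suc n) then Suc k else k) else {})"
  (is "?A = (if k < K then ?f ` ?B else {})")
proof (cases "k < K")
  case False
  then show ?thesis by (auto simp: enriched_def PiE_def Pi_def)
next
  case True
  have "?A = ?f ` ?B"
  proof (intro equalityI subsetI)
    fix s assume s: "s \<in> ?A"
    let ?t = "restrict s {1..n}"
    have sE: "s \<in> {1..Suc n} \<rightarrow>\<^sub>E {..<K}" and sk: "s (Suc n) = k"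
      and sI: "\<And>i. i \<in> {1..<Suc n} \<Longrightarrow>
        s i < s (Suc i) \<or> s i = s (Suc i) \<and> (odd (s i) \<longleftrightarrow> \<pi> i < \<pi> (Suc i))"
      using s unfolding enriched_def by blast+
    have last: "s n < (if odd k \<longleftrightarrow> \<pi> n < \<pi> (Suc n) then Suc k else k)"
      using sI[of n] sk assms by auto
    have le: "s i \<le> s n" if "i \<in> {1..n}" for i
      using enriched_mono_idx[of s "Suc n" \<pi> K i n] s that by auto
    have "?t \<in> ?B"
      unfolding enriched_def
    proof (intro CollectI conjI ballI)
      show "?t \<in> {1..n} \<rightarrow>\<^sub>E {..<(if odd k \<longleftrightarrow> \<pi> n < \<pi> (Suc n) then Suc k else k)}"
        using le_less_trans[OF le last] by (simp add: PiE_def Pi_def)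
      show "?t i < ?t (Suc i) \<or> ?t i = ?t (Suc i) \<and> (odd (?t i) \<longleftrightarrow> \<pi> i < \<pi> (Suc i))"
        if "i \<in> {1..<n}" for i
        using sI[of i] that by auto
    qed
    moreover have "s = ?f ?t"
      using sE sk by (auto simp: fun_eq_iff PiE_def extensional_def restrict_def)
    ultimately show "s \<in> ?f ` ?B" by blast
  next
    fix s assume "s \<in> ?f ` ?B"
    then obtain t where t: "t \<in> ?B" and s: "s = t(Suc n := k)" by blast
    have tE: "t \<in> {1..n} \<rightarrow>\<^sub>E {..<(if odd k \<longleftrightarrow> \<pi> n < \<pi> (Suc n) then Suc k else k)}"
      and tI: "\<And>i. i \<in> {1..<n} \<Longrightarrow>
        t i < t (Suc i) \<or> t i = t (Suc i) \<and> (odd (t i) \<longleftrightarrow> \<pi> i < \<pi> (Suc i))"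
      using t unfolding enriched_def by blast+
    have tn: "t i < (if odd k \<longleftrightarrow> \<pi> n < \<pi> (Suc n) then Suc k else k)" if "i \<in> {1..n}" for i
      using tE that by blast
    have "s \<in> {1..Suc n} \<rightarrow>\<^sub>E {..<K}"
    proof (rule PiE_I)
      show "s i \<in> {..<K}" if "i \<in> {1..Suc n}" for i
        using tn[of i] that True s by (cases "i = Suc n") (auto split: if_splits)
      show "s i = undefined" if "i \<notin> {1..Suc n}" for i
        using tE that s by (auto simp: PiE_def extensional_def)
    qed
    moreover have "s i < s (Suc i) \<or> s i = s (Suc i) \<and> (odd (s i) \<longleftrightarrow> \<pi> i < \<pi> (Suc i))"
      if "i \<in> {1..<Suc n}" for i
    proof (cases "i = n")
      case True
      then show ?thesis using tn[of n] assms s by (auto split: if_splits simp: less_Suc_eq)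
    next
      case False
      then show ?thesis using tI[of i] that s by auto
    qed
    ultimately show "s \<in> ?A" using s by (auto simp: enriched_def)
  qed
  with True show ?thesis by simp
qed

lemma card_enriched_Suc:
  assumes "n \<ge> 1"
  shows "card (enriched (Suc n) \<pi> K) =
    (\<Sum>k<K. card (enriched n \<pi> (if odd k \<longleftrightarrow> \<pi> n < \<pi> (Suc n) then Suc k else k)))"
proof -
  have "card (enriched (Suc n) \<pi> K) = card (\<Union>k<K. {s \<in> enriched (Suc n) \<pi> K. s (Suc n) = k})"
    by (rule arg_cong[where f = card]) (auto simp: enriched_def PiE_def Pi_def)
  also have "\<dots> = (\<Sum>k<K. card {s \<in> enriched (Suc n) \<pi> K. s (Suc n) = k})"
    by (rule card_UN_disjoint) auto
  also have "\<dots> = (\<Sum>k<K. card (enriched n \<pi> (if odd k \<longleftrightarrow> \<pi> n < \<pi> (Suc n) then Suc k else k)))"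
  proof (rule sum.cong[OF refl])
    fix k assume "k \<in> {..<K}"
    have inj: "inj_on (\<lambda>s. s(Suc n := k)) (enriched n \<pi> m)" for m
    proof (rule inj_onI)
      fix s t assume st: "s \<in> enriched n \<pi> m" "t \<in> enriched n \<pi> m" "s(Suc n := k) = t(Suc n := k)"
      have "s (Suc n) = undefined" "t (Suc n) = undefined"
        using st by (auto simp: enriched_def PiE_def extensional_def)
      then show "s = t" using st(3) by (metis fun_upd_triv fun_upd_upd)
    qed
    show "card {s \<in> enriched (Suc n) \<pi> K. s (Suc n) = k} =
       card (enriched n \<pi> (if odd k \<longleftrightarrow> \<pi> n < \<pi> (Suc n) then Suc k else k))"
      using \<open>k \<in> {..<K}\<close> by (subst enriched_Suc[OF assms]) (simp add: card_image[OF inj] del: fun_upd_apply)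
  qed
  finally show ?thesis .
qed

lemma card_enriched_1: "card (enriched 1 \<pi> K) = K"
proof -
  have "enriched 1 \<pi> K = {1::nat} \<rightarrow>\<^sub>E {..<K}" by (auto simp: enriched_def)
  then show ?thesis by (simp add: card_PiE)
qed

lemma peaks_Suc:
  assumes "n \<ge> 1"
  shows "peaks (Suc n) \<pi> = peaks n \<pi> + (if n \<ge> 2 \<and> \<pi> (n - 1) < \<pi> n \<and> \<pi> (Suc n) < \<pi> n then 1 else 0)"
proof -
  let ?A = "\<lambda>n. {i. 1 < i \<and> i < n \<and> \<pi> (i - 1) < \<pi> i \<and> \<pi> (i + 1) < \<pi> i}"
  have fin: "finite (?A n)" by (rule finite_subset[of _ "{..<n}"]) auto
  have "?A (Suc n) = ?A n \<union> (if n \<ge> 2 \<and> \<pi> (n - 1) < \<pi> n \<and> \<pi> (Suc n) < \<pi> n then {n} else {})"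
    by (auto simp: less_Suc_eq)
  moreover have "n \<notin> ?A n" by auto
  ultimately show ?thesis using fin by (auto simp: peaks_def)
qed

section \<open>Generating functions for alphabets of even and of odd size\<close>

definition even_fps :: "nat \<Rightarrow> (nat \<Rightarrow> nat) \<Rightarrow> real fps" where
  "even_fps n \<pi> = Abs_fps (\<lambda>a. real (card (enriched n \<pi> (2 * a))))"

definition odd_fps :: "nat \<Rightarrow> (nat \<Rightarrow> nat) \<Rightarrow> real fps" where
  "odd_fps n \<pi> = Abs_fps (\<lambda>a. real (card (enriched n \<pi> (2 * a + 1))))"

lemma enriched_0_letters: "n \<ge> 1 \<Longrightarrow> enriched n \<pi> 0 = {}"
  by (auto simp: enriched_def PiE_eq_empty_iff)

text \<open>At an ascent the remaining alphabet has size \<open>k\<close> for even \<open>k\<close>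
  and \<open>Suc k\<close> for odd \<open>k\<close>, so its size is always even; at a descent it is
  always odd. Multiplication by \<open>1 - fps_X\<close> takes differences in \<open>a\<close>,
  which involve only the two newest letters.\<close>

lemma even_fps_ascent:
  assumes "n \<ge> 1" "\<pi> n < \<pi> (Suc n)"
  shows "even_fps (Suc n) \<pi> * (1 - fps_X) = even_fps n \<pi> * (1 + fps_X)"
    and "odd_fps (Suc n) \<pi> = even_fps (Suc n) \<pi> + even_fps n \<pi>"
proof -
  show "even_fps (Suc n) \<pi> * (1 - fps_X) = even_fps n \<pi> * (1 + fps_X)"
  proof (rule fps_ext)
    fix a show "fps_nth (even_fps (Suc n) \<pi> * (1 - fps_X)) a = fps_nth (even_fps n \<pi> * (1 + fps_X)) a"
      using assms
      by (cases a) (simp_all add: even_fps_def algebra_simps enriched_0_letters card_enriched_Suc)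
  qed
  show "odd_fps (Suc n) \<pi> = even_fps (Suc n) \<pi> + even_fps n \<pi>"
    using assms by (intro fps_ext) (simp add: even_fps_def odd_fps_def card_enriched_Suc)
qed

lemma even_fps_descent:
  assumes "n \<ge> 1" "\<not> \<pi> n < \<pi> (Suc n)"
  shows "even_fps (Suc n) \<pi> * (1 - fps_X) = 2 * fps_X * odd_fps n \<pi>"
    and "odd_fps (Suc n) \<pi> = even_fps (Suc n) \<pi> + odd_fps n \<pi>"
proof -
  show "even_fps (Suc n) \<pi> * (1 - fps_X) = 2 * fps_X * odd_fps n \<pi>"
  proof (rule fps_ext)
    fix a show "fps_nth (even_fps (Suc n) \<pi> * (1 - fps_X)) a = fps_nth (2 * fps_X * odd_fps n \<pi>) a"
      using assms
      by (cases a) (simp_all add: even_fps_def odd_fps_def algebra_simps enriched_0_letters card_enriched_Suc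
          numeral_fps_const mult.assoc)
  qed
  show "odd_fps (Suc n) \<pi> = even_fps (Suc n) \<pi> + odd_fps n \<pi>"
    using assms by (intro fps_ext) (simp add: even_fps_def odd_fps_def card_enriched_Suc)
qed

text \<open>A single letter satisfies the same relation between the two series as a word ending in a
  descent, so position 1 starts the induction on the length in the descending state.\<close>

lemma even_fps_1: "2 * fps_X * odd_fps 1 \<pi> = (1 + fps_X) * even_fps 1 \<pi>"
  "(1 - fps_X)\<^sup>2 * even_fps 1 \<pi> = 2 * fps_X"
proof -
  have "fps_nth (2 * (fps_X * odd_fps 1 \<pi>)) a = fps_nth ((1 + fps_X) * even_fps 1 \<pi>) a" for a
    by (cases a) (simp_all add: even_fps_def odd_fps_def card_enriched_1[simplified] algebra_simps numeral_fps_const)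
  then show "2 * fps_X * odd_fps 1 \<pi> = (1 + fps_X) * even_fps 1 \<pi>"
    by (simp add: fps_eq_iff mult.assoc)
  have "(1 - fps_X) * even_fps 1 \<pi> = Abs_fps (\<lambda>a. if a = 0 then 0 else 2)"
    by (rule fps_ext) (auto simp: even_fps_def card_enriched_1[simplified] algebra_simps)
  then have "(1 - fps_X)\<^sup>2 * even_fps 1 \<pi> = (1 - fps_X) * Abs_fps (\<lambda>a. if a = 0 then 0 else 2)"
    by (simp add: power2_eq_square mult.assoc)
  also have "\<dots> = 2 * fps_X"
  proof (rule fps_ext)
    fix a show "fps_nth ((1 - fps_X) * Abs_fps (\<lambda>a. if a = 0 then 0 else 2)) a = fps_nth (2 * fps_X :: real fps) a"
      by (cases a) (auto simp: algebra_simps numeral_fps_const)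
  qed
  finally show "(1 - fps_X)\<^sup>2 * even_fps 1 \<pi> = 2 * fps_X" .
qed

text \<open>The state of the induction is the ratio of the odd to the even series, which depends
  only on the type of the last step. A step that creates no peak multiplies the even series by
  \<open>(1 + X) / (1 - X)\<close>; a descent after an ascent brings a further factor
  \<open>4 * X / (1 + X) ^ 2\<close>. Denominators are cleared to stay within power series. After a
  final ascent the bound on the peak number reserves room for the peak that may still arise.\<close>

lemma even_fps_peaks:
  assumes "n \<ge> 1" "inj_on \<pi> {1..n}"
  shows "(1 + fps_X) ^ (2 * peaks n \<pi>) * (1 - fps_X) ^ (n + 1) * even_fps n \<pi>
           = 2 * fps_X * (4 * fps_X) ^ peaks n \<pi> * (1 + fps_X) ^ (n - 1)
       \<and> (if n \<ge> 2 \<and> \<pi> (n - 1) < \<pi> n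
          then odd_fps n \<pi> * (1 + fps_X) = 2 * even_fps n \<pi> \<and> 2 * peaks n \<pi> + 2 \<le> n
          else 2 * fps_X * odd_fps n \<pi> = (1 + fps_X) * even_fps n \<pi> \<and> 2 * peaks n \<pi> + 1 \<le> n)"
  using assms
proof (induction n rule: dec_induct)
  case base
  have "peaks (Suc 0) \<pi> = 0" by (auto simp: peaks_def)
  then show ?case using even_fps_1[of \<pi>] by (auto simp: numeral_2_eq_2[symmetric])
next
  case (step n)
  have inj: "inj_on \<pi> {1..n}" using step.prems by (rule inj_on_subset) auto
  note IH = step.IH[OF inj]
  have n1: "n \<ge> 1" using step by simp
  have neq: "\<pi> n \<noteq> \<pi> (Suc n)" using inj_onD[OF step.prems, of n "Suc n"] n1 by auto
  let ?X = "fps_X :: real fps"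
  let ?P = "even_fps n \<pi>" and ?P' = "even_fps (Suc n) \<pi>"
  let ?Q = "odd_fps n \<pi>" and ?Q' = "odd_fps (Suc n) \<pi>"
  let ?p = "peaks n \<pi>"
  have main: "(1 + ?X) ^ (2 * ?p) * (1 - ?X) ^ (n + 1) * ?P = 2 * ?X * (4 * ?X) ^ ?p * (1 + ?X) ^ (n - 1)"
    using IH by blast
  have pn: "(1 + ?X) ^ n = (1 + ?X) * (1 + ?X) ^ (n - 1)" using n1 by (cases n) auto
  have same: "(1 + ?X) ^ (2 * ?p) * (1 - ?X) ^ (Suc n + 1) * ?P' = 2 * ?X * (4 * ?X) ^ ?p * (1 + ?X) ^ n"
    if "?P' * (1 - ?X) = ?P * (1 + ?X)"
  proof -
    have "(1 + ?X) ^ (2 * ?p) * (1 - ?X) ^ (Suc n + 1) * ?P'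
        = (1 + ?X) ^ (2 * ?p) * (1 - ?X) ^ (n + 1) * (?P' * (1 - ?X))"
      by (simp add: mult_ac)
    also have "\<dots> = ((1 + ?X) ^ (2 * ?p) * (1 - ?X) ^ (n + 1) * ?P) * (1 + ?X)"
      unfolding that by (simp only: mult_ac)
    also have "\<dots> = 2 * ?X * (4 * ?X) ^ ?p * (1 + ?X) ^ n"
      unfolding main pn by (simp only: mult_ac)
    finally show ?thesis .
  qed
  show ?case
  proof (cases "\<pi> n < \<pi> (Suc n)")
    case True
    note asc = even_fps_ascent[OF n1 True]
    have "?Q' * (1 + ?X) = ?P' * (1 + ?X) + ?P * (1 + ?X)" unfolding asc(2) by (simp only: distrib_right)
    also have "\<dots> = ?P' * (1 + ?X) + ?P' * (1 - ?X)" unfolding asc(1) ..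
    also have "\<dots> = 2 * ?P'" by (simp add: algebra_simps)
    finally have Q: "?Q' * (1 + ?X) = 2 * ?P'" .
    have pk: "peaks (Suc n) \<pi> = ?p" using True by (simp add: peaks_Suc[OF n1])
    show ?thesis using same[OF asc(1)] Q True IH n1 unfolding pk by (auto split: if_splits)
  next
    case False
    note desc = even_fps_descent[OF n1 False]
    have "2 * ?X * ?Q' = 2 * ?X * ?P' + ?P' * (1 - ?X)" unfolding desc(2) desc(1) by (simp only: distrib_left)
    also have "\<dots> = (1 + ?X) * ?P'" by (simp add: algebra_simps)
    finally have Q: "2 * ?X * ?Q' = (1 + ?X) * ?P'" .
    show ?thesis
    proof (cases "n \<ge> 2 \<and> \<pi> (n - 1) < \<pi> n")
      case True
      then have pk: "peaks (Suc n) \<pi> = Suc ?p" using False neq by (simp add: peaks_Suc[OF n1])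
      have *: "?P' * (1 - ?X) * (1 + ?X) = 4 * ?X * ?P"
      proof -
        have "?P' * (1 - ?X) * (1 + ?X) = 2 * ?X * (?Q * (1 + ?X))" unfolding desc(1) by (simp only: mult_ac)
        also have "\<dots> = 4 * ?X * ?P" using IH True by simp
        finally show ?thesis .
      qed
      have "(1 + ?X) ^ (2 * Suc ?p) * (1 - ?X) ^ (Suc n + 1) * ?P'
        = (1 + ?X) ^ (2 * ?p) * (1 - ?X) ^ (n + 1) * (1 + ?X) * (?P' * (1 - ?X) * (1 + ?X))"
        by (simp add: mult_ac)
      also have "\<dots> = ((1 + ?X) ^ (2 * ?p) * (1 - ?X) ^ (n + 1) * ?P) * (1 + ?X) * (4 * ?X)"
        unfolding * by (simp only: mult_ac)
      also have "\<dots> = 2 * ?X * (4 * ?X) ^ Suc ?p * (1 + ?X) ^ n"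
        unfolding main pn by (simp add: mult_ac)
      finally show ?thesis using Q False True IH unfolding pk by simp
    next
      case nasc: False
      then have pk: "peaks (Suc n) \<pi> = ?p" by (auto simp: peaks_Suc[OF n1])
      have "?P' * (1 - ?X) = ?P * (1 + ?X)" using IH nasc unfolding desc(1) by (auto simp: mult.commute)
      from same[OF this] show ?thesis using Q False nasc IH unfolding pk by auto
    qed
  qed
qed

section \<open>The Euler operator and recurrences in the peak number and the length\<close>

definition fps_theta :: "real fps \<Rightarrow> real fps" where
  "fps_theta f = fps_X * fps_deriv f"

lemma fps_theta_nth: "fps_nth (fps_theta f) a = real a * fps_nth f a"
  by (cases a) (simp_all add: fps_theta_def)

lemma fps_theta_mult: "fps_theta (f * g) = fps_theta f * g + f * fps_theta g"
  by (simp add: fps_theta_def algebra_simps)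

lemma fps_theta_diff: "fps_theta (f - g) = fps_theta f - fps_theta g"
  by (simp add: fps_theta_def algebra_simps)

lemma fps_theta_of_nat_mult: "fps_theta (of_nat k * f) = of_nat k * fps_theta f"
  by (rule fps_ext) (simp add: fps_theta_nth fps_of_nat[symmetric])

lemma fps_theta_one: "fps_theta 1 = 0"
  by (simp add: fps_theta_def)

abbreviation geo :: "real fps" where "geo \<equiv> inverse (1 - fps_X)"

lemma geo_mult: "(1 - fps_X) * geo = 1"
  by (rule inverse_mult_eq_1') simp

lemma X_geo: "fps_X * geo = geo - 1"
  using geo_mult by (simp add: algebra_simps)

lemma fps_theta_geo: "fps_theta geo = geo * (geo - 1)"
proof -
  have "fps_theta ((1 - fps_X) * geo) = 0" by (simp only: geo_mult fps_theta_one)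
  then have "(1 - fps_X) * fps_theta geo = fps_X * geo"
    by (simp add: fps_theta_mult) (simp add: fps_theta_def algebra_simps)
  then have "geo * ((1 - fps_X) * fps_theta geo) = geo * (fps_X * geo)" by simp
  moreover have "geo * ((1 - fps_X) * fps_theta geo) = fps_theta geo"
    using geo_mult by (metis mult.assoc mult.commute mult_1)
  ultimately show ?thesis using X_geo by simp
qed

text \<open>The series for \<open>p\<close> peaks at length \<open>N + 2 * p + 1\<close>. With this
  split of the length, a step in \<open>N\<close> is a multiplication by
  \<open>(1 + X) / (1 - X)\<close> and a step in \<open>p\<close> at \<open>N = 0\<close> one by
  \<open>4 * X / (1 - X) ^ 2\<close>.\<close>

definition enriched_fps :: "nat \<Rightarrow> nat \<Rightarrow> real fps" where
  "enriched_fps p N = 2 * fps_X * (4 * fps_X) ^ p * (1 + fps_X) ^ N * geo ^ (N + 2 * p + 2)"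

lemma even_fps_eq_enriched_fps:
  assumes "n \<ge> 1" "inj_on \<pi> {1..n}"
  shows "2 * peaks n \<pi> + 1 \<le> n" "even_fps n \<pi> = enriched_fps (peaks n \<pi>) (n - 1 - 2 * peaks n \<pi>)"
proof -
  let ?X = "fps_X :: real fps"
  define p where "p = peaks n \<pi>"
  define F where "F = even_fps n \<pi>"
  show le: "2 * peaks n \<pi> + 1 \<le> n" using even_fps_peaks[OF assms] by (auto split: if_splits)
  define N where "N = n - 1 - 2 * p"
  have n: "n = N + 2 * p + 1" using le by (simp add: N_def p_def)
  have eq: "(1 + ?X) ^ (2 * p) * (1 - ?X) ^ (n + 1) * F = 2 * ?X * (4 * ?X) ^ p * (1 + ?X) ^ (n - 1)"
    using even_fps_peaks[OF assms] unfolding p_def F_def by blast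
  have "(1 + ?X) ^ (2 * p) * ((1 - ?X) ^ (n + 1) * F)
      = (1 + ?X) ^ (2 * p) * (2 * ?X * (4 * ?X) ^ p * (1 + ?X) ^ N)"
  proof -
    have "(1 + ?X) ^ (n - 1) = (1 + ?X) ^ (2 * p) * (1 + ?X) ^ N" by (simp add: n power_add mult.commute)
    then show ?thesis using eq by (simp only: mult_ac)
  qed
  moreover have "(1 + ?X) ^ (2 * p) \<noteq> 0"
  proof -
    have "fps_nth (1 + ?X) 0 \<noteq> 0" by simp
    then have "1 + ?X \<noteq> 0" by (metis fps_zero_nth)
    then show ?thesis by simp
  qed
  ultimately have 1: "(1 - ?X) ^ (n + 1) * F = 2 * ?X * (4 * ?X) ^ p * (1 + ?X) ^ N"
    using mult_cancel_left by blast
  have "F = geo ^ (n + 1) * ((1 - ?X) ^ (n + 1) * F)"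
  proof -
    have "geo ^ (n + 1) * (1 - ?X) ^ (n + 1) = 1"
      by (metis geo_mult mult.commute power_mult_distrib power_one)
    then show ?thesis by (metis mult.assoc mult_1)
  qed
  also have "\<dots> = enriched_fps p N"
    unfolding 1 enriched_fps_def by (simp add: n mult_ac)
  finally show "even_fps n \<pi> = enriched_fps (peaks n \<pi>) (n - 1 - 2 * peaks n \<pi>)"
    unfolding F_def N_def p_def .
qed

lemma one_plus_X_geo: "(1 + fps_X) * geo = 2 * geo - 1"
  using X_geo by (simp add: distrib_right)

text \<open>Put \<open>h = 2 * geo - 1\<close>, that is \<open>(1 + X) / (1 - X)\<close>. Then
  \<open>h ^ 2 - 1 = 4 * geo * (geo - 1)\<close> and \<open>fps_theta h = (h ^ 2 - 1) / 2\<close>;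
  the recurrences below rest on these two identities.\<close>

lemma enriched_fps_Suc: "enriched_fps p (Suc N) = (2 * geo - 1) * enriched_fps p N"
  by (simp add: enriched_fps_def mult_ac one_plus_X_geo[symmetric])

lemma enriched_fps_Suc_peak: "enriched_fps (Suc p) 0 = 4 * (geo * (geo - 1)) * enriched_fps p 0"
  by (simp add: enriched_fps_def mult_ac X_geo[symmetric])

lemma fps_theta_X: "fps_theta fps_X = fps_X"
  by (simp add: fps_theta_def)

lemma fps_theta_2: "fps_theta 2 = 0" "fps_theta 4 = 0"
  by (simp_all add: fps_theta_def numeral_fps_const)

lemma fps_theta_enriched_fps:
  "fps_theta (enriched_fps p 0) = of_nat (p + 1) * (2 * geo - 1) * enriched_fps p 0"
proof (induction p)
  case 0
  show ?case
    by (simp add: enriched_fps_def fps_theta_mult fps_theta_2 fps_theta_X fps_theta_geo numeral_2_eq_2)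
       (simp add: algebra_simps)
next
  case (Suc p)
  show ?case
    unfolding enriched_fps_Suc_peak
    by (simp add: fps_theta_mult fps_theta_diff fps_theta_one fps_theta_2 fps_theta_geo Suc)
       (simp add: algebra_simps)
qed

text \<open>From \<open>fps_theta V = (p + 1) * h * V\<close> a second application gives
  \<open>(p + 1) * ((p + 1) * h ^ 2 + (h ^ 2 - 1) / 2) * V\<close>. Subtracting
  \<open>(p + 1) ^ 2 * V\<close> leaves a multiple of \<open>h ^ 2 - 1\<close>, which is exactly one
  more peak. On coefficients this is the factor \<open>4 * (a ^ 2 - (p + 1) ^ 2)\<close>, the origin
  of the product in \<open>weight\<close>.\<close>

lemma enriched_fps_peak_rec:
  "of_nat ((2 * p + 2) * (2 * p + 3)) * enriched_fps (Suc p) 0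
     = 4 * (fps_theta (fps_theta (enriched_fps p 0)) - of_nat ((p + 1)\<^sup>2) * enriched_fps p 0)"
proof -
  let ?V = "enriched_fps p 0"
  have 1: "fps_theta (2 * geo - 1) = 2 * (geo * (geo - 1))"
    by (simp add: fps_theta_mult fps_theta_diff fps_theta_one fps_theta_2 fps_theta_geo)
  have "fps_theta (fps_theta ?V) = of_nat (p + 1) * fps_theta ((2 * geo - 1) * ?V)"
    unfolding fps_theta_enriched_fps mult.assoc by (rule fps_theta_of_nat_mult)
  also have "fps_theta ((2 * geo - 1) * ?V) = 2 * (geo * (geo - 1)) * ?V
       + (2 * geo - 1) * (of_nat (p + 1) * (2 * geo - 1) * ?V)"
    unfolding fps_theta_mult[of "2 * geo - 1"] 1 fps_theta_enriched_fps ..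
  finally have 2: "fps_theta (fps_theta ?V) = of_nat (p + 1) * (2 * (geo * (geo - 1)) * ?V
       + (2 * geo - 1) * (of_nat (p + 1) * (2 * geo - 1) * ?V))" .
  show ?thesis unfolding 2 enriched_fps_Suc_peak
    by (simp add: algebra_simps power2_eq_square)
qed

lemma enriched_fps_theta_general:
  "fps_theta (enriched_fps p (Suc N)) = (2 * (geo * (geo - 1))) * enriched_fps p N
     + (2 * geo - 1) * fps_theta (enriched_fps p N)"
  unfolding enriched_fps_Suc
  by (simp add: fps_theta_mult fps_theta_diff fps_theta_one fps_theta_2 fps_theta_geo)

text \<open>Differentiate \<open>h ^ N * V\<close>, where \<open>V\<close> is the series for
  \<open>N = 0\<close>. The spare factor \<open>h\<close> avoids an inverse of \<open>h\<close> and
  lets the induction start at \<open>N = 0\<close>; it is cancelled in the two lemmas that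
  follow.\<close>

lemma enriched_fps_rec_aux:
  "of_nat (N + 2 * p + 2) * enriched_fps p (Suc N) * (2 * geo - 1)
     = 2 * (2 * geo - 1) * fps_theta (enriched_fps p N) + of_nat N * enriched_fps p N"
proof (induction N)
  case 0
  show ?case by (simp add: enriched_fps_Suc fps_theta_enriched_fps algebra_simps)
next
  case (Suc N)
  let ?h = "2 * geo - 1" and ?V = "enriched_fps p N"
  have "of_nat (Suc N + 2 * p + 2) * enriched_fps p (Suc (Suc N)) * ?h
     = ?h * (of_nat (N + 2 * p + 2) * enriched_fps p (Suc N) * ?h) + ?h * ?h * enriched_fps p (Suc N)"
    by (simp only: enriched_fps_Suc of_nat_add of_nat_Suc) (simp add: algebra_simps)
  also have "\<dots> = ?h * (2 * ?h * fps_theta ?V + of_nat N * ?V) + ?h * ?h * enriched_fps p (Suc N)"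
    by (simp only: Suc)
  also have "\<dots> = 2 * ?h * fps_theta (enriched_fps p (Suc N)) + of_nat (Suc N) * enriched_fps p (Suc N)"
    unfolding enriched_fps_theta_general unfolding enriched_fps_Suc by (simp add: algebra_simps)
  finally show ?case .
qed

lemma two_geo_minus_one_neq_0: "2 * geo - 1 \<noteq> 0"
proof -
  have "fps_nth (2 * geo - 1) 0 \<noteq> 0" by (simp add: numeral_fps_const)
  then show ?thesis by (metis fps_zero_nth)
qed

lemma enriched_fps_rec_0:
  "of_nat (2 * p + 2) * enriched_fps p 1 = 2 * fps_theta (enriched_fps p 0)"
proof -
  have "(2 * geo - 1) * (of_nat (2 * p + 2) * enriched_fps p 1) = (2 * geo - 1) * (2 * fps_theta (enriched_fps p 0))"
    using enriched_fps_rec_aux[of 0 p] by (simp add: mult_ac)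
  then show ?thesis using two_geo_minus_one_neq_0 mult_cancel_left by blast
qed

lemma enriched_fps_rec_Suc:
  "of_nat (N + 2 * p + 3) * enriched_fps p (N + 2)
     = 2 * fps_theta (enriched_fps p (Suc N)) + of_nat (Suc N) * enriched_fps p N"
proof -
  have "(2 * geo - 1) * (of_nat (N + 2 * p + 3) * enriched_fps p (N + 2))
     = (2 * geo - 1) * (2 * fps_theta (enriched_fps p (Suc N)) + of_nat (Suc N) * enriched_fps p N)"
    using enriched_fps_rec_aux[of "Suc N" p] unfolding enriched_fps_Suc[of p N]
    by (simp add: algebra_simps)
  then show ?thesis using two_geo_minus_one_neq_0 mult_cancel_left by blast
qed

text \<open>The coefficients of \<open>enriched_fps\<close> divided by
  \<open>(2 * a) ^ n / n!\<close>: after this scaling the number of letters enters only through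
  \<open>e\<close>. The two initial values agree because the step from \<open>N = 0\<close> to
  \<open>N = 1\<close> has no second term.\<close>

fun weight :: "real \<Rightarrow> nat \<Rightarrow> nat \<Rightarrow> real" where
  "weight e p 0 = (\<Prod>l=1..p. 1 - 4 * e * (real l)\<^sup>2)"
| "weight e p (Suc 0) = (\<Prod>l=1..p. 1 - 4 * e * (real l)\<^sup>2)"
| "weight e p (Suc (Suc N)) = weight e p (Suc N)
     + e * real ((N + 1) * (N + 2 * p + 2)) * weight e p N"

lemma enriched_fps_weight_0:
  assumes "a \<ge> 1"
  shows "fact (2 * p + 1) * fps_nth (enriched_fps p 0) a
           = (2 * real a) ^ (2 * p + 1) * weight (1 / (2 * real a)\<^sup>2) p 0"
proof (induction p)
  case 0
  have "fps_nth (enriched_fps 0 0) a = 2 * real a"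
  proof -
    have g: "enriched_fps 0 0 = 2 * fps_theta geo"
      by (simp add: enriched_fps_def fps_theta_geo X_geo[symmetric] power2_eq_square mult_ac)
    have geo1: "fps_nth geo a = 1"
    proof -
      have "geo = Abs_fps (\<lambda>n. 1)" using fps_inverse_gp'[where 'a = real]
        by (metis fps_inverse_idempotent fps_nth_Abs_fps one_neq_zero)
      then show ?thesis by simp
    qed
    show ?thesis unfolding g by (simp add: fps_theta_nth numeral_fps_const geo1)
  qed
  then show ?case by simp
next
  case (Suc p)
  let ?v = "\<lambda>p. fps_nth (enriched_fps p 0) a"
  have "fps_nth (of_nat ((2 * p + 2) * (2 * p + 3)) * enriched_fps (Suc p) 0) a
     = fps_nth (4 * (fps_theta (fps_theta (enriched_fps p 0)) - of_nat ((p + 1)\<^sup>2) * enriched_fps p 0)) a"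
    by (simp only: enriched_fps_peak_rec)
  then have rec: "real ((2 * p + 2) * (2 * p + 3)) * ?v (Suc p) = 4 * ((real a)\<^sup>2 - (real (p + 1))\<^sup>2) * ?v p"
    unfolding fps_of_nat[symmetric]
    by (simp add: numeral_fps_const fps_theta_nth power2_eq_square del: fps_const_add fps_const_mult of_nat_add of_nat_mult of_nat_Suc)
       (simp add: algebra_simps)
  have "fact (2 * Suc p + 1) * ?v (Suc p) = fact (2 * p + 1) * (real ((2 * p + 2) * (2 * p + 3)) * ?v (Suc p))"
    by (simp add: algebra_simps)
  also have "\<dots> = 4 * ((real a)\<^sup>2 - (real (p + 1))\<^sup>2) * (fact (2 * p + 1) * ?v p)"
    unfolding rec by (simp only: mult_ac)
  also have "\<dots> = 4 * ((real a)\<^sup>2 - (real (p + 1))\<^sup>2) * (2 * real a) ^ (2 * p + 1) * weight (1 / (2 * real a)\<^sup>2) p 0"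
    unfolding Suc by (simp only: mult_ac)
  also have "4 * ((real a)\<^sup>2 - (real (p + 1))\<^sup>2) = (2 * real a)\<^sup>2 * (1 - 4 * (1 / (2 * real a)\<^sup>2) * (real (p + 1))\<^sup>2)"
    using assms by (simp add: field_simps power2_eq_square)
  finally show ?case by (simp add: mult_ac power2_eq_square)
qed

lemma enriched_fps_weight:
  assumes "a \<ge> 1"
  shows "fact (N + 2 * p + 1) * fps_nth (enriched_fps p N) a
           = (2 * real a) ^ (N + 2 * p + 1) * weight (1 / (2 * real a)\<^sup>2) p N"
proof (induction "1 / (2 * real a)\<^sup>2" p N rule: weight.induct)
  case (1 p)
  then show ?case using enriched_fps_weight_0[OF assms, of p] by simp
next
  case (2 p)
  let ?v = "\<lambda>N. fps_nth (enriched_fps p N) a"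
  have "fps_nth (of_nat (2 * p + 2) * enriched_fps p 1) a = fps_nth (2 * fps_theta (enriched_fps p 0)) a"
    by (simp only: enriched_fps_rec_0)
  then have rec: "real (2 * p + 2) * ?v (Suc 0) = 2 * real a * ?v 0"
    unfolding fps_of_nat[symmetric] by (simp add: numeral_fps_const fps_theta_nth)
  have "fact (Suc 0 + 2 * p + 1) * ?v (Suc 0) = fact (2 * p + 1) * (real (2 * p + 2) * ?v (Suc 0))"
    by (simp add: algebra_simps)
  also have "\<dots> = 2 * real a * (fact (2 * p + 1) * ?v 0)" unfolding rec by (simp only: mult_ac)
  also have "\<dots> = (2 * real a) ^ (Suc 0 + 2 * p + 1) * weight (1 / (2 * real a)\<^sup>2) p (Suc 0)"
    unfolding enriched_fps_weight_0[OF assms] by simp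
  finally show ?case .
next
  case (3 p N)
  let ?v = "\<lambda>N. fps_nth (enriched_fps p N) a"
  let ?w = "weight (1 / (2 * real a)\<^sup>2) p"
  have "fps_nth (of_nat (N + 2 * p + 3) * enriched_fps p (N + 2)) a
      = fps_nth (2 * fps_theta (enriched_fps p (Suc N)) + of_nat (Suc N) * enriched_fps p N) a"
    by (simp only: enriched_fps_rec_Suc)
  then have rec: "real (N + 2 * p + 3) * ?v (Suc (Suc N)) = 2 * real a * ?v (Suc N) + real (Suc N) * ?v N"
    unfolding fps_of_nat[symmetric] by (simp add: numeral_fps_const fps_theta_nth)
  have "fact (Suc (Suc N) + 2 * p + 1) * ?v (Suc (Suc N))
     = fact (Suc N + 2 * p + 1) * (real (N + 2 * p + 3) * ?v (Suc (Suc N)))"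
    by (simp add: algebra_simps)
  also have "\<dots> = 2 * real a * (fact (Suc N + 2 * p + 1) * ?v (Suc N))
       + real (Suc N) * real (N + 2 * p + 2) * (fact (N + 2 * p + 1) * ?v N)"
    unfolding rec by (simp add: algebra_simps)
  also have "\<dots> = 2 * real a * ((2 * real a) ^ (Suc N + 2 * p + 1) * ?w (Suc N))
       + real (Suc N) * real (N + 2 * p + 2) * ((2 * real a) ^ (N + 2 * p + 1) * ?w N)"
    using 3 by simp
  also have "\<dots> = (2 * real a) ^ (Suc (Suc N) + 2 * p + 1) * ?w (Suc (Suc N))"
    using assms by (simp add: field_simps power2_eq_square)
  finally show ?case .
qed

lemma card_enriched_weight:
  assumes "n \<ge> 1" "inj_on \<pi> {1..n}" "a \<ge> 1"
  shows "fact n * real (card (enriched n \<pi> (2 * a))) = (2 * real a) ^ n *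
           weight (1 / (2 * real a)\<^sup>2) (peaks n \<pi>) (n - 1 - 2 * peaks n \<pi>)"
proof -
  have "real (card (enriched n \<pi> (2 * a))) = fps_nth (even_fps n \<pi>) a" by (simp add: even_fps_def)
  also have "\<dots> = fps_nth (enriched_fps (peaks n \<pi>) (n - 1 - 2 * peaks n \<pi>)) a"
    using even_fps_eq_enriched_fps[OF assms(1,2)] by simp
  finally show ?thesis
    using enriched_fps_weight[OF assms(3), of "n - 1 - 2 * peaks n \<pi>" "peaks n \<pi>"]
      even_fps_eq_enriched_fps(1)[OF assms(1,2)] by simp
qed

section \<open>Asymptotics of the weights\<close>

lemma ln_one_plus_bounds:
  assumes "0 \<le> (x::real)"
  shows "x - x\<^sup>2 / 2 \<le> ln (1 + x)" "ln (1 + x) \<le> x - x\<^sup>2 / 2 + x ^ 3 / 3"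
proof -
  have "(\<lambda>x. ln (1 + x) - x + x\<^sup>2 / 2) 0 \<le> (\<lambda>x. ln (1 + x) - x + x\<^sup>2 / 2) x"
  proof (rule DERIV_nonneg_imp_nondecreasing[OF assms])
    fix y :: real assume y: "0 \<le> y" "y \<le> x"
    have "((\<lambda>x. ln (1 + x) - x + x\<^sup>2 / 2) has_real_derivative (1 / (1 + y) - 1 + y)) (at y)"
      using y by (auto intro!: derivative_eq_intros)
    moreover have "1 / (1 + y) - 1 + y = y\<^sup>2 / (1 + y)" using y by (simp add: field_simps power2_eq_square)
    ultimately show "\<exists>d. ((\<lambda>x. ln (1 + x) - x + x\<^sup>2 / 2) has_real_derivative d) (at y) \<and> 0 \<le> d"
      using y by (intro exI[of _ "y\<^sup>2 / (1 + y)"]) auto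
  qed
  then show "x - x\<^sup>2 / 2 \<le> ln (1 + x)" by simp
  have "(\<lambda>x. x - x\<^sup>2 / 2 + x ^ 3 / 3 - ln (1 + x)) 0 \<le> (\<lambda>x. x - x\<^sup>2 / 2 + x ^ 3 / 3 - ln (1 + x)) x"
  proof (rule DERIV_nonneg_imp_nondecreasing[OF assms])
    fix y :: real assume y: "0 \<le> y" "y \<le> x"
    have "((\<lambda>x. x - x\<^sup>2 / 2 + x ^ 3 / 3 - ln (1 + x)) has_real_derivative (1 - y + y\<^sup>2 - 1 / (1 + y))) (at y)"
      using y by (auto intro!: derivative_eq_intros)
    moreover have "1 - y + y\<^sup>2 - 1 / (1 + y) = y ^ 3 / (1 + y)"
      using y by (simp add: field_simps power2_eq_square power3_eq_cube)
    ultimately show "\<exists>d. ((\<lambda>x. x - x\<^sup>2 / 2 + x ^ 3 / 3 - ln (1 + x)) has_real_derivative d) (at y) \<and> 0 \<le> d"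
      using y by (intro exI[of _ "y ^ 3 / (1 + y)"]) auto
  qed
  then show "ln (1 + x) \<le> x - x\<^sup>2 / 2 + x ^ 3 / 3" by simp
qed

lemma ln_one_minus_bounds:
  assumes "0 \<le> (x::real)" "x \<le> 1 / 2"
  shows "ln (1 - x) \<le> - x - x\<^sup>2 / 2" "- x - x\<^sup>2 / 2 - x ^ 3 \<le> ln (1 - x)"
proof -
  have "(\<lambda>x. - x - x\<^sup>2 / 2 - ln (1 - x)) 0 \<le> (\<lambda>x. - x - x\<^sup>2 / 2 - ln (1 - x)) x"
  proof (rule DERIV_nonneg_imp_nondecreasing[OF assms(1)])
    fix y :: real assume y: "0 \<le> y" "y \<le> x"
    have "((\<lambda>x. - x - x\<^sup>2 / 2 - ln (1 - x)) has_real_derivative (1 / (1 - y) - 1 - y)) (at y)"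
      using y assms by (auto intro!: derivative_eq_intros)
    moreover have "1 / (1 - y) - 1 - y = y\<^sup>2 / (1 - y)"
      using y assms by (simp add: field_simps power2_eq_square)
    ultimately show "\<exists>d. ((\<lambda>x. - x - x\<^sup>2 / 2 - ln (1 - x)) has_real_derivative d) (at y) \<and> 0 \<le> d"
      using y assms by (intro exI[of _ "y\<^sup>2 / (1 - y)"]) auto
  qed
  then show "ln (1 - x) \<le> - x - x\<^sup>2 / 2" by simp
  have "(\<lambda>x. ln (1 - x) + x + x\<^sup>2 / 2 + x ^ 3) 0 \<le> (\<lambda>x. ln (1 - x) + x + x\<^sup>2 / 2 + x ^ 3) x"
  proof (rule DERIV_nonneg_imp_nondecreasing[OF assms(1)])
    fix y :: real assume y: "0 \<le> y" "y \<le> x"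
    have "((\<lambda>x. ln (1 - x) + x + x\<^sup>2 / 2 + x ^ 3) has_real_derivative (1 + y + 3 * y\<^sup>2 - 1 / (1 - y))) (at y)"
      using y assms by (auto intro!: derivative_eq_intros)
    moreover have "1 + y + 3 * y\<^sup>2 - 1 / (1 - y) = y\<^sup>2 * (2 - 3 * y) / (1 - y)"
      using y assms by (simp add: field_simps power2_eq_square)
    ultimately show "\<exists>d. ((\<lambda>x. ln (1 - x) + x + x\<^sup>2 / 2 + x ^ 3) has_real_derivative d) (at y) \<and> 0 \<le> d"
      using y assms by (intro exI[of _ "y\<^sup>2 * (2 - 3 * y) / (1 - y)"]) auto
  qed
  then show "- x - x\<^sup>2 / 2 - x ^ 3 \<le> ln (1 - x)" by simp
qed

lemma inverse_one_plus_bounds: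
  assumes "0 \<le> (u::real)"
  shows "1 - u \<le> 1 / (1 + u)" "1 / (1 + u) \<le> 1 - u + u\<^sup>2"
proof -
  have "(1 - u) * (1 + u) \<le> 1" using assms by (simp add: algebra_simps)
  then show "1 - u \<le> 1 / (1 + u)" using assms by (simp add: pos_le_divide_eq)
  have "1 \<le> (1 - u + u\<^sup>2) * (1 + u)" using assms by (simp add: algebra_simps power2_eq_square)
  then show "1 / (1 + u) \<le> 1 - u + u\<^sup>2" using assms by (simp add: pos_divide_le_eq)
qed

text \<open>Sum the two-term expansion of \<open>ln (1 - 4 * e * l ^ 2)\<close> over
  \<open>l\<close>. The three error terms per factor are the cubic remainder of the logarithm and
  the errors of replacing the sums of \<open>l ^ 2\<close> and \<open>l ^ 4\<close> by
  \<open>p ^ 3 / 3\<close> and \<open>p ^ 5 / 5\<close>. The bound \<open>2 * p \<le> n\<close>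
  gives \<open>4 * e * l ^ 2 \<le> e * n ^ 2\<close>.\<close>

lemma weight_0_asymp:
  assumes e: "0 \<le> e" and n: "1 \<le> n" and h: "e * n\<^sup>2 \<le> 1 / 8" and p: "2 * real p \<le> n"
  shows "weight e p 0 > 0 \<and> \<bar>ln (weight e p 0) - (- 4 * e * real p ^ 3 / 3 - 8 * e\<^sup>2 * real p ^ 5 / 5)\<bar>
           \<le> real p * ((e * n\<^sup>2) ^ 3 + 4 * e * n + 8 * e\<^sup>2 * n ^ 3)"
  using p
proof (induction p)
  case (Suc p)
  define l where "l = real (Suc p)"
  have l: "1 \<le> l" "2 * l \<le> n" using Suc.prems by (auto simp: l_def)
  define x where "x = 4 * e * l\<^sup>2"
  define H where "H = e * n\<^sup>2"
  have l2: "4 * l\<^sup>2 \<le> n\<^sup>2"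
  proof -
    have "(2 * l)\<^sup>2 \<le> n\<^sup>2" using l by (intro power_mono) auto
    then show ?thesis by (simp add: power_mult_distrib)
  qed
  have x: "0 \<le> x" "x \<le> H" "x \<le> 1 / 2"
  proof -
    show "0 \<le> x" using e by (simp add: x_def)
    have "e * (4 * l\<^sup>2) \<le> e * n\<^sup>2" using l2 e by (rule mult_left_mono)
    then show "x \<le> H" by (simp add: x_def H_def mult_ac)
    then show "x \<le> 1 / 2" using h by (simp add: H_def)
  qed
  have IH: "weight e p 0 > 0" "\<bar>ln (weight e p 0) - (- 4 * e * real p ^ 3 / 3 - 8 * e\<^sup>2 * real p ^ 5 / 5)\<bar>
           \<le> real p * (H ^ 3 + 4 * e * n + 8 * e\<^sup>2 * n ^ 3)"
    using Suc unfolding H_def by auto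
  have w: "weight e (Suc p) 0 = weight e p 0 * (1 - x)"
    by (simp add: x_def l_def)
  have pos: "weight e (Suc p) 0 > 0" unfolding w using IH(1) x by simp
  have lnw: "ln (weight e (Suc p) 0) = ln (weight e p 0) + ln (1 - x)"
    unfolding w using IH(1) x by (simp add: ln_mult del: weight.simps)
  have x3: "x ^ 3 \<le> H ^ 3" using x by (intro power_mono) auto
  have lnx: "\<bar>ln (1 - x) - (- x - x\<^sup>2 / 2)\<bar> \<le> H ^ 3"
    using ln_one_minus_bounds[OF x(1,3)] x3 by linarith
  have rp: "real p = l - 1" by (simp add: l_def)
  have 1: "\<bar>4 * e * (l\<^sup>2 - l ^ 3 / 3 + (l - 1) ^ 3 / 3)\<bar> \<le> 4 * e * n"
  proof -
    have "l\<^sup>2 - l ^ 3 / 3 + (l - 1) ^ 3 / 3 = l - 1 / 3"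
      by (simp add: field_simps power2_eq_square power3_eq_cube)
    then show ?thesis using l e by (simp add: abs_mult mult_left_mono)
  qed
  have 2: "\<bar>8 * e\<^sup>2 * (l ^ 4 - l ^ 5 / 5 + (l - 1) ^ 5 / 5)\<bar> \<le> 8 * e\<^sup>2 * n ^ 3"
  proof -
    have eq: "l ^ 4 - l ^ 5 / 5 + (l - 1) ^ 5 / 5 = 2 * l ^ 3 - 2 * l\<^sup>2 + l - 1 / 5"
      by (simp add: field_simps eval_nat_numeral)
    have a: "l \<le> l\<^sup>2" "l\<^sup>2 \<le> l ^ 3" using l power_increasing[of 1 2 l] power_increasing[of 2 3 l] by auto
    have "(2 * l) ^ 3 \<le> n ^ 3" using l by (intro power_mono) auto
    then have "8 * l ^ 3 \<le> n ^ 3" by (simp add: power_mult_distrib)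
    then have "\<bar>l ^ 4 - l ^ 5 / 5 + (l - 1) ^ 5 / 5\<bar> \<le> n ^ 3" unfolding eq using a l by linarith
    then show ?thesis by (simp add: abs_mult mult_left_mono)
  qed
  have xx: "- x - x\<^sup>2 / 2 = - 4 * e * l\<^sup>2 - 8 * e\<^sup>2 * l ^ 4"
    by (simp add: x_def power_mult_distrib)
  have key: "ln (weight e (Suc p) 0) - (- 4 * e * l ^ 3 / 3 - 8 * e\<^sup>2 * l ^ 5 / 5)
     = (ln (weight e p 0) - (- 4 * e * (l - 1) ^ 3 / 3 - 8 * e\<^sup>2 * (l - 1) ^ 5 / 5))
       + (ln (1 - x) - (- x - x\<^sup>2 / 2)) - 4 * e * (l\<^sup>2 - l ^ 3 / 3 + (l - 1) ^ 3 / 3)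
       - 8 * e\<^sup>2 * (l ^ 4 - l ^ 5 / 5 + (l - 1) ^ 5 / 5)"
    unfolding lnw xx by (simp add: algebra_simps)
  have "\<bar>ln (weight e (Suc p) 0) - (- 4 * e * l ^ 3 / 3 - 8 * e\<^sup>2 * l ^ 5 / 5)\<bar>
     \<le> (l - 1) * (H ^ 3 + 4 * e * n + 8 * e\<^sup>2 * n ^ 3) + H ^ 3 + 4 * e * n + 8 * e\<^sup>2 * n ^ 3"
    unfolding key using IH(2) lnx 1 2 unfolding rp by linarith
  also have "\<dots> = l * (H ^ 3 + 4 * e * n + 8 * e\<^sup>2 * n ^ 3)" by (simp add: algebra_simps)
  finally show ?case using pos unfolding l_def H_def by blast
qed simp

text \<open>Dividing the recurrence by the previous weight gives the continued fraction
  \<open>v = d / (1 + u)\<close> for successive ratios \<open>1 + u\<close> and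
  \<open>1 + v\<close>. The crude bounds on \<open>u\<close> carry the induction; inserted once into
  \<open>1 / (1 + u)\<close> they give the ratio to second order.\<close>

lemma weight_ratio:
  assumes e: "0 \<le> e" and n: "1 \<le> n" and h: "e * n\<^sup>2 \<le> 1 / 8" and "real N + 2 * real p + 1 \<le> n"
  shows "weight e p N > 0 \<and> (\<exists>u\<ge>0. weight e p (Suc N) = weight e p N * (1 + u)
     \<and> u \<le> e * (real N * (real N + 2 * real p + 1))
     \<and> e * (real N * (real N + 2 * real p + 1)) - (e * n\<^sup>2)\<^sup>2 \<le> u
     \<and> \<bar>u - (e * (real N * (real N + 2 * real p + 1)) - (e * (real N * (real N + 2 * real p + 1)))\<^sup>2)\<bar>
         \<le> 2 * (e * n\<^sup>2) ^ 3 + 2 * e\<^sup>2 * n ^ 3)"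
  using assms(4)
proof (induction N)
  case 0
  have "weight e p 0 > 0" using weight_0_asymp[OF e n h, of p] 0 by simp
  then show ?case using e n by (intro conjI exI[of _ 0]) auto
next
  case (Suc N)
  define H where "H = e * n\<^sup>2"
  define c where "c = e * (real N * (real N + 2 * real p + 1))"
  define d where "d = e * (real (Suc N) * (real (Suc N) + 2 * real p + 1))"
  obtain u where w: "weight e p N > 0" and u: "u \<ge> 0" "weight e p (Suc N) = weight e p N * (1 + u)"
      "u \<le> c" "c - H\<^sup>2 \<le> u"
    using Suc unfolding c_def H_def by auto
  have H: "0 \<le> H" "H \<le> 1 / 8" using e h by (auto simp: H_def)
  have cd: "0 \<le> c" "c \<le> d" "d \<le> H"
  proof -
    show "0 \<le> c" using e by (simp add: c_def)
    show "c \<le> d" unfolding c_def d_def by (intro mult_left_mono e mult_mono) auto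
    have "real (Suc N) * (real (Suc N) + 2 * real p + 1) \<le> n * n"
      using Suc.prems by (intro mult_mono) auto
    then show "d \<le> H" unfolding d_def H_def power2_eq_square by (intro mult_left_mono e)
  qed
  define v where "v = d / (1 + u)"
  have pos: "weight e p (Suc N) > 0" using w u by (simp add: add_pos_nonneg)
  have step: "weight e p (Suc (Suc N)) = weight e p (Suc N) * (1 + v)"
  proof -
    have "weight e p (Suc (Suc N)) = weight e p (Suc N) + d * weight e p N"
      by (simp add: d_def algebra_simps)
    also have "d * weight e p N = weight e p (Suc N) * v" using u(1) unfolding u(2) v_def by (simp add: add_nonneg_eq_0_iff)
    finally show ?thesis by (simp add: algebra_simps)
  qed
  have v0: "v \<ge> 0" using cd u by (simp add: v_def)
  have vu: "d * (1 - u) \<le> v" "v \<le> d * (1 - u + u\<^sup>2)"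
    using mult_left_mono[OF inverse_one_plus_bounds(1)[OF u(1)], of d]
          mult_left_mono[OF inverse_one_plus_bounds(2)[OF u(1)], of d] cd
    by (auto simp: v_def)
  have v1: "v \<le> d" using u cd by (simp add: v_def divide_le_eq mult_le_cancel_left1)
  have du: "d * u \<le> H\<^sup>2" unfolding power2_eq_square using cd u H by (intro mult_mono) auto
  have v2: "d - H\<^sup>2 \<le> v" using vu(1) du by (simp add: algebra_simps)
  \<comment> \<open>The first-order value of \<open>v\<close> is \<open>d\<close>, but its
    correction involves \<open>u\<close>, whose first-order value is the previous one
    \<open>c\<close>. Neighbouring values differ by at most \<open>2 * e * n\<close>, so
    \<open>d * c\<close> may be replaced by \<open>d * d\<close>.\<close>
  have dc: "d * d - d * c \<le> 2 * e\<^sup>2 * n ^ 3"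
  proof -
    have "d - c = e * (2 * real N + 2 * real p + 2)"
      by (simp add: d_def c_def algebra_simps)
    also have "\<dots> \<le> e * (2 * n)" using Suc.prems by (intro mult_left_mono e) auto
    finally have "d * (d - c) \<le> (e * n\<^sup>2) * (e * (2 * n))"
      using cd H by (intro mult_mono) (auto simp: H_def)
    also have "\<dots> = 2 * e\<^sup>2 * n ^ 3" by (simp add: power2_eq_square power3_eq_cube)
    finally show ?thesis by (simp add: algebra_simps)
  qed
  have uu: "d * u\<^sup>2 \<le> H ^ 3"
  proof -
    have "d * u\<^sup>2 \<le> H * H\<^sup>2" using cd u H by (intro mult_mono power_mono) auto
    then show ?thesis by (simp add: power3_eq_cube power2_eq_square)
  qed
  have dH: "d * H\<^sup>2 \<le> H ^ 3"
    using mult_right_mono[OF cd(3), of "H\<^sup>2"] by (simp add: power3_eq_cube power2_eq_square)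
  have "d * (c - H\<^sup>2) \<le> d * u" "d * u \<le> d * c" "d * c \<le> d * d"
    using u cd by (auto intro!: mult_left_mono)
  then have v3: "\<bar>v - (d - d\<^sup>2)\<bar> \<le> 2 * H ^ 3 + 2 * e\<^sup>2 * n ^ 3"
    using vu dc uu dH H unfolding power2_eq_square[of d]
    by (simp add: algebra_simps abs_le_iff)
  show ?case using pos step v0 v1 v2 v3 unfolding d_def H_def by blast
qed

text \<open>With \<open>u = c - c ^ 2\<close> the expansion
  \<open>ln (1 + u) = u - u ^ 2 / 2\<close> gives \<open>c - 3 / 2 * c ^ 2\<close>, hence the
  constant 3/2. \<open>A\<close> is the antiderivative of \<open>f - 3 / 2 * f ^ 2\<close> for
  \<open>f x = e * x * (x + 2 * p)\<close>.\<close>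

lemma weight_step_asymp:
  fixes n :: real
  assumes e: "0 \<le> e" and n: "1 \<le> n" and h: "e * n\<^sup>2 \<le> 1 / 8" and N: "real N + 2 * real p + 1 \<le> n"
  defines "A \<equiv> (\<lambda>x. e * (x ^ 3 / 3 + real p * x\<^sup>2)
       - 3 / 2 * e\<^sup>2 * (x ^ 5 / 5 + real p * x ^ 4 + 4 / 3 * (real p)\<^sup>2 * x ^ 3))"
  defines "E \<equiv> 4 * (e * n\<^sup>2) ^ 3 + 14 * e\<^sup>2 * n ^ 3 + e * n"
  shows "weight e p N > 0" "weight e p (Suc N) > 0"
    "\<bar>ln (weight e p (Suc N)) - ln (weight e p N) - (A (real N + 1) - A (real N))\<bar> \<le> E"
    "0 \<le> ln (weight e p (Suc N)) - ln (weight e p N)"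
    "ln (weight e p (Suc N)) - ln (weight e p N) \<le> e * n\<^sup>2"
proof -
  define H where "H = e * n\<^sup>2"
  define x where "x = real N"
  define q where "q = real p"
  define c where "c = x * (x + 2 * q + 1)"
  obtain u where w: "weight e p N > 0" and u: "u \<ge> 0" "weight e p (Suc N) = weight e p N * (1 + u)"
      "u \<le> e * c" "e * c - H\<^sup>2 \<le> u" "\<bar>u - (e * c - (e * c)\<^sup>2)\<bar> \<le> 2 * H ^ 3 + 2 * e\<^sup>2 * n ^ 3"
    using weight_ratio[OF e n h N] unfolding c_def H_def x_def q_def by auto
  have H: "0 \<le> H" "H \<le> 1 / 8" using e h by (auto simp: H_def)
  have xq: "0 \<le> x" "0 \<le> q" "x + 2 * q + 1 \<le> n" using N by (auto simp: x_def q_def)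
  have "c \<le> n * n" unfolding c_def using xq by (intro mult_mono) auto
  then have cH: "0 \<le> e * c" "e * c \<le> H" using e xq
    by (auto simp: H_def power2_eq_square c_def intro!: mult_left_mono)
  show "weight e p N > 0" by (rule w)
  show w': "weight e p (Suc N) > 0" using w u by (simp add: add_pos_nonneg)
  have ln: "ln (weight e p (Suc N)) - ln (weight e p N) = ln (1 + u)"
    unfolding u(2) using w u(1) by (subst ln_mult) auto
  show "0 \<le> ln (weight e p (Suc N)) - ln (weight e p N)" unfolding ln using u(1) by simp
  have "ln (1 + u) \<le> u" using u(1) by (intro ln_add_one_self_le_self) auto
  then show "ln (weight e p (Suc N)) - ln (weight e p N) \<le> e * n\<^sup>2"
    unfolding ln H_def[symmetric] using u(3) cH by linarith
  have uH: "u \<le> H" using u(3) cH by linarith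
  have "u ^ 3 \<le> H ^ 3" using u uH by (intro power_mono) auto
  then have 1: "\<bar>ln (1 + u) - (u - u\<^sup>2 / 2)\<bar> \<le> H ^ 3"
    using ln_one_plus_bounds[OF u(1)] H by auto
  have 2: "\<bar>(e * c)\<^sup>2 - u\<^sup>2\<bar> \<le> 2 * H ^ 3"
  proof -
    have "(e * c)\<^sup>2 - u\<^sup>2 = (e * c - u) * (e * c + u)" by (simp add: power2_eq_square algebra_simps)
    moreover have "(e * c - u) * (e * c + u) \<le> H\<^sup>2 * (2 * H)"
      using u(1,3,4) cH uH H by (intro mult_mono) auto
    moreover have "0 \<le> (e * c - u) * (e * c + u)" using u cH by simp
    ultimately show ?thesis by (simp add: power2_eq_square power3_eq_cube mult_ac)
  qed
  have 3: "\<bar>ln (1 + u) - (e * c - 3 / 2 * (e * c)\<^sup>2)\<bar> \<le> 4 * H ^ 3 + 2 * e\<^sup>2 * n ^ 3"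
    using 1 2 u(5) by linarith
  \<comment> \<open>\<open>D1\<close> and \<open>D2\<close> are what a unit difference of the two
    polynomials in \<open>A\<close> leaves beyond \<open>c\<close> and \<open>c ^ 2\<close>; they
    have lower degree.\<close>
  define D1 where "D1 = q + 1 / 3"
  define D2 where "D2 = x\<^sup>2 + x + 1 / 5 + 2 * q * x\<^sup>2 + 4 * q * x + q + 4 * q\<^sup>2 * x + 4 / 3 * q\<^sup>2"
  have A: "A (x + 1) - A x = e * (c + D1) - 3 / 2 * e\<^sup>2 * (c\<^sup>2 + D2)"
  proof -
    have a: "((x + 1) ^ 3 / 3 + q * (x + 1)\<^sup>2) - (x ^ 3 / 3 + q * x\<^sup>2) = c + D1"
      by (simp add: c_def D1_def field_simps power2_eq_square power3_eq_cube)
    have b: "((x + 1) ^ 5 / 5 + q * (x + 1) ^ 4 + 4 / 3 * q\<^sup>2 * (x + 1) ^ 3)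
        - (x ^ 5 / 5 + q * x ^ 4 + 4 / 3 * q\<^sup>2 * x ^ 3) = c\<^sup>2 + D2"
      by (simp add: c_def D2_def field_simps eval_nat_numeral)
    show ?thesis unfolding A_def q_def[symmetric] a[symmetric] b[symmetric] by (simp add: algebra_simps)
  qed
  have D1: "0 \<le> D1" "D1 \<le> n" using xq n by (auto simp: D1_def)
  have D2: "0 \<le> D2" "D2 \<le> 8 * n ^ 3"
  proof -
    show "0 \<le> D2" using xq by (simp add: D2_def)
    have n0: "0 \<le> n" and x1: "x \<le> n" and q1: "2 * q \<le> n" using xq n by auto
    have nn: "n \<le> n ^ 3" "n\<^sup>2 \<le> n ^ 3" "1 \<le> n ^ 3"
      using n power_increasing[of 1 3 n] power_increasing[of 2 3 n] power_increasing[of 0 3 n] by auto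
    have "x\<^sup>2 \<le> n\<^sup>2" using x1 xq by (intro power_mono)
    moreover have "2 * q * x\<^sup>2 \<le> n * n\<^sup>2" using x1 q1 xq n0 by (intro mult_mono power_mono) auto
    moreover have "(2 * q) * x \<le> n * n" using x1 q1 xq n0 by (intro mult_mono) auto
    moreover have "(2 * q)\<^sup>2 * x \<le> n\<^sup>2 * n" using x1 q1 xq n0 by (intro mult_mono power_mono) auto
    moreover have "(2 * q)\<^sup>2 \<le> n\<^sup>2" using q1 xq by (intro power_mono) auto
    ultimately show "D2 \<le> 8 * n ^ 3"
      using nn x1 q1 unfolding D2_def power_mult_distrib by (simp add: power2_eq_square power3_eq_cube mult_ac)
  qed
  have "e * D1 \<le> e * n" "e\<^sup>2 * D2 \<le> e\<^sup>2 * (8 * n ^ 3)" "0 \<le> e * D1" "0 \<le> e\<^sup>2 * D2"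
    using D1 D2 e by (auto intro!: mult_left_mono)
  moreover have "e * (c + D1) - 3 / 2 * e\<^sup>2 * (c\<^sup>2 + D2)
     = e * c - 3 / 2 * (e * c)\<^sup>2 + e * D1 - 3 / 2 * (e\<^sup>2 * D2)"
    by (simp add: algebra_simps power_mult_distrib)
  ultimately show "\<bar>ln (weight e p (Suc N)) - ln (weight e p N) - (A (real N + 1) - A (real N))\<bar> \<le> E"
    using 3 unfolding ln x_def[symmetric] A E_def H_def[symmetric] by linarith
qed

text \<open>Telescoping in \<open>N\<close> from the product at \<open>N = 0\<close>. The
  \<open>p ^ 3\<close> terms of order \<open>e\<close> from the two parts cancel, and so do all
  powers of \<open>p\<close> above the second at order \<open>e ^ 2\<close>. The leading term is
  thus linear in \<open>p\<close>, which is what makes the weight an exponential tilt.\<close>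

lemma weight_asymp:
  fixes n p :: nat
  assumes e: "0 \<le> e" and h: "e * (real n)\<^sup>2 \<le> 1 / 8" and p: "2 * p + 1 \<le> n"
  shows "weight e p (n - 1 - 2 * p) > 0"
    "\<bar>ln (weight e p (n - 1 - 2 * p)) - (e * (real n ^ 3 / 3 - real p * (real n)\<^sup>2)
        + e\<^sup>2 * (- 3 / 10 * real n ^ 5 + 3 / 2 * real p * real n ^ 4 - 2 * (real p)\<^sup>2 * real n ^ 3))\<bar>
       \<le> 5 * real n * (e * (real n)\<^sup>2) ^ 3 + 30 * (e * (real n)\<^sup>2)"
proof -
  define M where "M = n - 1 - 2 * p"
  define A where "A = (\<lambda>x. e * (x ^ 3 / 3 + real p * x\<^sup>2)
       - 3 / 2 * e\<^sup>2 * (x ^ 5 / 5 + real p * x ^ 4 + 4 / 3 * (real p)\<^sup>2 * x ^ 3))"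
  define H where "H = e * (real n)\<^sup>2"
  define E where "E = 4 * H ^ 3 + 14 * e\<^sup>2 * real n ^ 3 + e * real n"
  define E0 where "E0 = H ^ 3 + 4 * e * real n + 8 * e\<^sup>2 * real n ^ 3"
  have n1: "1 \<le> real n" using p by simp
  have nM: "real n = real M + 1 + 2 * real p" using p by (auto simp: M_def)
  have E0: "0 \<le> E0" "0 \<le> E" using e by (auto simp: E0_def E_def H_def)
  note step = weight_step_asymp[OF e n1 h, of _ p]
  have step3: "\<bar>ln (weight e p (Suc N)) - ln (weight e p N) - (A (real N + 1) - A (real N))\<bar> \<le> E"
    if "real N + 2 * real p + 1 \<le> real n" for N
    unfolding A_def E_def H_def using step(3)[OF that] .
  have ind: "weight e p N > 0 \<and> \<bar>ln (weight e p N) - ln (weight e p 0) - A (real N)\<bar> \<le> real N * E" if "N \<le> M" for N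
    using that
  proof (induction N)
    case 0
    then show ?case using step[of 0] nM by (simp add: A_def)
  next
    case (Suc N)
    have N: "real N + 2 * real p + 1 \<le> real n" using Suc.prems nM by simp
    have "\<bar>ln (weight e p N) - ln (weight e p 0) - A (real N)\<bar> \<le> real N * E" using Suc by simp
    moreover have "\<bar>ln (weight e p (Suc N)) - ln (weight e p N) - (A (real N + 1) - A (real N))\<bar> \<le> E"
      by (rule step3[OF N])
    moreover have "A (real N + 1) = A (real (Suc N))" by (simp add: add.commute)
    moreover have "real (Suc N) * E = real N * E + E" by (simp add: algebra_simps)
    ultimately have "\<bar>ln (weight e p (Suc N)) - ln (weight e p 0) - A (real (Suc N))\<bar> \<le> real (Suc N) * E"
      by linarith
    then show ?case using step(2)[OF N] by blast
  qed
  have N: "real M + 2 * real p + 1 \<le> real n" using nM by simp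
  show "weight e p (n - 1 - 2 * p) > 0" using ind[of M] by (simp add: M_def)
  have i: "\<bar>ln (weight e p M) - ln (weight e p 0) - A (real M)\<bar> \<le> real M * E" using ind[of M] by simp
  \<comment> \<open>\<open>M + 1 = n - 2 * p\<close>, so evaluating \<open>A\<close> at
    \<open>M + 1\<close> rather than at \<open>M\<close> makes the final polynomial identity exact,
    at the cost of one increment.\<close>
  have ii: "\<bar>A (real M + 1) - A (real M)\<bar> \<le> H + E"
    using step3[OF N] step(4,5)[OF N] unfolding H_def by linarith
  have iii: "\<bar>ln (weight e p 0) - (- 4 * e * real p ^ 3 / 3 - 8 * e\<^sup>2 * real p ^ 5 / 5)\<bar> \<le> real p * E0"
    using weight_0_asymp[OF e n1 h, of p] p unfolding E0_def H_def by auto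
  have x: "real M + 1 = real n - 2 * real p" using nM by simp
  have eq: "A (real M + 1) + (- 4 * e * real p ^ 3 / 3 - 8 * e\<^sup>2 * real p ^ 5 / 5)
     = e * (real n ^ 3 / 3 - real p * (real n)\<^sup>2)
        + e\<^sup>2 * (- 3 / 10 * real n ^ 5 + 3 / 2 * real p * real n ^ 4 - 2 * (real p)\<^sup>2 * real n ^ 3)"
    unfolding x A_def by (simp add: field_simps eval_nat_numeral)
  have "real M * E + (H + E) + real p * E0 \<le> real n * (E + E0) + H"
  proof -
    have "(real M + 1) * E \<le> real n * E" using E0 nM by (intro mult_right_mono) auto
    moreover have "real p * E0 \<le> real n * E0" using E0 p by (intro mult_right_mono) auto
    ultimately show ?thesis by (simp add: algebra_simps)
  qed
  also have "\<dots> = 5 * real n * H ^ 3 + 22 * H\<^sup>2 + 6 * H"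
    unfolding E_def E0_def H_def by (simp add: algebra_simps eval_nat_numeral)
  also have "\<dots> \<le> 5 * real n * H ^ 3 + 30 * H"
  proof -
    have "0 \<le> H" "H \<le> 1 / 8" using e h by (auto simp: H_def)
    then have "H * H \<le> 1 / 8 * H" by (intro mult_right_mono)
    then show ?thesis using \<open>0 \<le> H\<close> by (simp add: power2_eq_square)
  qed
  finally show "\<bar>ln (weight e p (n - 1 - 2 * p)) - (e * (real n ^ 3 / 3 - real p * (real n)\<^sup>2)
        + e\<^sup>2 * (- 3 / 10 * real n ^ 5 + 3 / 2 * real p * real n ^ 4 - 2 * (real p)\<^sup>2 * real n ^ 3))\<bar>
       \<le> 5 * real n * (e * (real n)\<^sup>2) ^ 3 + 30 * (e * (real n)\<^sup>2)"
    unfolding M_def[symmetric] eq[symmetric] H_def[symmetric] using i ii iii by linarith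
qed

section \<open>Configurations: labellings with a compatible order\<close>

definition strict_lin :: "'a set \<Rightarrow> ('a \<times> 'a) set \<Rightarrow> bool" where
  "strict_lin S r \<longleftrightarrow> r \<subseteq> S \<times> S \<and> irrefl r \<and> trans r \<and> (\<forall>x\<in>S. \<forall>y\<in>S. x \<noteq> y \<longrightarrow> (x, y) \<in> r \<or> (y, x) \<in> r)"

lemma strict_linD:
  assumes "strict_lin S r"
  shows "(x, x) \<notin> r" "(x, y) \<in> r \<Longrightarrow> (y, x) \<notin> r" "(x, y) \<in> r \<Longrightarrow> (y, z) \<in> r \<Longrightarrow> (x, z) \<in> r"
    "x \<in> S \<Longrightarrow> y \<in> S \<Longrightarrow> x \<noteq> y \<Longrightarrow> (x, y) \<in> r \<or> (y, x) \<in> r"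
    "(x, y) \<in> r \<Longrightarrow> x \<in> S \<and> y \<in> S"
proof -
  have "r \<subseteq> S \<times> S" and irr: "irrefl r" and tr: "trans r"
    and tot: "\<forall>x\<in>S. \<forall>y\<in>S. x \<noteq> y \<longrightarrow> (x, y) \<in> r \<or> (y, x) \<in> r"
    using assms by (auto simp: strict_lin_def)
  show 1: "(x, x) \<notin> r" for x using irr by (simp add: irrefl_def)
  show 3: "(x, y) \<in> r \<Longrightarrow> (y, z) \<in> r \<Longrightarrow> (x, z) \<in> r" for x y z using tr by (rule transD)
  show "(x, y) \<in> r \<Longrightarrow> (y, x) \<notin> r" using 1[of x] 3[of x y x] by blast
  show "x \<in> S \<Longrightarrow> y \<in> S \<Longrightarrow> x \<noteq> y \<Longrightarrow> (x, y) \<in> r \<or> (y, x) \<in> r" using tot by blast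
  show "(x, y) \<in> r \<Longrightarrow> x \<in> S \<and> y \<in> S" using \<open>r \<subseteq> S \<times> S\<close> by blast
qed

text \<open>Ranking the points by \<open>r\<close> turns a configuration into a relabelling of the
  points together with an enriched word of the conjugated permutation. This version refers to no
  numbering of \<open>S\<close>, so points can be added and removed.\<close>

definition configs :: "('a \<Rightarrow> 'a) \<Rightarrow> nat \<Rightarrow> 'a set \<Rightarrow> (('a \<Rightarrow> nat) \<times> ('a \<times> 'a) set) set" where
  "configs p K S = {(L, r). L \<in> S \<rightarrow>\<^sub>E {..<K} \<and> strict_lin S r \<and>
     (\<forall>(x, y)\<in>r. L x < L y \<or> L x = L y \<and> (if odd (L x) then (p x, p y) \<in> r else (p y, p x) \<in> r))}"

lemma finite_configs:
  assumes "finite S"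
  shows "finite (configs p K S)"
proof -
  have "configs p K S \<subseteq> (S \<rightarrow>\<^sub>E {..<K}) \<times> Pow (S \<times> S)"
    by (auto simp: configs_def strict_lin_def)
  moreover have "finite ((S \<rightarrow>\<^sub>E {..<K}) \<times> Pow (S \<times> S))"
    using assms by (intro finite_cartesian_product finite_PiE) auto
  ultimately show ?thesis by (rule finite_subset)
qed

section \<open>Words read along orbits and their signed lexicographic order\<close>

definition same_word :: "('a \<Rightarrow> 'a) \<Rightarrow> ('a \<Rightarrow> nat) \<Rightarrow> 'a \<Rightarrow> 'a \<Rightarrow> bool" where
  "same_word p L x y \<longleftrightarrow> (\<forall>e. L ((p ^^ e) x) = L ((p ^^ e) y))"

lemma same_word_sym: "same_word p L x y \<Longrightarrow> same_word p L y x"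
  by (simp add: same_word_def)

lemma same_word_trans: "same_word p L x y \<Longrightarrow> same_word p L y z \<Longrightarrow> same_word p L x z"
  by (simp add: same_word_def)

lemma same_word_funpow: "same_word p L x y \<Longrightarrow> same_word p L ((p ^^ d) x) ((p ^^ d) y)"
  unfolding same_word_def by (metis comp_apply funpow_add)

lemma same_word_step: "same_word p L x y \<longleftrightarrow> L x = L y \<and> same_word p L (p x) (p y)"
proof
  assume *: "same_word p L x y"
  have "L ((p ^^ e) (p x)) = L ((p ^^ e) (p y))" for e
    using *[unfolded same_word_def, rule_format, of "Suc e"] by (simp add: funpow_swap1)
  moreover have "L x = L y" using *[unfolded same_word_def, rule_format, of 0] by simp
  ultimately show "L x = L y \<and> same_word p L (p x) (p y)" by (simp add: same_word_def)
next
  assume *: "L x = L y \<and> same_word p L (p x) (p y)"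
  have "L ((p ^^ e) x) = L ((p ^^ e) y)" for e
    using * by (cases e) (auto simp: same_word_def funpow_swap1)
  then show "same_word p L x y" by (simp add: same_word_def)
qed

definition letter_sign :: "nat \<Rightarrow> real" where
  "letter_sign c = (if odd c then 1 else - 1)"

text \<open>A real number whose order is the signed lexicographic order of the infinite word read along the
  \<open>p\<close>-orbit; the base \<open>2 * K\<close> keeps the ranges of distinct first letters apart.\<close>

definition word_val :: "('a \<Rightarrow> 'a) \<Rightarrow> nat \<Rightarrow> ('a \<Rightarrow> nat) \<Rightarrow> 'a \<Rightarrow> real" where
  "word_val p K L x = (\<Sum>k. (\<Prod>l<k. letter_sign (L ((p ^^ l) x))) * real (L ((p ^^ k) x)) / (2 * real K) ^ (Suc k))"

locale labelled =
  fixes p :: "'a \<Rightarrow> 'a" and K :: nat and S :: "'a set" and L :: "'a \<Rightarrow> nat"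
  assumes invar: "p ` S \<subseteq> S" and K_pos: "K \<ge> 1" and L_bound: "\<And>x. x \<in> S \<Longrightarrow> L x < K"
begin

lemma funpow_in: "x \<in> S \<Longrightarrow> (p ^^ e) x \<in> S"
  using invar by (induction e) auto

lemma word_val_term_le:
  assumes "x \<in> S"
  shows "norm ((\<Prod>l<k. letter_sign (L ((p ^^ l) x))) * real (L ((p ^^ k) x)) / (2 * real K) ^ (Suc k))
     \<le> (real K - 1) / (2 * real K) * (1 / (2 * real K)) ^ k"
proof -
  have "\<bar>\<Prod>l<k. letter_sign (L ((p ^^ l) x))\<bar> = 1"
    unfolding abs_prod by (rule prod.neutral) (simp add: letter_sign_def)
  moreover have "real (L ((p ^^ k) x)) \<le> real K - 1"
    using L_bound[OF funpow_in[OF assms, of k]] by linarith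
  ultimately show ?thesis using K_pos
    by (simp add: abs_mult power_divide divide_right_mono)
qed

lemma word_val_geometric:
  "summable (\<lambda>k. (real K - 1) / (2 * real K) * (1 / (2 * real K)) ^ k)"
  "(\<Sum>k. (real K - 1) / (2 * real K) * (1 / (2 * real K)) ^ k) < 1 / 2"
proof -
  have r: "norm (1 / (2 * real K)) < 1" using K_pos by simp
  show "summable (\<lambda>k. (real K - 1) / (2 * real K) * (1 / (2 * real K)) ^ k)"
    by (rule summable_mult[OF summable_geometric[OF r]])
  have "(\<Sum>k. (real K - 1) / (2 * real K) * (1 / (2 * real K)) ^ k)
      = (real K - 1) / (2 * real K) * (1 / (1 - 1 / (2 * real K)))"
    by (subst suminf_mult[OF summable_geometric[OF r]]) (simp add: suminf_geometric[OF r])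
  also have "\<dots> = (real K - 1) / (2 * real K - 1)" using K_pos by (simp add: field_simps)
  also have "\<dots> < 1 / 2" using K_pos by (simp add: field_simps)
  finally show "(\<Sum>k. (real K - 1) / (2 * real K) * (1 / (2 * real K)) ^ k) < 1 / 2" .
qed

lemma word_val_summable:
  assumes "x \<in> S"
  shows "summable (\<lambda>k. (\<Prod>l<k. letter_sign (L ((p ^^ l) x))) * real (L ((p ^^ k) x)) / (2 * real K) ^ (Suc k))"
  by (rule summable_comparison_test'[OF word_val_geometric(1)]) (rule word_val_term_le[OF assms])

text \<open>Labels are at most \<open>K - 1\<close>, so the series is dominated by
  \<open>(K - 1) / (2 * K - 1)\<close>, strictly below 1/2. Two tails together therefore weigh less
  than a difference of 1 in the first label.\<close>

lemma word_val_abs: 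
  assumes "x \<in> S"
  shows "\<bar>word_val p K L x\<bar> < 1 / 2"
proof -
  have "norm (word_val p K L x) \<le> (\<Sum>k. (real K - 1) / (2 * real K) * (1 / (2 * real K)) ^ k)"
    unfolding word_val_def
    by (rule norm_suminf_le[OF word_val_term_le[OF assms] word_val_geometric(1)])
  then show ?thesis using word_val_geometric(2) by simp
qed

lemma word_val_rec:
  assumes "x \<in> S"
  shows "2 * real K * word_val p K L x = real (L x) + letter_sign (L x) * word_val p K L (p x)"
proof -
  let ?t = "\<lambda>x k. (\<Prod>l<k. letter_sign (L ((p ^^ l) x))) * real (L ((p ^^ k) x)) / (2 * real K) ^ (Suc k)"
  have px: "p x \<in> S" using assms invar by auto
  have "word_val p K L x = ?t x 0 + (\<Sum>k. ?t x (Suc k))"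
    unfolding word_val_def using suminf_split_head[OF word_val_summable[OF assms]] by simp
  also have "(\<lambda>k. ?t x (Suc k)) = (\<lambda>k. letter_sign (L x) / (2 * real K) * ?t (p x) k)"
  proof
    fix k
    have "(\<Prod>l<Suc k. letter_sign (L ((p ^^ l) x))) = letter_sign (L x) * (\<Prod>l<k. letter_sign (L ((p ^^ l) (p x))))"
      by (subst prod.lessThan_Suc_shift) (simp add: funpow_swap1)
    then show "?t x (Suc k) = letter_sign (L x) / (2 * real K) * ?t (p x) k"
      by (simp add: funpow_swap1 del: prod.lessThan_Suc)
  qed
  also have "(\<Sum>k. letter_sign (L x) / (2 * real K) * ?t (p x) k) = letter_sign (L x) / (2 * real K) * word_val p K L (p x)"
    unfolding word_val_def by (rule suminf_mult[OF word_val_summable[OF px]])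
  finally show ?thesis using K_pos by (simp add: field_simps)
qed

lemma word_val_less:
  assumes "x \<in> S" "y \<in> S" "L x < L y"
  shows "word_val p K L x < word_val p K L y"
proof -
  have "p x \<in> S" "p y \<in> S" using assms invar by auto
  then have "\<bar>word_val p K L (p x)\<bar> < 1 / 2" "\<bar>word_val p K L (p y)\<bar> < 1 / 2" using word_val_abs by auto
  moreover have "real (L x) + 1 \<le> real (L y)" using assms(3) by simp
  ultimately have "2 * real K * word_val p K L x < 2 * real K * word_val p K L y"
    unfolding word_val_rec[OF assms(1)] word_val_rec[OF assms(2)] letter_sign_def by (auto split: if_splits)
  then show ?thesis using K_pos by simp
qed

text \<open>On points with equal labels \<open>p\<close> expands differences by
  \<open>2 * K\<close>, with the sign of the label. As values are bounded, such an expansion cannot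
  continue forever unless the difference is 0.\<close>

lemma word_val_diff:
  assumes "x \<in> S" "y \<in> S" "L x = L y"
  shows "word_val p K L (p x) - word_val p K L (p y)
     = letter_sign (L x) * (2 * real K) * (word_val p K L x - word_val p K L y)"
proof -
  have "2 * real K * (word_val p K L x - word_val p K L y)
     = letter_sign (L x) * (word_val p K L (p x) - word_val p K L (p y))"
    using word_val_rec[OF assms(1)] word_val_rec[OF assms(2)] assms(3) by (simp add: algebra_simps)
  then show ?thesis by (auto simp: letter_sign_def split: if_splits)
qed

lemma word_val_eq_iff:
  assumes "x \<in> S" "y \<in> S"
  shows "word_val p K L x = word_val p K L y \<longleftrightarrow> same_word p L x y"
proof
  assume "same_word p L x y"
  then show "word_val p K L x = word_val p K L y" by (simp add: word_val_def same_word_def)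
next
  assume eq: "word_val p K L x = word_val p K L y"
  have "word_val p K L ((p ^^ e) x) = word_val p K L ((p ^^ e) y)" for e
  proof (induction e)
    case (Suc e)
    have "L ((p ^^ e) x) = L ((p ^^ e) y)"
      using word_val_less[OF funpow_in funpow_in, OF assms, of e e]
        word_val_less[OF funpow_in funpow_in, OF assms(2,1), of e e] Suc
      by (metis less_irrefl linorder_neqE_nat)
    from word_val_diff[OF funpow_in funpow_in this, OF assms] Suc show ?case by simp
  qed (simp add: eq)
  then have "L ((p ^^ e) x) = L ((p ^^ e) y)" for e
    using word_val_less[OF funpow_in funpow_in, OF assms, of e e]
        word_val_less[OF funpow_in funpow_in, OF assms(2,1), of e e]
    by (metis less_irrefl linorder_neqE_nat)
  then show "same_word p L x y" by (simp add: same_word_def)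
qed

end

lemma configs_labelled:
  assumes "(L, r) \<in> configs p K S" "p ` S \<subseteq> S" "K \<ge> 1"
  shows "labelled p K S L"
  using assms by (auto simp: labelled_def configs_def PiE_def Pi_def)

lemma configs_strict_lin: "(L, r) \<in> configs p K S \<Longrightarrow> strict_lin S r"
  by (simp add: configs_def)

lemma configs_rel:
  "(L, r) \<in> configs p K S \<Longrightarrow> (x, y) \<in> r \<Longrightarrow>
     L x < L y \<or> L x = L y \<and> (if odd (L x) then (p x, p y) \<in> r else (p y, p x) \<in> r)"
  unfolding configs_def by fast

text \<open>If the order disagreed with the values, applying \<open>p\<close> would multiply the gap by \<open>2 * K\<close> forever.\<close>

lemma configs_word_val_mono:
  assumes c: "(L, r) \<in> configs p K S" and inv: "p ` S \<subseteq> S" and K: "K \<ge> 1" and xy: "(x, y) \<in> r"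
  shows "word_val p K L x \<le> word_val p K L y"
proof (rule ccontr)
  interpret labelled p K S L by (rule configs_labelled[OF c inv K])
  note sl = strict_linD[OF configs_strict_lin[OF c]]
  define D where "D = word_val p K L x - word_val p K L y"
  assume "\<not> word_val p K L x \<le> word_val p K L y"
  then have D: "D > 0" by (simp add: D_def)
  have "\<exists>u v. (u, v) \<in> r \<and> word_val p K L u - word_val p K L v \<ge> 2 ^ N * D" for N
  proof (induction N)
    case 0
    then show ?case using xy by (auto simp: D_def)
  next
    case (Suc N)
    then obtain u v where uv: "(u, v) \<in> r" "word_val p K L u - word_val p K L v \<ge> 2 ^ N * D" by blast
    have S: "u \<in> S" "v \<in> S" using sl(5)[OF uv(1)] by auto
    have pos: "word_val p K L u - word_val p K L v > 0" using uv(2) D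
      by (meson less_le_trans mult_pos_pos zero_less_numeral zero_less_power)
    have "\<not> L u < L v" using word_val_less[OF S] pos by auto
    then have eq: "L u = L v" and rel: "if odd (L u) then (p u, p v) \<in> r else (p v, p u) \<in> r"
      using configs_rel[OF c uv(1)] by auto
    have big: "2 ^ Suc N * D \<le> 2 * real K * (word_val p K L u - word_val p K L v)"
    proof -
      have "2 ^ Suc N * D \<le> 2 * (word_val p K L u - word_val p K L v)" using uv(2) by simp
      also have "\<dots> \<le> 2 * real K * (word_val p K L u - word_val p K L v)"
        using K pos by (intro mult_right_mono) auto
      finally show ?thesis .
    qed
    have d: "word_val p K L (p u) - word_val p K L (p v)
       = letter_sign (L u) * (2 * real K) * (word_val p K L u - word_val p K L v)"
      by (rule word_val_diff[OF S eq])
    show ?case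
    proof (cases "odd (L u)")
      case True
      then show ?thesis using rel d big by (intro exI[of _ "p u"] exI[of _ "p v"]) (simp add: letter_sign_def)
    next
      case False
      then show ?thesis using rel d big by (intro exI[of _ "p v"] exI[of _ "p u"]) (simp add: letter_sign_def)
    qed
  qed note * = this
  obtain N where "1 / D < 2 ^ N" using real_arch_pow[of 2 "1 / D"] by auto
  then have N: "1 < 2 ^ N * D" using D by (simp add: field_simps)
  obtain u v where uv: "(u, v) \<in> r" "word_val p K L u - word_val p K L v \<ge> 2 ^ N * D" using * by blast
  have "\<bar>word_val p K L u\<bar> < 1 / 2" "\<bar>word_val p K L v\<bar> < 1 / 2" using sl(5)[OF uv(1)] word_val_abs by auto
  then show False using uv(2) N by linarith
qed

text \<open>Given the labels, the order is forced between points with different words; all freedom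
  is inside classes of equal words.\<close>

lemma configs_word_val_iff:
  assumes c: "(L, r) \<in> configs p K S" and inv: "p ` S \<subseteq> S" and K: "K \<ge> 1"
    and S: "x \<in> S" "y \<in> S" and "\<not> same_word p L x y"
  shows "(x, y) \<in> r \<longleftrightarrow> word_val p K L x < word_val p K L y"
proof -
  interpret labelled p K S L by (rule configs_labelled[OF c inv K])
  note sl = strict_linD[OF configs_strict_lin[OF c]]
  have "x \<noteq> y" using assms(6) by (auto simp: same_word_def)
  moreover have "word_val p K L x \<noteq> word_val p K L y" using word_val_eq_iff[OF S] assms(6) by blast
  ultimately show ?thesis
    using configs_word_val_mono[OF c inv K] sl(4)[OF S] sl(2) by (metis linorder_not_le order_le_less)
qed

text \<open>True when the product of the signs of the first \<open>e\<close> letters is positive,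
  that is, when \<open>p ^^ e\<close> preserves rather than reverses the order inside a class of
  equal words.\<close>

fun word_pos :: "('a \<Rightarrow> 'a) \<Rightarrow> ('a \<Rightarrow> nat) \<Rightarrow> nat \<Rightarrow> 'a \<Rightarrow> bool" where
  "word_pos p L 0 x = True"
| "word_pos p L (Suc e) x = (word_pos p L e x = odd (L ((p ^^ e) x)))"

lemma word_pos_cong: "same_word p L x y \<Longrightarrow> word_pos p L e x = word_pos p L e y"
  by (induction e) (auto simp: same_word_def)

text \<open>The definition of \<open>configs\<close> gives implications only, for pairs in
  \<open>r\<close>. Since \<open>r\<close> is total, using them for a pair and for the reversed pair
  yields an equivalence, so the order may also be pulled back along \<open>p\<close>.\<close>

lemma configs_transport:
  assumes c: "(L, r) \<in> configs p K S" and inv: "p ` S \<subseteq> S" and K: "K \<ge> 1" and inj: "inj p"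
    and S: "x \<in> S" "y \<in> S" and w: "same_word p L x y"
  shows "((p ^^ e) x, (p ^^ e) y) \<in> r \<longleftrightarrow> (if word_pos p L e x then (x, y) \<in> r else (y, x) \<in> r)"
proof (cases "x = y")
  case True
  then show ?thesis using strict_linD(1)[OF configs_strict_lin[OF c]] by auto
next
  case neq: False
  interpret labelled p K S L by (rule configs_labelled[OF c inv K])
  note sl = strict_linD[OF configs_strict_lin[OF c]]
  have step: "(p u, p v) \<in> r \<longleftrightarrow> (if odd (L u) then (u, v) \<in> r else (v, u) \<in> r)"
    if "u \<in> S" "v \<in> S" "u \<noteq> v" "L u = L v" for u v
    using configs_rel[OF c, of u v] configs_rel[OF c, of v u] sl(4)[OF that(1-3)] sl(2) that(4)
    by (smt (verit, best) less_irrefl)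
  show ?thesis
  proof (induction e)
    case (Suc e)
    let ?u = "(p ^^ e) x" and ?v = "(p ^^ e) y"
    have uv: "?u \<in> S" "?v \<in> S" using funpow_in S by auto
    have ne: "?u \<noteq> ?v" using neq inj_fn[OF inj, of e] by (auto dest: injD)
    have L: "L ?u = L ?v" using w by (simp add: same_word_def)
    have flip: "(?v, ?u) \<in> r \<longleftrightarrow> \<not> (?u, ?v) \<in> r" using sl(4)[OF uv ne] sl(2) by blast
    have flip': "(y, x) \<in> r \<longleftrightarrow> \<not> (x, y) \<in> r" using sl(4)[OF S neq] sl(2) by blast
    show ?case using step[OF uv ne L] Suc flip flip' by (auto split: if_splits)
  qed simp
qed

section \<open>Inserting a cycle\<close>

locale cycle_extension =
  fixes p :: "'a \<Rightarrow> 'a" and K :: nat and S :: "'a set" and c0 :: 'a and i :: nat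
  assumes inj: "inj p" and fin: "finite S" and invS: "p ` S \<subseteq> S" and K: "K \<ge> 1" and i: "i \<ge> 1"
    and period: "(p ^^ i) c0 = c0" and distinct_orbit: "inj_on (\<lambda>e. (p ^^ e) c0) {..<i}" and c0: "c0 \<notin> S"
begin

definition cyc :: "'a set" where "cyc = (\<lambda>e. (p ^^ e) c0) ` {..<i}"

lemma finite_cyc: "finite cyc" and card_cyc: "card cyc = i"
  by (simp_all add: cyc_def card_image[OF distinct_orbit])

lemma funpow_mod: "(p ^^ (e mod i)) c0 = (p ^^ e) c0"
  by (rule funpow_mod_eq[OF period])

lemma funpow_cyc: "(p ^^ e) c0 \<in> cyc"
  unfolding cyc_def using i by (subst funpow_mod[symmetric]) auto

lemma p_cyc: "p ` cyc \<subseteq> cyc"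
proof -
  have "p ((p ^^ e) c0) \<in> cyc" for e using funpow_cyc[of "Suc e"] by simp
  then show ?thesis by (auto simp: cyc_def)
qed

lemma cycE:
  assumes "x \<in> cyc" obtains e where "e < i" "x = (p ^^ e) c0"
  using assms by (auto simp: cyc_def)

lemma funpow_eq_c0_iff: "(p ^^ e) c0 = c0 \<longleftrightarrow> i dvd e"
proof
  assume "(p ^^ e) c0 = c0"
  then have "(p ^^ (e mod i)) c0 = (p ^^ 0) c0" by (simp add: funpow_mod)
  then have "e mod i = 0" using inj_onD[OF distinct_orbit] i by (metis lessThan_iff less_le_trans mod_less_divisor zero_less_one)
  then show "i dvd e" by auto
next
  assume "i dvd e" then show "(p ^^ e) c0 = c0" using funpow_mod[of e] by (simp add: dvd_eq_mod_eq_0)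
qed

lemma funpow_S: "x \<in> S \<Longrightarrow> (p ^^ e) x \<in> S"
  using invS by (induction e) auto

lemma return_c0: "e < i \<Longrightarrow> (p ^^ (i - e)) ((p ^^ e) c0) = c0"
  using period by (metis comp_apply funpow_add le_add_diff_inverse2 less_imp_le)

lemma disj: "S \<inter> cyc = {}"
proof -
  have "(p ^^ e) c0 \<notin> S" if "e < i" for e
    using funpow_S[of "(p ^^ e) c0" "i - e"] return_c0[OF that] c0 by auto
  then show ?thesis by (auto simp: cyc_def)
qed

lemma invSc: "p ` (S \<union> cyc) \<subseteq> S \<union> cyc"
  using invS p_cyc by blast

definition ext :: "('a \<Rightarrow> nat) \<Rightarrow> ('a \<times> 'a) set \<Rightarrow> (('a \<Rightarrow> nat) \<times> ('a \<times> 'a) set) set" where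
  "ext L' r' = {(L, r) \<in> configs p K (S \<union> cyc). restrict L S = L' \<and> r \<inter> S \<times> S = r'}"

text \<open>Only these points of \<open>S\<close> can be placed freely relative to the new cycle: a
  tie of a point of \<open>S\<close> with another cycle point is moved to \<open>c0\<close> by a
  power of \<open>p\<close>.\<close>

definition ties :: "('a \<Rightarrow> nat) \<Rightarrow> ('a \<Rightarrow> nat) \<Rightarrow> 'a set" where
  "ties L' w = {y \<in> S. \<forall>e. L' ((p ^^ e) y) = w ((p ^^ e) c0)}"

text \<open>The words for which \<open>c0\<close> is tied with another point of the cycle, at
  distance \<open>d\<close>.\<close>

definition rot :: "nat \<Rightarrow> ('a \<Rightarrow> nat) set" where
  "rot d = {w \<in> cyc \<rightarrow>\<^sub>E {..<K}. \<forall>e. w ((p ^^ (e + d)) c0) = w ((p ^^ e) c0)}"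

lemma cyc_fun_eqI:
  assumes "w \<in> cyc \<rightarrow>\<^sub>E A" "w' \<in> cyc \<rightarrow>\<^sub>E A" "\<And>e. e < i \<Longrightarrow> w ((p ^^ e) c0) = w' ((p ^^ e) c0)"
  shows "w = w'"
proof (rule PiE_ext[OF assms(1,2)])
  fix x assume "x \<in> cyc" then show "w x = w' x" using assms(3) by (auto elim: cycE)
qed

lemma card_rot_le:
  assumes "1 \<le> d" "d \<le> i"
  shows "card (rot d) \<le> K ^ d"
proof -
  let ?f = "\<lambda>w. \<lambda>e\<in>{..<d}. w ((p ^^ e) c0)"
  have per: "w ((p ^^ e) c0) = w ((p ^^ (e mod d)) c0)" if "w \<in> rot d" for w e
  proof (induction e rule: less_induct)
    case (less e)
    show ?case
    proof (cases "e < d")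
      case False
      then have "w ((p ^^ (e - d + d)) c0) = w ((p ^^ (e - d)) c0)" using that unfolding rot_def by blast
      also have "\<dots> = w ((p ^^ ((e - d) mod d)) c0)" using less[of "e - d"] False assms by simp
      finally show ?thesis using False by (simp add: le_mod_geq)
    qed simp
  qed
  have "inj_on ?f (rot d)"
  proof (rule inj_onI)
    fix w w' assume w: "w \<in> rot d" "w' \<in> rot d" "?f w = ?f w'"
    show "w = w'"
    proof (rule cyc_fun_eqI)
      show "w \<in> cyc \<rightarrow>\<^sub>E {..<K}" "w' \<in> cyc \<rightarrow>\<^sub>E {..<K}" using w by (auto simp: rot_def)
      fix e
      have "?f w (e mod d) = ?f w' (e mod d)" using w(3) by simp
      then show "w ((p ^^ e) c0) = w' ((p ^^ e) c0)"
        using per[OF w(1), of e] per[OF w(2), of e] assms by simp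
    qed
  qed
  moreover have "?f ` rot d \<subseteq> {..<d} \<rightarrow>\<^sub>E {..<K}"
  proof (rule image_subsetI)
    fix w assume "w \<in> rot d"
    then have "w \<in> cyc \<rightarrow>\<^sub>E {..<K}" by (simp add: rot_def)
    from PiE_mem[OF this funpow_cyc] show "?f w \<in> {..<d} \<rightarrow>\<^sub>E {..<K}" by simp
  qed
  moreover have "finite ({..<d} \<rightarrow>\<^sub>E {..<K})" by (intro finite_PiE) auto
  ultimately have "card (rot d) \<le> card ({..<d} \<rightarrow>\<^sub>E {..<K})" by (metis card_inj_on_le)
  then show ?thesis by (simp add: card_PiE)
qed

lemma card_words: "card (cyc \<rightarrow>\<^sub>E {..<K}) = K ^ i" and finite_words: "finite (cyc \<rightarrow>\<^sub>E {..<K})"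
  by (auto simp: card_PiE finite_cyc card_cyc intro!: finite_PiE)

text \<open>The word read from \<open>y\<close> prescribes every label on the cycle. Summed over
  \<open>y\<close>, ties therefore cost at most \<open>card S\<close>, independently of
  \<open>K\<close>.\<close>

lemma card_tied_words_le:
  "card {w \<in> cyc \<rightarrow>\<^sub>E {..<K}. y \<in> ties L' w} \<le> 1"
proof -
  have "w = w'" if "w \<in> cyc \<rightarrow>\<^sub>E {..<K}" "w' \<in> cyc \<rightarrow>\<^sub>E {..<K}" "y \<in> ties L' w" "y \<in> ties L' w'" for w w'
    by (rule cyc_fun_eqI[OF that(1,2)]) (use that(3,4) in \<open>simp add: ties_def\<close>)
  then show ?thesis by (intro card_le_Suc0_iff_eq[THEN iffD2, simplified One_nat_def[symmetric]]) (auto simp: finite_words)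
qed

lemma finite_ties: "finite (ties L' w)"
  using fin by (simp add: ties_def)

lemma sum_card_ties_le: "(\<Sum>w\<in>cyc \<rightarrow>\<^sub>E {..<K}. card (ties L' w)) \<le> card S"
proof -
  have "(\<Sum>w\<in>cyc \<rightarrow>\<^sub>E {..<K}. card (ties L' w)) = (\<Sum>w\<in>cyc \<rightarrow>\<^sub>E {..<K}. \<Sum>y\<in>S. if y \<in> ties L' w then 1 else 0)"
  proof (rule sum.cong[OF refl])
    fix w
    have "ties L' w = S \<inter> {y. y \<in> ties L' w}" by (auto simp: ties_def)
    then show "card (ties L' w) = (\<Sum>y\<in>S. if y \<in> ties L' w then 1 else 0)"
      using fin by (simp add: sum.If_cases)
  qed
  also have "\<dots> = (\<Sum>y\<in>S. \<Sum>w\<in>cyc \<rightarrow>\<^sub>E {..<K}. if y \<in> ties L' w then 1 else 0)"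
    by (rule sum.swap)
  also have "\<dots> \<le> (\<Sum>y\<in>S. 1)"
  proof (rule sum_mono)
    fix y
    have "(\<Sum>w\<in>cyc \<rightarrow>\<^sub>E {..<K}. if y \<in> ties L' w then 1 else 0) = card {w \<in> cyc \<rightarrow>\<^sub>E {..<K}. y \<in> ties L' w}"
      using finite_words by (simp add: sum.If_cases Int_def)
    then show "(\<Sum>w\<in>cyc \<rightarrow>\<^sub>E {..<K}. if y \<in> ties L' w then 1 else (0::nat)) \<le> 1"
      using card_tied_words_le by simp
  qed
  finally show ?thesis by simp
qed

text \<open>On points with equal words \<open>p ^^ (2 * d)\<close> preserves the order, so it cannot move a point along a finite orbit.\<close>

lemma same_word_c0_shift:
  assumes c: "(L, r) \<in> configs p K (S \<union> cyc)" and d: "0 < d" "d < i" and w: "same_word p L c0 ((p ^^ d) c0)"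
  shows "2 * d = i"
proof -
  note sl = strict_linD[OF configs_strict_lin[OF c]]
  let ?q = "p ^^ d"
  have fs: "(p ^^ e) c0 \<in> S \<union> cyc" for e using funpow_cyc by blast
  have sw1: "same_word p L ((p ^^ e) c0) ((p ^^ (e + d)) c0)" for e
    using same_word_funpow[OF w, of e] by (metis comp_apply funpow_add)
  have sw: "same_word p L ((p ^^ e) c0) ((p ^^ (e + k * d)) c0)" for e k
  proof (induction k)
    case (Suc k)
    then show ?case using same_word_trans[OF Suc sw1[of "e + k * d"]] by (simp add: algebra_simps)
  qed (simp add: same_word_def)
  have twice: "((p ^^ (e + 2 * d)) c0, (p ^^ (f + 2 * d)) c0) \<in> r"
    if "((p ^^ e) c0, (p ^^ f) c0) \<in> r" "same_word p L ((p ^^ e) c0) ((p ^^ f) c0)" for e f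
  proof -
    let ?x = "(p ^^ e) c0" and ?y = "(p ^^ f) c0"
    have t: "(?q x, ?q y) \<in> r \<longleftrightarrow> (if word_pos p L d x then (x, y) \<in> r else (y, x) \<in> r)"
      if "x \<in> S \<union> cyc" "y \<in> S \<union> cyc" "same_word p L x y" for x y
      by (rule configs_transport[OF c invSc K inj that])
    have fa: "(p ^^ k) ((p ^^ l) c0) = (p ^^ (l + k)) c0" for k l
      by (metis add.commute comp_apply funpow_add)
    have qx: "?q ?x = (p ^^ (e + d)) c0" "?q ?y = (p ^^ (f + d)) c0" by (rule fa)+
    have qqx: "?q (?q ?x) = (p ^^ (e + 2 * d)) c0" "?q (?q ?y) = (p ^^ (f + 2 * d)) c0"
      unfolding fa by (simp_all add: mult_2 add.assoc)
    have wq: "same_word p L (?q ?x) (?q ?y)" by (rule same_word_funpow[OF that(2)])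
    have pos: "word_pos p L d (?q ?x) = word_pos p L d ?x" "word_pos p L d (?q ?y) = word_pos p L d ?x"
      using word_pos_cong[OF sw1[of e], of d] word_pos_cong[OF wq, of d] qx by auto
    have posy: "word_pos p L d ?y = word_pos p L d ?x" using word_pos_cong[OF that(2), of d] by simp
    have inq: "?q ?x \<in> S \<union> cyc" "?q ?y \<in> S \<union> cyc" unfolding qx using fs by auto
    have t1: "(?q ?x, ?q ?y) \<in> r \<longleftrightarrow> (if word_pos p L d ?x then (?x, ?y) \<in> r else (?y, ?x) \<in> r)"
      by (rule t[OF fs fs that(2)])
    have t2: "(?q ?y, ?q ?x) \<in> r \<longleftrightarrow> (if word_pos p L d ?x then (?y, ?x) \<in> r else (?x, ?y) \<in> r)"
      using t[OF fs fs same_word_sym[OF that(2)]] unfolding posy .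
    have t3: "(?q (?q ?x), ?q (?q ?y)) \<in> r \<longleftrightarrow>
        (if word_pos p L d ?x then (?q ?x, ?q ?y) \<in> r else (?q ?y, ?q ?x) \<in> r)"
      using t[OF inq wq] unfolding pos .
    have "(?q (?q ?x), ?q (?q ?y)) \<in> r"
      using t1 t2 t3 that(1) by (cases "word_pos p L d ?x") (simp_all only: if_True if_False)
    then show ?thesis unfolding qqx .
  qed
  have "(p ^^ (2 * d)) c0 = c0"
  proof (rule ccontr)
    assume ne: "(p ^^ (2 * d)) c0 \<noteq> c0"
    have w2: "same_word p L ((p ^^ (2 * d * k)) c0) ((p ^^ (2 * d * Suc k)) c0)" for k
      using sw[of "2 * d * k" 2] by (simp add: algebra_simps)
    have cyc_ret: "(p ^^ (2 * d * i)) c0 = c0" by (simp add: funpow_eq_c0_iff)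
    have "(c0, (p ^^ (2 * d)) c0) \<in> r \<or> ((p ^^ (2 * d)) c0, c0) \<in> r"
      using sl(4)[OF fs[of 0] fs[of "2 * d"]] ne by auto
    then show False
    proof
      assume "(c0, (p ^^ (2 * d)) c0) \<in> r"
      then have st: "((p ^^ (2 * d * k)) c0, (p ^^ (2 * d * Suc k)) c0) \<in> r" for k
      proof (induction k)
        case (Suc k)
        from twice[OF Suc.IH[OF Suc.prems] w2] show ?case by (simp add: algebra_simps)
      qed simp
      have "(c0, (p ^^ (2 * d * Suc k)) c0) \<in> r" for k
      proof (induction k)
        case (Suc k) then show ?case using sl(3) st[of "Suc k"] by blast
      qed (use st[of 0] in simp)
      from this[of "i - 1"] show False using i cyc_ret sl(1) by simp
    next
      assume "((p ^^ (2 * d)) c0, c0) \<in> r"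
      then have st: "((p ^^ (2 * d * Suc k)) c0, (p ^^ (2 * d * k)) c0) \<in> r" for k
      proof (induction k)
        case (Suc k)
        from twice[OF Suc.IH[OF Suc.prems] same_word_sym[OF w2]] show ?case by (simp add: algebra_simps)
      qed simp
      have "((p ^^ (2 * d * Suc k)) c0, c0) \<in> r" for k
      proof (induction k)
        case (Suc k) then show ?case using sl(3) st[of "Suc k"] by blast
      qed (use st[of 0] in simp)
      from this[of "i - 1"] show False using i cyc_ret sl(1) by simp
    qed
  qed
  then have "i dvd 2 * d" by (simp only: funpow_eq_c0_iff)
  then obtain k where k: "2 * d = i * k" by (elim dvdE)
  have "k = 1"
  proof -
    have "k \<noteq> 0" using k d by (cases "k = 0") auto
    moreover have "k < 2"
    proof (rule ccontr)
      assume "\<not> k < 2" then have "i * 2 \<le> i * k" by (intro mult_le_mono2) simp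
      then show False using k d by linarith
    qed
    ultimately show ?thesis by simp
  qed
  then show ?thesis using k by simp
qed

section \<open>Upper bound for the number of extensions\<close>

lemma ext_labels:
  assumes "(L, r) \<in> ext L' r'" "restrict L cyc = w"
  shows "x \<in> S \<Longrightarrow> L x = L' x" "x \<in> cyc \<Longrightarrow> L x = w x" "x \<notin> S \<union> cyc \<Longrightarrow> L x = undefined"
proof -
  have "restrict L S = L'" "L \<in> S \<union> cyc \<rightarrow>\<^sub>E {..<K}" using assms by (auto simp: ext_def configs_def)
  then show "x \<in> S \<Longrightarrow> L x = L' x" "x \<in> cyc \<Longrightarrow> L x = w x" "x \<notin> S \<union> cyc \<Longrightarrow> L x = undefined"
    using assms(2) by (auto simp: PiE_def extensional_def)
qed

lemma return_shift:
  assumes "e < f" "f < i"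
  shows "(p ^^ (i - e)) ((p ^^ f) c0) = (p ^^ (f - e)) c0"
proof -
  have "(p ^^ (i - e)) ((p ^^ f) c0) = (p ^^ (i + (f - e))) c0"
    using funpow_add[of "i - e" f p, THEN fun_cong, of c0] assms by simp
  also have "\<dots> = (p ^^ (f - e)) c0"
    using funpow_add[of "f - e" i p, THEN fun_cong, of c0] period by (simp add: add.commute)
  finally show ?thesis .
qed

lemma same_word_imp_rot:
  assumes w: "w \<in> cyc \<rightarrow>\<^sub>E {..<K}" and L: "\<And>x. x \<in> cyc \<Longrightarrow> L x = w x"
    and sw: "same_word p L c0 ((p ^^ d) c0)"
  shows "w \<in> rot d"
proof -
  have "w ((p ^^ (k + d)) c0) = w ((p ^^ k) c0)" for k
  proof -
    have "L ((p ^^ k) c0) = L ((p ^^ k) ((p ^^ d) c0))" using sw unfolding same_word_def by blast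
    moreover have "(p ^^ k) ((p ^^ d) c0) = (p ^^ (k + d)) c0" by (simp add: funpow_add)
    ultimately show ?thesis using L[OF funpow_cyc] by metis
  qed
  then show ?thesis using w by (simp add: rot_def)
qed

text \<open>Once the labels are known, an extension is determined by the number of tied points of
  \<open>S\<close> below \<open>c0\<close> and, for a word of period \<open>i / 2\<close>, by the
  order of \<open>c0\<close> and its antipode. One inclusion is enough, as the hypotheses are
  symmetric in \<open>r1\<close> and \<open>r2\<close>.\<close>

lemma ext_eqI:
  assumes 1: "(L, r1) \<in> ext L' r'" and 2: "(L, r2) \<in> ext L' r'" and w: "restrict L cyc = w"
    and pos: "card {y \<in> ties L' w. (y, c0) \<in> r1} = card {y \<in> ties L' w. (y, c0) \<in> r2}"
    and half: "\<And>d. 2 * d = i \<Longrightarrow> w \<in> rot d \<Longrightarrow> (c0, (p ^^ d) c0) \<in> r1 \<longleftrightarrow> (c0, (p ^^ d) c0) \<in> r2"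
  shows "r1 \<subseteq> r2"
proof -
  let ?U = "S \<union> cyc"
  have c1: "(L, r1) \<in> configs p K ?U" and c2: "(L, r2) \<in> configs p K ?U"
    and r1: "r1 \<inter> S \<times> S = r'" and r2: "r2 \<inter> S \<times> S = r'"
    using 1 2 by (auto simp: ext_def)
  note sl1 = strict_linD[OF configs_strict_lin[OF c1]] and sl2 = strict_linD[OF configs_strict_lin[OF c2]]
  define eqr where "eqr = (\<lambda>x y. (x, y) \<in> r1 \<longleftrightarrow> (x, y) \<in> r2)"
  have eqr_sym: "eqr y x" if "eqr x y" "x \<in> ?U" "y \<in> ?U" for x y
  proof (cases "x = y")
    case False
    then have "(y, x) \<in> r1 \<longleftrightarrow> (x, y) \<notin> r1" "(y, x) \<in> r2 \<longleftrightarrow> (x, y) \<notin> r2"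
      using sl1(2)[of x y] sl1(2)[of y x] sl1(4)[OF that(2,3)] sl2(2)[of x y] sl2(2)[of y x] sl2(4)[OF that(2,3)]
      by argo+
    then show ?thesis using that(1) by (simp add: eqr_def)
  qed (use that in simp)
  \<comment> \<open>Both orders are transported by the same rule, because it depends only on the
    common labels; agreement may thus be tested after applying a power of \<open>p\<close>.\<close>
  have tr: "eqr x y" if "eqr ((p ^^ e) x) ((p ^^ e) y)" "x \<in> ?U" "y \<in> ?U" "same_word p L x y" for x y e
  proof -
    have "word_pos p L e x \<Longrightarrow> eqr x y" "\<not> word_pos p L e x \<Longrightarrow> eqr y x"
      using that(1) unfolding eqr_def configs_transport[OF c1 invSc K inj that(2-4)]
        configs_transport[OF c2 invSc K inj that(2-4)] by simp_all
    then show ?thesis using eqr_sym[OF _ that(3,2)] by argo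
  qed
  have LL: "\<And>x. x \<in> S \<Longrightarrow> L x = L' x" "\<And>x. x \<in> cyc \<Longrightarrow> L x = w x" using ext_labels[OF 1 w] by auto
  have eq_S: "eqr x y" if "x \<in> S" "y \<in> S" for x y using that r1 r2 unfolding eqr_def by blast
  \<comment> \<open>The tied points below \<open>c0\<close> form an initial segment of the tied
    points in the order \<open>r'\<close>. Initial segments of one chain are nested, so equal
    cardinality makes them equal.\<close>
  have down: "{y \<in> ties L' w. (y, c0) \<in> r1} = {y \<in> ties L' w. (y, c0) \<in> r2}" (is "?D1 = ?D2")
  proof -
    have fin: "finite ?D1" "finite ?D2" using finite_ties[of L' w] by auto
    have tS: "ties L' w \<subseteq> S" by (auto simp: ties_def)
    have "?D1 \<subseteq> ?D2 \<or> ?D2 \<subseteq> ?D1"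
    proof (rule ccontr)
      assume "\<not> ?thesis"
      then obtain y z where y: "y \<in> ?D1" "y \<notin> ?D2" and z: "z \<in> ?D2" "z \<notin> ?D1" by blast
      have yz: "y \<in> S" "z \<in> S" "y \<noteq> z" "y \<noteq> c0" "z \<noteq> c0" using y z tS c0 by auto
      have c: "c0 \<in> ?U" using funpow_cyc[of 0] by simp
      have y': "y \<in> ties L' w" "(y, c0) \<in> r1" "(y, c0) \<notin> r2" using y by blast+
      have z': "z \<in> ties L' w" "(z, c0) \<in> r2" "(z, c0) \<notin> r1" using z by blast+
      have "(c0, y) \<in> r2" using sl2(4)[OF c UnI1[OF yz(1)]] yz(4) y'(3) by metis
      then have 1: "(z, y) \<in> r2" by (rule sl2(3)[OF z'(2)])
      have "(c0, z) \<in> r1" using sl1(4)[OF c UnI1[OF yz(2)]] yz(5) z'(3) by metis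
      then have 2: "(y, z) \<in> r1" by (rule sl1(3)[OF y'(2)])
      have "(y, z) \<in> r2" using eq_S[OF yz(1,2)] 2 unfolding eqr_def by simp
      then show False using sl2(2)[OF 1] by simp
    qed
    then show ?thesis
      using card_subset_eq[OF fin(2), of ?D1] card_subset_eq[OF fin(1), of ?D2] pos by auto
  qed
  have eq_c0: "eqr y c0" if "y \<in> S" "same_word p L y c0" for y
  proof -
    have "L' ((p ^^ e) y) = w ((p ^^ e) c0)" for e
      using that(2)[unfolded same_word_def, rule_format, of e] LL(1)[OF funpow_S[OF that(1)]] LL(2)[OF funpow_cyc]
      by metis
    then have "y \<in> ties L' w" unfolding ties_def using that(1) by blast
    then show ?thesis using down unfolding eqr_def by blast
  qed
  have eq_mixed: "eqr x y" if xy: "x \<in> S" "y \<in> cyc" "same_word p L x y" for x y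
  proof -
    obtain e where e: "e < i" "y = (p ^^ e) c0" using xy(2) by (rule cycE)
    have "same_word p L ((p ^^ (i - e)) x) c0"
      using same_word_funpow[OF xy(3), of "i - e"] return_c0[OF e(1)] e(2) by simp
    then have "eqr ((p ^^ (i - e)) x) ((p ^^ (i - e)) y)"
      using eq_c0[OF funpow_S[OF xy(1)]] return_c0[OF e(1)] e(2) by simp
    then show ?thesis by (rule tr[OF _ UnI1[OF xy(1)] UnI2[OF xy(2)] xy(3)])
  qed
  have eq_cyc: "eqr ((p ^^ e) c0) ((p ^^ f) c0)"
    if ef: "e < f" "f < i" "same_word p L ((p ^^ e) c0) ((p ^^ f) c0)" for e f
  proof -
    define d where "d = f - e"
    have d: "0 < d" "d < i" using ef by (auto simp: d_def)
    have f: "(p ^^ (i - e)) ((p ^^ f) c0) = (p ^^ d) c0" using return_shift ef(1,2) by (simp add: d_def)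
    have e: "(p ^^ (i - e)) ((p ^^ e) c0) = c0" using return_c0 ef by auto
    have sw: "same_word p L c0 ((p ^^ d) c0)" using same_word_funpow[OF ef(3), of "i - e"] unfolding e f .
    have i2: "2 * d = i" by (rule same_word_c0_shift[OF c1 d sw])
    have "w \<in> cyc \<rightarrow>\<^sub>E {..<K}" using c1 w by (fastforce simp: configs_def)
    then have "w \<in> rot d" using LL(2) sw by (rule same_word_imp_rot)
    then have "eqr c0 ((p ^^ d) c0)" using half[OF i2] unfolding eqr_def by blast
    then have "eqr ((p ^^ (i - e)) ((p ^^ e) c0)) ((p ^^ (i - e)) ((p ^^ f) c0))" unfolding e f .
    then show ?thesis by (rule tr[OF _ UnI2[OF funpow_cyc] UnI2[OF funpow_cyc] ef(3)])
  qed
  have all: "eqr x y" if xy: "x \<in> ?U" "y \<in> ?U" for x y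
  proof (cases "same_word p L x y")
    case False
    then show ?thesis
      using configs_word_val_iff[OF c1 invSc K xy False] configs_word_val_iff[OF c2 invSc K xy False]
      by (simp add: eqr_def)
  next
    case True
    consider "x \<in> S" "y \<in> S" | "x \<in> S" "y \<in> cyc" | "x \<in> cyc" "y \<in> S" | "x \<in> cyc" "y \<in> cyc" using xy by blast
    then show ?thesis
    proof cases
      case 1 then show ?thesis by (rule eq_S)
    next
      case 2 then show ?thesis using eq_mixed True by blast
    next
      case 3 then show ?thesis by (intro eqr_sym[OF eq_mixed[OF 3(2,1) same_word_sym[OF True]] xy(2,1)])
    next
      case 4
      obtain e where e: "e < i" "x = (p ^^ e) c0" using 4(1) by (rule cycE)
      obtain f where f: "f < i" "y = (p ^^ f) c0" using 4(2) by (rule cycE)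
      consider "e < f" | "e = f" | "f < e" by linarith
      then show ?thesis
      proof cases
        case 1
        show ?thesis using eq_cyc[OF 1 f(1) True[unfolded e(2) f(2)]] unfolding e(2) f(2) .
      next
        case 2
        then have "x = y" unfolding e(2) f(2) by simp
        then show ?thesis using sl1(1)[of x] sl2(1)[of x] unfolding eqr_def by blast
      next
        case 3
        have "eqr y x"
          using eq_cyc[OF 3 e(1) same_word_sym[OF True, unfolded e(2) f(2)]] unfolding e(2) f(2) .
        then show ?thesis by (rule eqr_sym[OF _ xy(2,1)])
      qed
    qed
  qed
  show ?thesis
  proof (rule subrelI)
    fix x y assume xy: "(x, y) \<in> r1"
    have "eqr x y" using sl1(5)[OF xy] by (intro all) blast+
    then show "(x, y) \<in> r2" using xy unfolding eqr_def by blast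
  qed
qed

lemma finite_ext: "finite (ext L' r')"
  by (rule finite_subset[OF _ finite_configs[of "S \<union> cyc" p K]]) (auto simp: ext_def fin finite_cyc)

lemma card_ext_fiber_le:
  "card {(L, r) \<in> ext L' r'. restrict L cyc = w}
     \<le> (1 + card (ties L' w)) * (1 + (if even i \<and> w \<in> rot (i div 2) then 1 else 0))" (is "card ?A \<le> _")
proof -
  let ?sq = "even i \<and> w \<in> rot (i div 2)"
  let ?f = "\<lambda>(L, r). (card {y \<in> ties L' w. (y, c0) \<in> r}, ?sq \<and> (c0, (p ^^ (i div 2)) c0) \<in> r)"
  let ?B = "{..card (ties L' w)} \<times> (if ?sq then UNIV else {False})"
  have "inj_on ?f ?A"
  proof (rule inj_onI)
    fix a b assume a: "a \<in> ?A" and b: "b \<in> ?A" and fab: "?f a = ?f b"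
    obtain L r where ar: "a = (L, r)" by (cases a)
    obtain L2 r2 where br: "b = (L2, r2)" by (cases b)
    have A: "(L, r) \<in> ext L' r'" "(L2, r2) \<in> ext L' r'" and w: "restrict L cyc = w" "restrict L2 cyc = w"
      using a b ar br by simp_all
    have f: "card {y \<in> ties L' w. (y, c0) \<in> r} = card {y \<in> ties L' w. (y, c0) \<in> r2}"
        "(?sq \<and> (c0, (p ^^ (i div 2)) c0) \<in> r) = (?sq \<and> (c0, (p ^^ (i div 2)) c0) \<in> r2)"
      using fab unfolding ar br by simp_all
    have L: "L2 = L"
    proof
      fix x show "L2 x = L x"
        using ext_labels[OF A(1) w(1), of x] ext_labels[OF A(2) w(2), of x] by (cases "x \<in> S"; cases "x \<in> cyc") auto
    qed
    have half: "(c0, (p ^^ d) c0) \<in> r \<longleftrightarrow> (c0, (p ^^ d) c0) \<in> r2" if "2 * d = i" "w \<in> rot d" for d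
    proof -
      have "even i" "i div 2 = d" using that(1) by auto
      then show ?thesis using f(2) that(2) by simp
    qed
    have "r \<subseteq> r2" by (rule ext_eqI[OF A(1) A(2)[unfolded L] w(1) f(1) half])
    moreover have "r2 \<subseteq> r" by (rule ext_eqI[OF A(2)[unfolded L] A(1) w(1) f(1)[symmetric] half[symmetric]])
    ultimately show "a = b" using L ar br by simp
  qed
  moreover have "?f ` ?A \<subseteq> ?B"
  proof (rule image_subsetI)
    fix a assume "a \<in> ?A"
    obtain L r where ar: "a = (L, r)" by (cases a)
    have "card {y \<in> ties L' w. (y, c0) \<in> r} \<le> card (ties L' w)"
      by (rule card_mono[OF finite_ties]) auto
    then show "?f a \<in> ?B" unfolding ar by auto
  qed
  moreover have "finite ?B" by simp
  ultimately have "card ?A \<le> card ?B" by (rule card_inj_on_le)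
  also have "card ?B = (1 + card (ties L' w)) * (1 + (if ?sq then 1 else 0))"
    by (simp add: card_cartesian_product card_UNIV_bool)
  finally show ?thesis .
qed

text \<open>With \<open>t\<close> ties and \<open>s = 1\<close> or \<open>s = 0\<close> according to
  the half period, \<open>(1 + t) * (1 + s) \<le> 1 + 2 * t + s\<close>. Summed over all words, the
  ties give at most \<open>card S\<close> and the half periods at most \<open>K ^ (i div 2)\<close>;
  the extra factor \<open>i\<close> only matches the lower bound.\<close>

lemma card_ext_le: "card (ext L' r') \<le> K ^ i + 2 * card S + i * K ^ (i div 2)"
proof -
  let ?W = "cyc \<rightarrow>\<^sub>E {..<K}"
  let ?sq = "\<lambda>w. if even i \<and> w \<in> rot (i div 2) then 1 else (0::nat)"
  have "ext L' r' = (\<Union>w\<in>?W. {(L, r) \<in> ext L' r'. restrict L cyc = w})"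
  proof (intro equalityI subsetI)
    fix a assume a: "a \<in> ext L' r'"
    obtain L r where ar: "a = (L, r)" by (cases a)
    have "L \<in> S \<union> cyc \<rightarrow>\<^sub>E {..<K}" using a by (simp add: ar ext_def configs_def)
    then have "restrict L cyc \<in> ?W" by (simp add: PiE_def Pi_def)
    then show "a \<in> (\<Union>w\<in>?W. {(L, r) \<in> ext L' r'. restrict L cyc = w})" using a ar by simp
  qed auto
  then have "card (ext L' r') = card (\<Union>w\<in>?W. {(L, r) \<in> ext L' r'. restrict L cyc = w})" by (rule arg_cong)
  also have "\<dots> \<le> (\<Sum>w\<in>?W. card {(L, r) \<in> ext L' r'. restrict L cyc = w})"
    by (rule card_UN_le[OF finite_words])
  also have "\<dots> \<le> (\<Sum>w\<in>?W. 1 + 2 * card (ties L' w) + ?sq w)"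
  proof (rule sum_mono)
    fix w
    have "card {(L, r) \<in> ext L' r'. restrict L cyc = w} \<le> (1 + card (ties L' w)) * (1 + ?sq w)"
      by (rule card_ext_fiber_le)
    also have "\<dots> \<le> 1 + 2 * card (ties L' w) + ?sq w" by (simp split: if_split)
    finally show "card {(L, r) \<in> ext L' r'. restrict L cyc = w} \<le> 1 + 2 * card (ties L' w) + ?sq w" .
  qed
  also have "\<dots> = card ?W + 2 * (\<Sum>w\<in>?W. card (ties L' w)) + (\<Sum>w\<in>?W. ?sq w)"
    unfolding sum.distrib sum_distrib_left by simp
  also have "(\<Sum>w\<in>?W. ?sq w) \<le> i * K ^ (i div 2)"
  proof (cases "even i")
    case True
    have "(\<Sum>w\<in>?W. ?sq w) = card (?W \<inter> rot (i div 2))" using True finite_words by (simp add: sum.If_cases)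
    also have "\<dots> \<le> card (rot (i div 2))"
      by (rule card_mono) (auto intro!: finite_subset[OF _ finite_words] simp: rot_def)
    also have "\<dots> \<le> K ^ (i div 2)" using True i by (intro card_rot_le) auto
    also have "\<dots> \<le> i * K ^ (i div 2)" using i by simp
    finally show ?thesis .
  qed simp
  finally show ?thesis using sum_card_ties_le[of L'] card_words by linarith
qed

section \<open>Lower bound: extensions by generic words\<close>

lemma rot_complement:
  assumes "w \<in> rot d" "d \<le> i"
  shows "w \<in> rot (i - d)"
proof -
  have "w ((p ^^ (e + (i - d))) c0) = w ((p ^^ e) c0)" for e
  proof -
    have "w ((p ^^ (e + (i - d))) c0) = w ((p ^^ (e + (i - d) + d)) c0)"
      using assms(1) unfolding rot_def by simp
    also have "e + (i - d) + d = e + i" using assms(2) by simp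
    also have "(p ^^ (e + i)) c0 = (p ^^ e) c0" by (simp add: funpow_add period)
    finally show ?thesis .
  qed
  then show ?thesis using assms(1) by (simp add: rot_def)
qed

text \<open>For a generic word the values on the cycle differ from each other and from those on
  \<open>S\<close>. Ordering by value, with the remaining ties inside \<open>S\<close> broken by
  \<open>r'\<close>, is then compatible. Periods come in pairs \<open>d\<close> and
  \<open>i - d\<close>, so it is enough to exclude those up to \<open>i div 2\<close>.\<close>

lemma generic_ext:
  assumes c: "(L', r') \<in> configs p K S" and w: "w \<in> cyc \<rightarrow>\<^sub>E {..<K}"
    and ties: "ties L' w = {}" and rot: "\<And>d. d \<in> {1..i div 2} \<Longrightarrow> w \<notin> rot d"
  shows "\<exists>L r. (L, r) \<in> ext L' r' \<and> restrict L cyc = w"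
proof -
  let ?U = "S \<union> cyc"
  define L where "L = (\<lambda>x. if x \<in> S then L' x else if x \<in> cyc then w x else undefined)"
  have L'E: "L' \<in> S \<rightarrow>\<^sub>E {..<K}" using c by (simp add: configs_def)
  have LS: "x \<in> S \<Longrightarrow> L x = L' x" and Lc: "x \<in> cyc \<Longrightarrow> L x = w x" for x
    using disj by (auto simp: L_def)
  have LE: "L \<in> ?U \<rightarrow>\<^sub>E {..<K}"
  proof (rule PiE_I)
    show "L x \<in> {..<K}" if "x \<in> ?U" for x
      using that LS Lc PiE_mem[OF L'E] PiE_mem[OF w] by (cases "x \<in> S") auto
  qed (auto simp: L_def)
  interpret U: labelled p K ?U L
    using LE invSc K by unfold_locales (auto simp: PiE_def Pi_def)
  define v where "v = word_val p K L"
  have vS: "word_val p K L' x = v x" if "x \<in> S" for x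
    unfolding v_def word_val_def using LS[OF funpow_S[OF that]] by simp
  note sl = strict_linD[OF configs_strict_lin[OF c]]
  have mono': "v x \<le> v y" if "(x, y) \<in> r'" for x y
    using configs_word_val_mono[OF c invS K that] vS sl(5)[OF that] by simp
  have cross: "\<not> same_word p L x y" if xy: "x \<in> S" "y \<in> cyc" for x y
  proof
    assume sw: "same_word p L x y"
    obtain e where e: "e < i" "y = (p ^^ e) c0" using xy(2) by (rule cycE)
    have xS: "(p ^^ (i - e)) x \<in> S" by (rule funpow_S[OF xy(1)])
    have sw': "same_word p L ((p ^^ (i - e)) x) c0"
      using same_word_funpow[OF sw, of "i - e"] return_c0[OF e(1)] unfolding e(2) by simp
    have "L' ((p ^^ k) ((p ^^ (i - e)) x)) = w ((p ^^ k) c0)" for k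
      using sw'[unfolded same_word_def, rule_format, of k] LS[OF funpow_S[OF xS]] Lc[OF funpow_cyc] by metis
    then have "(p ^^ (i - e)) x \<in> ties L' w" unfolding ties_def using xS by blast
    then show False using ties by blast
  qed
  have inner: "\<not> same_word p L ((p ^^ e) c0) ((p ^^ f) c0)" if ef: "e < f" "f < i" for e f
  proof
    assume sw: "same_word p L ((p ^^ e) c0) ((p ^^ f) c0)"
    define d where "d = f - e"
    have d: "1 \<le> d" "d < i" using ef by (auto simp: d_def)
    have ei: "e < i" using ef by simp
    have sw0: "same_word p L c0 ((p ^^ d) c0)"
      using same_word_funpow[OF sw, of "i - e"] unfolding return_c0[OF ei] return_shift[OF ef] d_def .
    have wd: "w \<in> rot d" using w Lc sw0 by (rule same_word_imp_rot)
    show False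
    proof (cases "d \<le> i div 2")
      case True
      then show False using rot[of d] wd d by simp
    next
      case False
      then have "i - d \<in> {1..i div 2}" using d by auto
      then show False using rot rot_complement[OF wd] d by simp
    qed
  qed
  have tie: "x \<in> S \<and> y \<in> S" if "x \<in> ?U" "y \<in> ?U" "x \<noteq> y" "v x = v y" for x y
  proof -
    have sw: "same_word p L x y" using U.word_val_eq_iff[OF that(1,2)] that(4) by (simp add: v_def)
    have "False" if "x \<in> cyc" "y \<in> cyc"
    proof -
      obtain e where e: "e < i" "x = (p ^^ e) c0" using \<open>x \<in> cyc\<close> by (rule cycE)
      obtain f where f: "f < i" "y = (p ^^ f) c0" using \<open>y \<in> cyc\<close> by (rule cycE)
      have "e \<noteq> f" using \<open>x \<noteq> y\<close> e f by auto
      then show False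
        using inner[of e f] inner[of f e] sw same_word_sym[OF sw] e f by (metis linorder_neqE_nat)
    qed
    then show ?thesis using cross[of x y] cross[of y x] sw same_word_sym[OF sw] that(1,2) by blast
  qed
  define r where "r = {(x, y). x \<in> ?U \<and> y \<in> ?U \<and> (v x < v y \<or> v x = v y \<and> (x, y) \<in> r')}"
  have lin: "strict_lin ?U r"
    unfolding strict_lin_def
  proof (intro conjI ballI impI)
    show "r \<subseteq> ?U \<times> ?U" by (auto simp: r_def)
    show "irrefl r" using sl(1) by (auto simp: irrefl_def r_def)
    show "trans r"
    proof (rule transI)
      fix x y z assume "(x, y) \<in> r" "(y, z) \<in> r"
      then show "(x, z) \<in> r" using sl(3)[of x y z] unfolding r_def by auto
    qed
    fix x y assume xy: "x \<in> ?U" "y \<in> ?U" "x \<noteq> y"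
    consider "v x < v y" | "v y < v x" | "v x = v y" by linarith
    then show "(x, y) \<in> r \<or> (y, x) \<in> r"
    proof cases
      case 3
      then have "(x, y) \<in> r' \<or> (y, x) \<in> r'" using tie[OF xy 3] sl(4) xy by blast
      then show ?thesis using 3 xy by (auto simp: r_def)
    qed (use xy in \<open>auto simp: r_def\<close>)
  qed
  have rel: "L x < L y \<or> L x = L y \<and> (if odd (L x) then (p x, p y) \<in> r else (p y, p x) \<in> r)"
    if "(x, y) \<in> r" for x y
  proof -
    have xy: "x \<in> ?U" "y \<in> ?U" using that by (auto simp: r_def)
    have pU: "p x \<in> ?U" "p y \<in> ?U" using invSc xy by auto
    show ?thesis
    proof (cases "v x < v y")
      case True
      have "\<not> L y < L x" using U.word_val_less[OF xy(2,1)] True by (auto simp: v_def)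
      moreover have "if odd (L x) then (p x, p y) \<in> r else (p y, p x) \<in> r" if "L x = L y"
      proof -
        have "v (p x) - v (p y) = letter_sign (L x) * (2 * real K) * (v x - v y)"
          unfolding v_def by (rule U.word_val_diff[OF xy that])
        moreover have "(2 * real K) * (v x - v y) < 0" using True K by (simp add: mult_less_0_iff)
        ultimately have "if odd (L x) then v (p x) < v (p y) else v (p y) < v (p x)"
          by (auto simp: letter_sign_def)
        then show ?thesis using pU by (auto simp: r_def split: if_splits)
      qed
      ultimately show ?thesis by linarith
    next
      case False
      then have v: "v x = v y" and r': "(x, y) \<in> r'" using that by (auto simp: r_def)
      have S: "x \<in> S" "y \<in> S" using sl(5)[OF r'] by auto
      have sw: "same_word p L x y" using U.word_val_eq_iff[OF xy] v by (simp add: v_def)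
      have eq: "L x = L y" and swp: "same_word p L (p x) (p y)" using sw same_word_step by metis+
      have vp: "v (p x) = v (p y)" using U.word_val_eq_iff[OF pU] swp by (simp add: v_def)
      have "if odd (L x) then (p x, p y) \<in> r' else (p y, p x) \<in> r'"
        using configs_rel[OF c r'] eq LS[OF S(1)] LS[OF S(2)] by auto
      then show ?thesis using eq vp pU by (auto simp: r_def split: if_splits)
    qed
  qed
  have rr: "r \<inter> S \<times> S = r'"
  proof (intro equalityI subrelI)
    fix x y assume xy: "(x, y) \<in> r \<inter> S \<times> S"
    then have S: "x \<in> S" "y \<in> S" and r: "(x, y) \<in> r" by auto
    have "x \<noteq> y" using strict_linD(1)[OF lin] r by auto
    show "(x, y) \<in> r'"
    proof (rule ccontr)
      assume n: "(x, y) \<notin> r'"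
      then have "(y, x) \<in> r'" using sl(4)[OF S \<open>x \<noteq> y\<close>] by blast
      then have "v y \<le> v x" by (rule mono')
      then show False using r n by (auto simp: r_def)
    qed
  next
    fix x y assume xy: "(x, y) \<in> r'"
    then show "(x, y) \<in> r \<inter> S \<times> S" using mono'[OF xy] sl(5)[OF xy] by (auto simp: r_def)
  qed
  have "(L, r) \<in> configs p K ?U" unfolding configs_def using LE lin rel by blast
  moreover have "restrict L S = L'"
    using L'E LS by (auto simp: fun_eq_iff PiE_def extensional_def restrict_def)
  moreover have "restrict L cyc = w"
    using w Lc by (auto simp: fun_eq_iff PiE_def extensional_def restrict_def)
  ultimately show ?thesis using rr by (auto simp: ext_def)
qed

text \<open>Each point of \<open>S\<close> excludes at most one word and each
  \<open>d \<le> i div 2\<close> at most \<open>K ^ d\<close> words; all remaining words are generic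
  and have at least one extension.\<close>

lemma card_ext_ge:
  assumes c: "(L', r') \<in> configs p K S"
  shows "K ^ i \<le> card (ext L' r') + card S + i * K ^ (i div 2)"
proof -
  let ?W = "cyc \<rightarrow>\<^sub>E {..<K}"
  define W1 where "W1 = (\<Union>y\<in>S. {w \<in> ?W. y \<in> ties L' w})"
  define W2 where "W2 = (\<Union>d\<in>{1..i div 2}. rot d)"
  define W0 where "W0 = ?W - (W1 \<union> W2)"
  have sub: "W0 \<subseteq> (\<lambda>(L, r). restrict L cyc) ` ext L' r'"
  proof
    fix w assume w: "w \<in> W0"
    have wW: "w \<in> ?W" using w by (simp add: W0_def)
    have "ties L' w = {}"
    proof (rule ccontr)
      assume "ties L' w \<noteq> {}"
      then obtain y where y: "y \<in> ties L' w" by blast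
      then have "y \<in> S" by (simp add: ties_def)
      then have "w \<in> W1" using y wW unfolding W1_def by blast
      then show False using w by (simp add: W0_def)
    qed
    moreover have "w \<notin> rot d" if "d \<in> {1..i div 2}" for d using w that unfolding W0_def W2_def by blast
    ultimately obtain L r where "(L, r) \<in> ext L' r'" "restrict L cyc = w"
      using generic_ext[OF c wW] by blast
    then show "w \<in> (\<lambda>(L, r). restrict L cyc) ` ext L' r'" by force
  qed
  have c0: "card W0 \<le> card (ext L' r')"
    using card_mono[OF finite_imageI[OF finite_ext] sub] card_image_le[OF finite_ext] le_trans by blast
  have c1: "card W1 \<le> card S"
  proof -
    have "card W1 \<le> (\<Sum>y\<in>S. card {w \<in> ?W. y \<in> ties L' w})" unfolding W1_def by (rule card_UN_le[OF fin])
    also have "\<dots> \<le> (\<Sum>y\<in>S. 1)" by (rule sum_mono) (rule card_tied_words_le)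
    finally show ?thesis by simp
  qed
  have c2: "card W2 \<le> i * K ^ (i div 2)"
  proof -
    have "card W2 \<le> (\<Sum>d\<in>{1..i div 2}. card (rot d))" unfolding W2_def by (rule card_UN_le) simp
    also have "\<dots> \<le> (\<Sum>d\<in>{1..i div 2}. K ^ (i div 2))"
    proof (rule sum_mono)
      fix d assume d: "d \<in> {1..i div 2}"
      have "card (rot d) \<le> K ^ d" using d by (intro card_rot_le) auto
      also have "\<dots> \<le> K ^ (i div 2)" using d K by (intro power_increasing) auto
      finally show "card (rot d) \<le> K ^ (i div 2)" .
    qed
    also have "\<dots> = (i div 2) * K ^ (i div 2)" by simp
    also have "\<dots> \<le> i * K ^ (i div 2)" by (intro mult_le_mono1) simp
    finally show ?thesis .
  qed
  have "finite W0" "finite W1" "finite W2"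
    using finite_words fin by (auto simp: W0_def W1_def W2_def rot_def)
  have "?W \<subseteq> W0 \<union> (W1 \<union> W2)" by (auto simp: W0_def)
  then have "K ^ i \<le> card (W0 \<union> (W1 \<union> W2))"
    unfolding card_words[symmetric] using \<open>finite W0\<close> \<open>finite W1\<close> \<open>finite W2\<close> by (intro card_mono) auto
  also have "\<dots> \<le> card W0 + (card W1 + card W2)"
    by (rule order_trans[OF card_Un_le add_left_mono[OF card_Un_le]])
  finally show ?thesis using c0 c1 c2 by linarith
qed

lemma configs_restrict:
  assumes "(L, r) \<in> configs p K (S \<union> cyc)"
  shows "(restrict L S, r \<inter> S \<times> S) \<in> configs p K S"
proof -
  have L: "L \<in> S \<union> cyc \<rightarrow>\<^sub>E {..<K}" and lin: "strict_lin (S \<union> cyc) r" using assms by (auto simp: configs_def)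
  note sl = strict_linD[OF lin]
  have "restrict L S \<in> S \<rightarrow>\<^sub>E {..<K}" using L by (simp add: PiE_def Pi_def)
  moreover have "strict_lin S (r \<inter> S \<times> S)"
    unfolding strict_lin_def
  proof (intro conjI ballI impI)
    show "irrefl (r \<inter> S \<times> S)" using sl(1) by (auto simp: irrefl_def)
    show "trans (r \<inter> S \<times> S)"
    proof (rule transI)
      fix x y z assume "(x, y) \<in> r \<inter> S \<times> S" "(y, z) \<in> r \<inter> S \<times> S"
      then show "(x, z) \<in> r \<inter> S \<times> S" using sl(3)[of x y z] by simp
    qed
    fix x y assume "x \<in> S" "y \<in> S" "x \<noteq> y"
    then show "(x, y) \<in> r \<inter> S \<times> S \<or> (y, x) \<in> r \<inter> S \<times> S" using sl(4)[of x y] by simp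
  qed simp
  moreover have "restrict L S x < restrict L S y \<or> restrict L S x = restrict L S y \<and>
      (if odd (restrict L S x) then (p x, p y) \<in> r \<inter> S \<times> S else (p y, p x) \<in> r \<inter> S \<times> S)"
    if "(x, y) \<in> r \<inter> S \<times> S" for x y
  proof -
    have xy: "(x, y) \<in> r" "x \<in> S" "y \<in> S" using that by auto
    then have "p x \<in> S" "p y \<in> S" using invS by auto
    then show ?thesis using configs_rel[OF assms xy(1)] xy by auto
  qed
  ultimately show ?thesis unfolding configs_def by blast
qed

lemma card_configs_bounds:
  "card (configs p K (S \<union> cyc)) \<le> card (configs p K S) * (K ^ i + 2 * card S + i * K ^ (i div 2))"
  "card (configs p K S) * K ^ i \<le> card (configs p K (S \<union> cyc)) + card (configs p K S) * (card S + i * K ^ (i div 2))"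
proof -
  let ?C = "configs p K S"
  have finC: "finite ?C" by (rule finite_configs[OF fin])
  have eq: "configs p K (S \<union> cyc) = (\<Union>a\<in>?C. ext (fst a) (snd a))"
  proof (intro equalityI subsetI)
    fix b assume b: "b \<in> configs p K (S \<union> cyc)"
    obtain L r where Lr: "b = (L, r)" by (cases b)
    have "b \<in> ext (fst (restrict L S, r \<inter> S \<times> S)) (snd (restrict L S, r \<inter> S \<times> S))"
      using b by (simp add: ext_def Lr)
    then show "b \<in> (\<Union>a\<in>?C. ext (fst a) (snd a))"
      by (rule UN_I[OF configs_restrict[OF b[unfolded Lr]]])
  qed (auto simp: ext_def)
  have card: "card (configs p K (S \<union> cyc)) = (\<Sum>a\<in>?C. card (ext (fst a) (snd a)))"
    unfolding eq
  proof (rule card_UN_disjoint[OF finC])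
    show "\<forall>a\<in>?C. finite (ext (fst a) (snd a))" using finite_ext by blast
    show "\<forall>a\<in>?C. \<forall>b\<in>?C. a \<noteq> b \<longrightarrow> ext (fst a) (snd a) \<inter> ext (fst b) (snd b) = {}"
      by (auto simp: ext_def)
  qed
  show "card (configs p K (S \<union> cyc)) \<le> card ?C * (K ^ i + 2 * card S + i * K ^ (i div 2))"
    unfolding card using sum_bounded_above[of ?C "\<lambda>a. card (ext (fst a) (snd a))"] card_ext_le by simp
  have "card ?C * K ^ i = (\<Sum>a\<in>?C. K ^ i)" by simp
  also have "\<dots> \<le> (\<Sum>a\<in>?C. card (ext (fst a) (snd a)) + (card S + i * K ^ (i div 2)))"
    by (rule sum_mono) (use card_ext_ge in \<open>auto simp: add.assoc\<close>)
  also have "\<dots> = card (configs p K (S \<union> cyc)) + card ?C * (card S + i * K ^ (i div 2))"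
    unfolding card by (simp add: sum.distrib)
  finally show "card ?C * K ^ i \<le> card (configs p K (S \<union> cyc)) + card ?C * (card S + i * K ^ (i div 2))" .
qed

end

section \<open>Removing the cycles down to the fixed points\<close>

lemma orbit_decomposition:
  assumes inj: "inj p" and fin: "finite S" and inv: "p ` S \<subseteq> S" and K: "K \<ge> 1" and c0: "c0 \<in> S" "p c0 \<noteq> c0"
  obtains i T where "2 \<le> i" "T \<subseteq> S" "cycle_extension p K T c0 i" "S = T \<union> cycle_extension.cyc p c0 i"
    "{x \<in> T. p x = x} = {x \<in> S. p x = x}" "card S = card T + i"
proof -
  have fS: "(p ^^ e) c0 \<in> S" for e using c0(1) inv by (induction e) auto
  have "finite {y. \<exists>n. y = (p ^^ n) c0}" by (rule finite_subset[OF _ fin]) (use fS in auto)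
  then obtain n where n: "n > 0" "(p ^^ n) c0 = c0" using funpow_inj_finite[OF inj] by blast
  define i where "i = (LEAST n. n > 0 \<and> (p ^^ n) c0 = c0)"
  have i: "i > 0" "(p ^^ i) c0 = c0"
    using LeastI[of "\<lambda>n. n > 0 \<and> (p ^^ n) c0 = c0" n] n unfolding i_def by auto
  have least: "\<not> (p ^^ k) c0 = c0" if "0 < k" "k < i" for k
    using not_less_Least[of k "\<lambda>n. n > 0 \<and> (p ^^ n) c0 = c0"] that unfolding i_def by auto
  have i2: "2 \<le> i"
  proof -
    have "i \<noteq> 1" using i(2) c0(2) by auto
    then show ?thesis using i(1) by simp
  qed
  have ne: "(p ^^ e) c0 \<noteq> (p ^^ f) c0" if "e < f" "f < i" for e f
  proof
    assume "(p ^^ e) c0 = (p ^^ f) c0"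
    then have "(p ^^ e) c0 = (p ^^ e) ((p ^^ (f - e)) c0)"
      using that funpow_add[of e "f - e" p] by simp
    then have "c0 = (p ^^ (f - e)) c0" using inj_fn[OF inj, of e] by (simp add: inj_eq)
    moreover have "0 < f - e" "f - e < i" using that by auto
    ultimately show False using least[of "f - e"] by simp
  qed
  have distinct: "inj_on (\<lambda>e. (p ^^ e) c0) {..<i}"
    by (rule linorder_inj_onI) (use ne in auto)
  define Orb where "Orb = (\<lambda>e. (p ^^ e) c0) ` {..<i}"
  define T where "T = S - Orb"
  have OS: "Orb \<subseteq> S" using fS by (auto simp: Orb_def)
  have inO: "(p ^^ e) c0 \<in> Orb" for e
    unfolding Orb_def using i by (subst funpow_mod_eq[OF i(2), symmetric]) auto
  have invT: "p ` T \<subseteq> T"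
  proof (rule image_subsetI)
    fix x assume x: "x \<in> T"
    have "p x \<notin> Orb"
    proof
      assume "p x \<in> Orb"
      then obtain e where "p x = (p ^^ e) c0" by (auto simp: Orb_def)
      also have "\<dots> = (p ^^ (e + i)) c0" using i(2) by (simp add: funpow_add)
      also have "\<dots> = p ((p ^^ (e + i - 1)) c0)" using i(1) by (cases i) auto
      finally have "x = (p ^^ (e + i - 1)) c0" using inj by (simp add: inj_eq)
      then show False using inO x by (auto simp: T_def)
    qed
    then show "p x \<in> T" using x inv by (auto simp: T_def)
  qed
  have ce: "cycle_extension p K T c0 i"
  proof
    show "c0 \<notin> T" using inO[of 0] by (simp add: T_def)
    show "finite T" using fin by (simp add: T_def)
  qed (use inj invT K i distinct in auto)
  interpret ce: cycle_extension p K T c0 i by (rule ce)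
  have Orb: "ce.cyc = Orb" by (simp add: ce.cyc_def Orb_def)
  have nofix: "p x \<noteq> x" if x: "x \<in> Orb" for x
  proof
    assume "p x = x"
    obtain e where e: "x = (p ^^ e) c0" using x by (auto simp: Orb_def)
    have "(p ^^ e) (p c0) = (p ^^ e) c0" using \<open>p x = x\<close> unfolding e by (simp add: funpow_swap1)
    then show False using inj_fn[OF inj, of e] c0(2) by (simp add: inj_eq)
  qed
  show ?thesis
  proof (rule that[OF i2 _ ce])
    show "T \<subseteq> S" by (auto simp: T_def)
    show "S = T \<union> ce.cyc" using OS by (auto simp: T_def Orb)
    show "{x \<in> T. p x = x} = {x \<in> S. p x = x}" using nofix by (auto simp: T_def)
    have "card Orb = i" using ce.card_cyc by (simp add: Orb)
    then show "card S = card T + i"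
      using OS fin card_mono[OF fin OS] by (simp add: T_def card_Diff_subset finite_subset)
  qed
qed

text \<open>\<open>\<delta>\<close> is the relative error of one cycle per point of the cycle: for
  \<open>i \<ge> 2\<close>, \<open>2 * n \<le> 2 * n / K ^ 2 * K ^ i\<close> and
  \<open>K ^ (i div 2) \<le> K ^ i / K\<close>. The lengths of the removed cycles add up to at most
  \<open>card S\<close>, so the factors \<open>1 + i * \<delta>\<close> and
  \<open>1 - i * \<delta>\<close> combine to bounds free of the cycle type, the former by
  Bernoulli's inequality.\<close>

lemma card_configs_fixed_points:
  assumes inj: "inj p" and K: "K \<ge> 1" and \<delta>: "\<delta> = 2 * real n / (real K)\<^sup>2 + 1 / real K"
    and "finite S" "p ` S \<subseteq> S" "card S \<le> n"
  defines "g \<equiv> \<lambda>T. real (card (configs p K T)) / real K ^ card T"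
  shows "g S \<le> (1 + \<delta>) ^ (card S) * g {x \<in> S. p x = x}"
    "(1 - real (card S) * \<delta>) * g {x \<in> S. p x = x} \<le> g S"
proof -
  have \<delta>0: "\<delta> \<ge> 0" unfolding \<delta> by simp
  have g0: "g T \<ge> 0" for T by (simp add: g_def)
  have "g S \<le> (1 + \<delta>) ^ (card S) * g {x \<in> S. p x = x} \<and> (1 - real (card S) * \<delta>) * g {x \<in> S. p x = x} \<le> g S"
    using assms(4-6)
  proof (induction "card S" arbitrary: S rule: less_induct)
    case less
    show ?case
    proof (cases "\<forall>x\<in>S. p x = x")
      case True
      then have F: "{x \<in> S. p x = x} = S" by auto
      have "1 * g S \<le> (1 + \<delta>) ^ card S * g S" using \<delta>0 g0 by (intro mult_right_mono) auto
      moreover have "(1 - real (card S) * \<delta>) * g S \<le> 1 * g S" using \<delta>0 g0 by (intro mult_right_mono) auto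
      ultimately show ?thesis unfolding F by simp
    next
      case False
      then obtain c0 where c0: "c0 \<in> S" "p c0 \<noteq> c0" by blast
      obtain i T where i: "2 \<le> i" and TS: "T \<subseteq> S" and ce: "cycle_extension p K T c0 i"
        and S: "S = T \<union> cycle_extension.cyc p c0 i" and F: "{x \<in> T. p x = x} = {x \<in> S. p x = x}"
        and card: "card S = card T + i"
        using orbit_decomposition[OF inj less.prems(1,2) K c0] by blast
      interpret ce: cycle_extension p K T c0 i by (rule ce)
      let ?F = "g {x \<in> S. p x = x}"
      have IH: "g T \<le> (1 + \<delta>) ^ card T * ?F" "(1 - real (card T) * \<delta>) * ?F \<le> g T"
        using less.hyps[of T] card i ce.fin ce.invS less.prems(3) unfolding F by auto
      have Kp: "real K > 0" using K by simp
      have Ki: "real K ^ i > 0" using Kp by simp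
      have err: "2 * real (card T) + real i * real K ^ (i div 2) \<le> real i * \<delta> * real K ^ i"
      proof -
        have "(real K)\<^sup>2 \<le> real K ^ i" using K i by (intro power_increasing) auto
        then have "2 * real n / (real K)\<^sup>2 * (real K)\<^sup>2 \<le> 2 * real n / (real K)\<^sup>2 * real K ^ i"
          by (intro mult_left_mono) auto
        then have "2 * real n \<le> 2 * real n / (real K)\<^sup>2 * real K ^ i" using Kp by simp
        also have "\<dots> \<le> real i * (2 * real n / (real K)\<^sup>2 * real K ^ i)"
          using i mult_right_mono[of 1 "real i" "2 * real n / (real K)\<^sup>2 * real K ^ i"] by simp
        finally have 1: "2 * real (card T) \<le> real i * (2 * real n / (real K)\<^sup>2) * real K ^ i"
          using less.prems(3) card by (simp add: mult.assoc)
        have "real K ^ (i div 2) * real K \<le> real K ^ i"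
        proof -
          have "real K ^ (i div 2 + 1) \<le> real K ^ i" using K i by (intro power_increasing) auto
          then show ?thesis by (simp add: mult.commute)
        qed
        then have "real K ^ (i div 2) \<le> 1 / real K * real K ^ i" using Kp by (simp add: field_simps)
        then have 2: "real i * real K ^ (i div 2) \<le> real i * (1 / real K * real K ^ i)"
          by (intro mult_left_mono) auto
        show ?thesis using 1 2 unfolding \<delta> by (simp add: algebra_simps)
      qed
      let ?C = "real (card (configs p K T))" and ?D = "real (card (configs p K S))"
      have "?D \<le> ?C * (real K ^ i + 2 * real (card T) + real i * real K ^ (i div 2))"
        using of_nat_mono[where 'a = real, OF ce.card_configs_bounds(1)] unfolding S[symmetric] by simp
      also have "\<dots> \<le> ?C * (real K ^ i + real i * \<delta> * real K ^ i)"
        using err by (intro mult_left_mono) auto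
      finally have up: "?D \<le> ?C * real K ^ i * (1 + real i * \<delta>)" by (simp add: algebra_simps)
      have "?C * real K ^ i \<le> ?D + ?C * (real (card T) + real i * real K ^ (i div 2))"
        using of_nat_mono[where 'a = real, OF ce.card_configs_bounds(2)] unfolding S[symmetric] by simp
      moreover have "?C * (real (card T) + real i * real K ^ (i div 2)) \<le> ?C * (real i * \<delta> * real K ^ i)"
        using err by (intro mult_left_mono) auto
      ultimately have lo: "?C * real K ^ i * (1 - real i * \<delta>) \<le> ?D" by (simp add: algebra_simps)
      have gT: "g T * real K ^ card S = ?C * real K ^ i" using Kp by (simp add: g_def card power_add)
      have gS: "g S * real K ^ card S = ?D" using Kp by (simp add: g_def)
      have Kc: "real K ^ card S > 0" using Kp by simp
      have "g S * real K ^ card S \<le> (g T * (1 + real i * \<delta>)) * real K ^ card S"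
        using up unfolding gS gT[symmetric] by (simp add: mult_ac)
      then have up': "g S \<le> g T * (1 + real i * \<delta>)" using Kc by simp
      have "(g T * (1 - real i * \<delta>)) * real K ^ card S \<le> g S * real K ^ card S"
        using lo unfolding gS gT[symmetric] by (simp add: mult_ac)
      then have lo': "g T * (1 - real i * \<delta>) \<le> g S" using Kc by simp
      have "1 + real i * \<delta> \<le> (1 + \<delta>) ^ i" using \<delta>0 Bernoulli_inequality[of \<delta> i] by simp
      then have "g S \<le> ((1 + \<delta>) ^ card T * ?F) * (1 + \<delta>) ^ i"
        using up' IH(1) g0 \<delta>0 by (intro order_trans[OF up'] mult_mono) auto
      then have 1: "g S \<le> (1 + \<delta>) ^ card S * ?F" by (simp add: card power_add mult_ac)
      have 2: "(1 - real (card S) * \<delta>) * ?F \<le> g S"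
      \<comment> \<open>Multiplying lower bounds needs a nonnegative factor. Otherwise the claimed
        bound is itself not positive and holds trivially.\<close>
      proof (cases "real i * \<delta> \<le> 1")
        case True
        have "(1 - real (card S) * \<delta>) * ?F \<le> ((1 - real (card T) * \<delta>) * (1 - real i * \<delta>)) * ?F"
          using g0 \<delta>0 by (intro mult_right_mono) (simp_all add: card algebra_simps)
        also have "\<dots> = ((1 - real (card T) * \<delta>) * ?F) * (1 - real i * \<delta>)" by simp
        also have "\<dots> \<le> g T * (1 - real i * \<delta>)" using IH(2) True by (intro mult_right_mono) auto
        also have "\<dots> \<le> g S" by (rule lo')
        finally show ?thesis .
      next
        case False
        have "real i * \<delta> \<le> real (card S) * \<delta>" using \<delta>0 card by (intro mult_right_mono) auto
        then have "(1 - real (card S) * \<delta>) * ?F \<le> 0" using False g0 by (intro mult_nonpos_nonneg) auto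
        then show ?thesis using g0[of S] by linarith
      qed
      show ?thesis using 1 2 by blast
    qed
  qed
  then show "g S \<le> (1 + \<delta>) ^ (card S) * g {x \<in> S. p x = x}"
    "(1 - real (card S) * \<delta>) * g {x \<in> S. p x = x} \<le> g S" by auto
qed

section \<open>From configurations to conjugacy classes\<close>

lemma strict_lin_rank:
  assumes fin: "finite S" and lin: "strict_lin S r"
  obtains \<rho> where "bij_betw \<rho> S {1..card S}" "\<And>x y. x \<in> S \<Longrightarrow> y \<in> S \<Longrightarrow> (x, y) \<in> r \<longleftrightarrow> \<rho> x < (\<rho> y :: nat)"
proof -
  note sl = strict_linD[OF lin]
  define D where "D = (\<lambda>x. {y \<in> S. (y, x) \<in> r})"
  define \<rho> where "\<rho> = (\<lambda>x. Suc (card (D x)))"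
  have finD: "finite (D x)" for x using fin by (simp add: D_def)
  have mono: "\<rho> x < \<rho> y" if "(x, y) \<in> r" for x y
  proof -
    have "D x \<subset> D y"
    proof (rule psubsetI)
      show "D x \<subseteq> D y" unfolding D_def using sl(3)[OF _ that] by blast
      have "x \<in> D y" "x \<notin> D x" using that sl(5)[OF that] sl(1) by (auto simp: D_def)
      then show "D x \<noteq> D y" by blast
    qed
    then show ?thesis unfolding \<rho>_def using psubset_card_mono[OF finD] by simp
  qed
  have iff: "(x, y) \<in> r \<longleftrightarrow> \<rho> x < \<rho> y" if "x \<in> S" "y \<in> S" for x y
  proof
    assume "\<rho> x < \<rho> y"
    then have "x \<noteq> y" "(y, x) \<notin> r" using mono[of y x] by auto
    then show "(x, y) \<in> r" using sl(4)[OF that] by blast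
  qed (rule mono)
  have "inj_on \<rho> S"
  proof (rule inj_onI)
    fix x y assume "x \<in> S" "y \<in> S" "\<rho> x = \<rho> y"
    then show "x = y" using sl(4)[of x y] mono[of x y] mono[of y x] by (metis less_irrefl)
  qed
  moreover have "\<rho> ` S \<subseteq> {1..card S}"
  proof (rule image_subsetI)
    fix x assume x: "x \<in> S"
    have "D x \<subset> S" using x sl(1) by (auto simp: D_def)
    then have "card (D x) < card S" by (rule psubset_card_mono[OF fin])
    then show "\<rho> x \<in> {1..card S}" by (simp add: \<rho>_def)
  qed
  ultimately have "bij_betw \<rho> S {1..card S}"
    unfolding bij_betw_def by (metis card_image card_subset_eq finite_atLeastAtMost card_atLeastAtMost diff_Suc_1)
  then show ?thesis using iff that by blast
qed

text \<open>Monotonicity makes all letters between two equal ones equal, and constancy of the letter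
  makes \<open>\<pi>\<close> monotone there. This passes from neighbouring positions to arbitrary
  pairs, the form used in \<open>configs\<close>.\<close>

lemma enriched_between:
  assumes s: "s \<in> enriched m \<pi> K" and inj: "inj_on \<pi> {1..m}" and ij: "1 \<le> i" "i < j" "j \<le> m"
  shows "s i < s j \<or> s i = s j \<and> (if odd (s i) then \<pi> i < \<pi> j else \<pi> j < \<pi> i)"
proof (cases "s i < s j")
  case False
  have le: "s a \<le> s b" if "1 \<le> a" "a \<le> b" "b \<le> m" for a b by (rule enriched_mono_idx[OF s that])
  have eq: "s i = s j" using False le[of i j] ij by simp
  have const: "s k = s i" if "i \<le> k" "k \<le> j" for k using le[of i k] le[of k j] that ij eq by simp
  have step: "if odd (s i) then \<pi> k < \<pi> (Suc k) else \<pi> (Suc k) < \<pi> k" if k: "i \<le> k" "k < j" for k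
  proof -
    have "k \<in> {1..<m}" using k ij by auto
    then have "s k < s (Suc k) \<or> s k = s (Suc k) \<and> (odd (s k) \<longleftrightarrow> \<pi> k < \<pi> (Suc k))"
      using s unfolding enriched_def by blast
    then have o: "odd (s i) \<longleftrightarrow> \<pi> k < \<pi> (Suc k)" using const[of k] const[of "Suc k"] k by simp
    have "\<pi> k \<noteq> \<pi> (Suc k)" using inj_onD[OF inj, of k "Suc k"] k ij by auto
    then show ?thesis using o by auto
  qed
  have "if odd (s i) then \<pi> i < \<pi> j else \<pi> j < \<pi> i"
  proof -
    have "if odd (s i) then \<pi> i < \<pi> (i + Suc d) else \<pi> (i + Suc d) < \<pi> i" if "i + Suc d \<le> j" for d
      using that
    proof (induction d)
      case 0
      then show ?case using step[of i] by simp
    next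
      case (Suc d)
      then show ?case using step[of "i + Suc d"] by (auto split: if_splits)
    qed
    moreover have "i + Suc (j - i - 1) = j" using ij by simp
    ultimately show ?thesis by (metis order_refl)
  qed
  then show ?thesis using eq by blast
qed simp

text \<open>\<open>\<beta>\<close> is an arbitrary numbering of the points. A pair of a relabelling
  \<open>\<tau>\<close> and a word \<open>s\<close> corresponds to the configuration in which
  \<open>x\<close> has rank \<open>\<tau> (\<beta> x)\<close> and label
  \<open>s (\<tau> (\<beta> x))\<close>. In terms of ranks \<open>p\<close> acts as the conjugate
  \<open>P \<tau>\<close>, so the two compatibility conditions coincide.\<close>

lemma card_configs_eq_sum_enriched:
  fixes p :: "'a \<Rightarrow> 'a"
  assumes fin: "finite S" and bij: "bij_betw \<beta> S {1..m}" and inv: "p ` S \<subseteq> S" and injp: "inj_on p S"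
  shows "card (configs p K S) = (\<Sum>\<tau> | \<tau> permutes {1..m}.
     card (enriched m (\<lambda>i. \<tau> (\<beta> (p (inv_into S \<beta> (inv \<tau> i))))) K))"
proof -
  define P where "P = (\<lambda>\<tau> i. \<tau> (\<beta> (p (inv_into S \<beta> (inv \<tau> i)))) :: nat)"
  define T where "T = (SIGMA \<tau>:{\<tau>. \<tau> permutes {1..m}}. enriched m (P \<tau>) K)"
  define f where "f = (\<lambda>(\<tau> :: nat \<Rightarrow> nat, s :: nat \<Rightarrow> nat). (\<lambda>x\<in>S. s (\<tau> (\<beta> x)), {(x, y). x \<in> S \<and> y \<in> S \<and> \<tau> (\<beta> x) < \<tau> (\<beta> y)}))"
  have m: "card S = m" using bij_betw_same_card[OF bij] by simp
  have bij': "bij_betw (\<lambda>x. \<tau> (\<beta> x)) S {1..m}" if "\<tau> permutes {1..m}" for \<tau>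
    using bij_betw_trans[OF bij permutes_imp_bij[OF that]] by (simp add: o_def)
  have conj_val: "P \<tau> (\<tau> (\<beta> x)) = \<tau> (\<beta> (p x))" if "\<tau> permutes {1..m}" "x \<in> S" for \<tau> x
    using that bij_betw_inv_into_left[OF bij] by (simp add: P_def permutes_inverses)
  have preim: "\<exists>x\<in>S. \<tau> (\<beta> x) = i" if "\<tau> permutes {1..m}" "i \<in> {1..m}" for \<tau> i
    using bij_betw_imp_surj_on[OF bij'[OF that(1)]] that(2) by (metis imageE)
  have injP: "inj_on (P \<tau>) {1..m}" if t: "\<tau> permutes {1..m}" for \<tau>
  proof (rule inj_onI)
    fix i j assume ij: "i \<in> {1..m}" "j \<in> {1..m}" "P \<tau> i = P \<tau> j"
    obtain x y where x: "x \<in> S" "\<tau> (\<beta> x) = i" and y: "y \<in> S" "\<tau> (\<beta> y) = j"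
      using preim[OF t ij(1)] preim[OF t ij(2)] by blast
    have "\<tau> (\<beta> (p x)) = \<tau> (\<beta> (p y))" using ij(3) conj_val[OF t x(1)] conj_val[OF t y(1)] x y by simp
    moreover have "p x \<in> S" "p y \<in> S" using inv x y by auto
    ultimately have "p x = p y" using inj_onD[OF bij_betw_imp_inj_on[OF bij'[OF t]]] by blast
    then have "x = y" using inj_onD[OF injp] x y by blast
    then show "i = j" using x y by simp
  qed
  have "bij_betw f T (configs p K S)"
    unfolding bij_betw_def
  proof (intro conjI equalityI)
    show "inj_on f T"
    proof (rule inj_onI)
      fix a b assume a: "a \<in> T" and b: "b \<in> T" and fab: "f a = f b"
      obtain \<tau> s where as: "a = (\<tau>, s)" by (cases a)
      obtain \<tau>' s' where bs: "b = (\<tau>', s')" by (cases b)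
      have t: "\<tau> permutes {1..m}" "\<tau>' permutes {1..m}" and s: "s \<in> enriched m (P \<tau>) K" "s' \<in> enriched m (P \<tau>') K"
        using a b by (auto simp: T_def as bs)
      have L: "(\<lambda>x\<in>S. s (\<tau> (\<beta> x))) = (\<lambda>x\<in>S. s' (\<tau>' (\<beta> x)))"
        and R: "{(x, y). x \<in> S \<and> y \<in> S \<and> \<tau> (\<beta> x) < \<tau> (\<beta> y)} = {(x, y). x \<in> S \<and> y \<in> S \<and> \<tau>' (\<beta> x) < \<tau>' (\<beta> y)}"
        using fab by (auto simp: f_def as bs)
      \<comment> \<open>The order determines the relabelling: the rank of \<open>x\<close> is one
        more than the number of points below it.\<close>
      have rank: "\<tau> (\<beta> x) = Suc (card {y \<in> S. \<tau> (\<beta> y) < \<tau> (\<beta> x)})" if t: "\<tau> permutes {1..m}" and x: "x \<in> S" for \<tau> x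
      proof -
        let ?g = "\<lambda>x. \<tau> (\<beta> x)"
        have g: "?g ` S = {1..m}" "inj_on ?g S" using bij'[OF t] by (auto simp: bij_betw_def)
        have gx: "?g x \<in> {1..m}" using g(1) x by blast
        have "?g ` {y \<in> S. ?g y < ?g x} = {1..<?g x}"
        proof (intro equalityI subsetI)
          fix i assume "i \<in> {1..<?g x}"
          then have "i \<in> ?g ` S" unfolding g(1) using gx by auto
          then show "i \<in> ?g ` {y \<in> S. ?g y < ?g x}" using \<open>i \<in> {1..<?g x}\<close> by auto
        qed (use g(1) in \<open>fastforce simp: image_def\<close>)
        then have "card {1..<?g x} = card {y \<in> S. ?g y < ?g x}"
          using card_image[of ?g "{y \<in> S. ?g y < ?g x}"] inj_on_subset[OF g(2)] by (metis (no_types, lifting) mem_Collect_eq subsetI)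
        then have "?g x - 1 = card {y \<in> S. ?g y < ?g x}" by simp
        then show ?thesis using gx by (metis Suc_pred' atLeastAtMost_iff less_eq_Suc_le One_nat_def)
      qed
      have tb: "\<tau> (\<beta> x) = \<tau>' (\<beta> x)" if "x \<in> S" for x
      proof -
        have "{y \<in> S. \<tau> (\<beta> y) < \<tau> (\<beta> x)} = {y \<in> S. \<tau>' (\<beta> y) < \<tau>' (\<beta> x)}"
          using R that by (auto simp: set_eq_iff)
        then show ?thesis using rank[OF t(1) that] rank[OF t(2) that] by simp
      qed
      have tt: "\<tau> = \<tau>'"
      proof
        fix i show "\<tau> i = \<tau>' i"
        proof (cases "i \<in> {1..m}")
          case True
          then obtain x where "x \<in> S" "i = \<beta> x" using bij_betw_imp_surj_on[OF bij] by (metis imageE)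
          then show ?thesis using tb by simp
        next
          case False
          then show ?thesis using permutes_not_in t by metis
        qed
      qed
      have "s = s'"
      proof (rule PiE_ext)
        show "s \<in> {1..m} \<rightarrow>\<^sub>E {..<K}" "s' \<in> {1..m} \<rightarrow>\<^sub>E {..<K}" using s by (auto simp: enriched_def)
        fix i assume "i \<in> {1..m}"
        then obtain x where x: "x \<in> S" "\<tau> (\<beta> x) = i" using preim[OF t(1)] by blast
        show "s i = s' i" using fun_cong[OF L, of x] x tb[OF x(1)] by simp
      qed
      then show "a = b" using tt by (simp add: as bs)
    qed
    show "f ` T \<subseteq> configs p K S"
    proof (rule image_subsetI)
      fix a assume a: "a \<in> T"
      obtain \<tau> s where as: "a = (\<tau>, s)" by (cases a)
      have t: "\<tau> permutes {1..m}" and s: "s \<in> enriched m (P \<tau>) K" using a by (auto simp: T_def as)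
      let ?g = "\<lambda>x. \<tau> (\<beta> x)"
      define r where "r = {(x, y). x \<in> S \<and> y \<in> S \<and> ?g x < ?g y}"
      define L where "L = (\<lambda>x\<in>S. s (?g x))"
      have gm: "?g x \<in> {1..m}" if "x \<in> S" for x using bij_betw_apply[OF bij'[OF t] that] .
      have sE: "s \<in> {1..m} \<rightarrow>\<^sub>E {..<K}" using s by (simp add: enriched_def)
      have LE: "L \<in> S \<rightarrow>\<^sub>E {..<K}" unfolding L_def using PiE_mem[OF sE gm] by simp
      have lin: "strict_lin S r" unfolding strict_lin_def
      proof (intro conjI ballI impI)
        fix x y assume "x \<in> S" "y \<in> S" "x \<noteq> y"
        then have "?g x \<noteq> ?g y" using inj_onD[OF bij_betw_imp_inj_on[OF bij'[OF t]]] by blast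
        then show "(x, y) \<in> r \<or> (y, x) \<in> r" using \<open>x \<in> S\<close> \<open>y \<in> S\<close> by (auto simp: r_def)
      qed (auto simp: r_def irrefl_def intro!: transI)
      have rel: "L x < L y \<or> L x = L y \<and> (if odd (L x) then (p x, p y) \<in> r else (p y, p x) \<in> r)"
        if "(x, y) \<in> r" for x y
      proof -
        have xy: "x \<in> S" "y \<in> S" "?g x < ?g y" using that by (auto simp: r_def)
        have pxy: "p x \<in> S" "p y \<in> S" using inv xy by auto
        have "s (?g x) < s (?g y) \<or> s (?g x) = s (?g y) \<and> (if odd (s (?g x)) then P \<tau> (?g x) < P \<tau> (?g y) else P \<tau> (?g y) < P \<tau> (?g x))"
          using gm[OF xy(1)] gm[OF xy(2)] xy(3) by (intro enriched_between[OF s injP[OF t]]) auto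
        then show ?thesis unfolding conj_val[OF t xy(1)] conj_val[OF t xy(2)] using xy pxy by (auto simp: L_def r_def)
      qed
      have "(L, r) \<in> configs p K S" unfolding configs_def using LE lin rel by blast
      then show "f a \<in> configs p K S" by (simp add: f_def as L_def r_def)
    qed
    show "configs p K S \<subseteq> f ` T"
    proof
      fix b assume b: "b \<in> configs p K S"
      obtain L r where bs: "b = (L, r)" by (cases b)
      have c: "(L, r) \<in> configs p K S" using b bs by simp
      have LE: "L \<in> S \<rightarrow>\<^sub>E {..<K}" using c by (simp add: configs_def)
      obtain \<rho> where \<rho>: "bij_betw \<rho> S {1..card S}" "\<And>x y. x \<in> S \<Longrightarrow> y \<in> S \<Longrightarrow> (x, y) \<in> r \<longleftrightarrow> \<rho> x < (\<rho> y :: nat)"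
        using strict_lin_rank[OF fin configs_strict_lin[OF c]] by blast
      define \<tau> where "\<tau> = (\<lambda>i. if i \<in> {1..m} then \<rho> (inv_into S \<beta> i) else i)"
      have t: "\<tau> permutes {1..m}"
      proof (rule bij_imp_permutes)
        have "bij_betw (\<rho> \<circ> inv_into S \<beta>) {1..m} {1..m}"
          using bij_betw_trans[OF bij_betw_inv_into[OF bij] \<rho>(1)] m by simp
        moreover have "bij_betw (\<rho> \<circ> inv_into S \<beta>) {1..m} {1..m} \<longleftrightarrow> bij_betw \<tau> {1..m} {1..m}"
          by (rule bij_betw_cong) (simp add: \<tau>_def)
        ultimately show "bij_betw \<tau> {1..m} {1..m}" by simp
      qed (auto simp: \<tau>_def)
      have tb: "\<tau> (\<beta> x) = \<rho> x" if "x \<in> S" for x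
        using bij_betw_apply[OF bij that] bij_betw_inv_into_left[OF bij that] by (simp add: \<tau>_def)
      define s where "s = (\<lambda>i\<in>{1..m}. L (inv_into S \<rho> i))"
      have sg: "s (\<rho> x) = L x" if "x \<in> S" for x
        using bij_betw_apply[OF \<rho>(1) that] bij_betw_inv_into_left[OF \<rho>(1) that] m by (simp add: s_def)
      have pre: "\<exists>x\<in>S. \<rho> x = i" if "i \<in> {1..m}" for i
        using bij_betw_imp_surj_on[OF \<rho>(1)] that m by (metis imageE)
      have "s \<in> enriched m (P \<tau>) K"
        unfolding enriched_def
      proof (intro CollectI conjI ballI)
        show "s \<in> {1..m} \<rightarrow>\<^sub>E {..<K}"
        proof (rule PiE_I)
          fix i assume "i \<in> {1..m}"
          then obtain x where "x \<in> S" "\<rho> x = i" using pre by blast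
          then show "s i \<in> {..<K}" using sg[of x] PiE_mem[OF LE, of x] by simp
        qed (auto simp: s_def)
        fix i assume i: "i \<in> {1..<m}"
        obtain x where x: "x \<in> S" "\<rho> x = i" using pre[of i] i by auto
        obtain y where y: "y \<in> S" "\<rho> y = Suc i" using pre[of "Suc i"] i by auto
        have xy: "(x, y) \<in> r" using \<rho>(2)[OF x(1) y(1)] x y by simp
        have pxy: "p x \<in> S" "p y \<in> S" using inv x y by auto
        have Pi: "P \<tau> i = \<rho> (p x)" "P \<tau> (Suc i) = \<rho> (p y)"
          using conj_val[OF t x(1)] conj_val[OF t y(1)] tb[OF x(1)] tb[OF y(1)] tb[OF pxy(1)] tb[OF pxy(2)] x y by simp_all
        have si: "s i = L x" "s (Suc i) = L y" using sg[OF x(1)] sg[OF y(1)] x y by simp_all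
        show "s i < s (Suc i) \<or> s i = s (Suc i) \<and> (odd (s i) \<longleftrightarrow> P \<tau> i < P \<tau> (Suc i))"
          using configs_rel[OF c xy] \<rho>(2)[OF pxy] \<rho>(2)[OF pxy(2,1)] unfolding Pi si by (auto split: if_splits)
      qed
      then have "(\<tau>, s) \<in> T" using t by (simp add: T_def)
      moreover have "b = f (\<tau>, s)"
      proof -
        have "L = (\<lambda>x\<in>S. s (\<tau> (\<beta> x)))"
        proof
          fix x show "L x = (\<lambda>x\<in>S. s (\<tau> (\<beta> x))) x"
            using sg[of x] tb[of x] LE by (cases "x \<in> S") (auto simp: PiE_def extensional_def)
        qed
        moreover have "r = {(x, y). x \<in> S \<and> y \<in> S \<and> \<tau> (\<beta> x) < \<tau> (\<beta> y)}"
        proof (intro equalityI subrelI)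
          fix x y assume xy: "(x, y) \<in> r"
          then have S: "x \<in> S" "y \<in> S" using strict_linD(5)[OF configs_strict_lin[OF c] xy] by auto
          show "(x, y) \<in> {(x, y). x \<in> S \<and> y \<in> S \<and> \<tau> (\<beta> x) < \<tau> (\<beta> y)}"
            using S xy \<rho>(2)[OF S] tb[OF S(1)] tb[OF S(2)] by simp
        next
          fix x y assume "(x, y) \<in> {(x, y). x \<in> S \<and> y \<in> S \<and> \<tau> (\<beta> x) < \<tau> (\<beta> y)}"
          then have S: "x \<in> S" "y \<in> S" "\<tau> (\<beta> x) < \<tau> (\<beta> y)" by auto
          show "(x, y) \<in> r" using S(3) \<rho>(2)[OF S(1,2)] tb[OF S(1)] tb[OF S(2)] by simp
        qed
        ultimately show ?thesis by (simp add: f_def bs)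
      qed
      ultimately show "b \<in> f ` T" by blast
    qed
  qed
  then have "card (configs p K S) = card T" by (simp add: bij_betw_same_card)
  also have "\<dots> = (\<Sum>\<tau> | \<tau> permutes {1..m}. card (enriched m (P \<tau>) K))"
    unfolding T_def by (rule card_SigmaI) (auto simp: finite_permutations)
  finally show ?thesis by (simp add: P_def)
qed

lemma enriched_cong:
  assumes "\<And>i. i \<in> {1..n} \<Longrightarrow> \<pi> i = \<pi>' i"
  shows "enriched n \<pi> K = enriched n \<pi>' K"
proof -
  have "\<pi> i = \<pi>' i \<and> \<pi> (Suc i) = \<pi>' (Suc i)" if "i \<in> {1..<n}" for i using that assms by auto
  then show ?thesis unfolding enriched_def by auto
qed

text \<open>The fibres of \<open>\<sigma> \<mapsto> \<sigma> \<circ> p \<circ> inv \<sigma>\<close>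
  are cosets of the centraliser of \<open>p\<close>, all of the same size \<open>k\<close>. The case
  of a constant \<open>h\<close> identifies \<open>card C * k\<close> as \<open>n!\<close>.\<close>

lemma sum_conjugates:
  fixes h :: "(nat \<Rightarrow> nat) \<Rightarrow> real"
  assumes p: "p permutes {1..n}" and C: "C = {\<sigma> \<circ> p \<circ> inv \<sigma> | \<sigma>. \<sigma> permutes {1..n}}"
  shows "finite C" "C \<noteq> {}" "real (card C) * (\<Sum>\<sigma> | \<sigma> permutes {1..n}. h (\<sigma> \<circ> p \<circ> inv \<sigma>)) = fact n * sum h C"
proof -
  let ?P = "{\<sigma>. \<sigma> permutes {1..n}}" and ?g = "\<lambda>\<sigma>. \<sigma> \<circ> p \<circ> inv \<sigma>"
  have finP: "finite ?P" by (simp add: finite_permutations)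
  have C': "C = ?g ` ?P" unfolding C by blast
  show finC: "finite C" unfolding C' using finP by simp
  show "C \<noteq> {}" unfolding C' using p by blast
  define k where "k = card {\<sigma> \<in> ?P. ?g \<sigma> = p}"
  have fiber: "card {\<sigma> \<in> ?P. ?g \<sigma> = \<pi>} = k" if pi: "\<pi> \<in> C" for \<pi>
  proof -
    obtain \<sigma>0 where s0: "\<sigma>0 permutes {1..n}" "\<pi> = ?g \<sigma>0" using pi unfolding C by blast
    have "bij_betw (\<lambda>\<sigma>. \<sigma>0 \<circ> \<sigma>) {\<sigma> \<in> ?P. ?g \<sigma> = p} {\<sigma> \<in> ?P. ?g \<sigma> = \<pi>}"
    proof (rule bij_betw_byWitness[where f' = "\<lambda>\<sigma>. inv \<sigma>0 \<circ> \<sigma>"])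
      show "\<forall>a\<in>{\<sigma> \<in> ?P. ?g \<sigma> = p}. inv \<sigma>0 \<circ> (\<sigma>0 \<circ> a) = a"
        using permutes_inv_o(2)[OF s0(1)] by (simp add: o_assoc)
      show "\<forall>a\<in>{\<sigma> \<in> ?P. ?g \<sigma> = \<pi>}. \<sigma>0 \<circ> (inv \<sigma>0 \<circ> a) = a"
        using permutes_inv_o(1)[OF s0(1)] by (simp add: o_assoc)
      show "(\<lambda>\<sigma>. \<sigma>0 \<circ> \<sigma>) ` {\<sigma> \<in> ?P. ?g \<sigma> = p} \<subseteq> {\<sigma> \<in> ?P. ?g \<sigma> = \<pi>}"
      proof (rule image_subsetI)
        fix \<sigma> assume "\<sigma> \<in> {\<sigma> \<in> ?P. ?g \<sigma> = p}"
        then have s: "\<sigma> permutes {1..n}" "?g \<sigma> = p" by auto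
        have "?g (\<sigma>0 \<circ> \<sigma>) = \<sigma>0 \<circ> ?g \<sigma> \<circ> inv \<sigma>0"
          using o_inv_distrib[OF permutes_bij[OF s0(1)] permutes_bij[OF s(1)]] by (simp add: o_assoc)
        then show "\<sigma>0 \<circ> \<sigma> \<in> {\<sigma> \<in> ?P. ?g \<sigma> = \<pi>}"
          using s s0 permutes_compose[OF s(1) s0(1)] by simp
      qed
      show "(\<lambda>\<sigma>. inv \<sigma>0 \<circ> \<sigma>) ` {\<sigma> \<in> ?P. ?g \<sigma> = \<pi>} \<subseteq> {\<sigma> \<in> ?P. ?g \<sigma> = p}"
      proof (rule image_subsetI)
        fix \<sigma> assume "\<sigma> \<in> {\<sigma> \<in> ?P. ?g \<sigma> = \<pi>}"
        then have s: "\<sigma> permutes {1..n}" "?g \<sigma> = \<pi>" by auto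
        have "?g (inv \<sigma>0 \<circ> \<sigma>) = inv \<sigma>0 \<circ> ?g \<sigma> \<circ> \<sigma>0"
          using o_inv_distrib[OF permutes_bij[OF permutes_inv[OF s0(1)]] permutes_bij[OF s(1)]]
            permutes_inv_inv[OF s0(1)] by (simp add: o_assoc)
        also have "\<dots> = (inv \<sigma>0 \<circ> \<sigma>0) \<circ> p \<circ> (inv \<sigma>0 \<circ> \<sigma>0)" using s s0 by (simp add: o_assoc)
        also have "\<dots> = p" using permutes_inv_o(2)[OF s0(1)] by simp
        finally show "inv \<sigma>0 \<circ> \<sigma> \<in> {\<sigma> \<in> ?P. ?g \<sigma> = p}"
          using permutes_compose[OF s(1) permutes_inv[OF s0(1)]] by simp
      qed
    qed
    then show ?thesis unfolding k_def by (simp add: bij_betw_same_card)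
  qed
  have sum: "(\<Sum>\<sigma>\<in>?P. h (?g \<sigma>)) = real k * sum h C" for h :: "(nat \<Rightarrow> nat) \<Rightarrow> real"
  proof -
    have "(\<Sum>\<sigma>\<in>?P. h (?g \<sigma>)) = (\<Sum>\<pi>\<in>C. \<Sum>\<sigma>\<in>{\<sigma> \<in> ?P. ?g \<sigma> = \<pi>}. h (?g \<sigma>))"
      unfolding C' by (rule sum.image_gen[OF finP])
    also have "\<dots> = (\<Sum>\<pi>\<in>C. real k * h \<pi>)"
    proof (rule sum.cong[OF refl])
      fix \<pi> assume "\<pi> \<in> C"
      have "(\<Sum>\<sigma>\<in>{\<sigma> \<in> ?P. ?g \<sigma> = \<pi>}. h (?g \<sigma>)) = (\<Sum>\<sigma>\<in>{\<sigma> \<in> ?P. ?g \<sigma> = \<pi>}. h \<pi>)"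
        by (rule sum.cong) auto
      also have "\<dots> = real k * h \<pi>" using fiber[OF \<open>\<pi> \<in> C\<close>] by (simp only: sum_constant)
      finally show "(\<Sum>\<sigma>\<in>{\<sigma> \<in> ?P. ?g \<sigma> = \<pi>}. h (?g \<sigma>)) = real k * h \<pi>" .
    qed
    finally show ?thesis by (simp add: sum_distrib_left)
  qed
  have "real (card C) * real k = fact n"
    using sum[of "\<lambda>_. 1"] card_permutations[of "{1..n}" n] by (simp add: mult.commute)
  then show "real (card C) * (\<Sum>\<sigma> | \<sigma> permutes {1..n}. h (\<sigma> \<circ> p \<circ> inv \<sigma>)) = fact n * sum h C"
    unfolding sum by (simp add: mult.assoc[symmetric])
qed

lemma fixed_points_conjugate:
  assumes s: "\<sigma> permutes {1..n}"
  shows "fixed_points n (\<sigma> \<circ> p \<circ> inv \<sigma>) = fixed_points n p"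
proof -
  have "bij_betw \<sigma> {i \<in> {1..n}. p i = i} {i \<in> {1..n}. (\<sigma> \<circ> p \<circ> inv \<sigma>) i = i}"
  proof (rule bij_betw_byWitness[where f' = "inv \<sigma>"])
    show "\<forall>a\<in>{i \<in> {1..n}. p i = i}. inv \<sigma> (\<sigma> a) = a" using permutes_inverses(2)[OF s] by simp
    show "\<forall>a\<in>{i \<in> {1..n}. (\<sigma> \<circ> p \<circ> inv \<sigma>) i = i}. \<sigma> (inv \<sigma> a) = a" using permutes_inverses(1)[OF s] by simp
    show "\<sigma> ` {i \<in> {1..n}. p i = i} \<subseteq> {i \<in> {1..n}. (\<sigma> \<circ> p \<circ> inv \<sigma>) i = i}"
    proof (rule image_subsetI)
      fix i assume "i \<in> {i \<in> {1..n}. p i = i}"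
      then show "\<sigma> i \<in> {i \<in> {1..n}. (\<sigma> \<circ> p \<circ> inv \<sigma>) i = i}"
        using permutes_inverses(2)[OF s] permutes_in_image[OF s, of i] by simp
    qed
    show "inv \<sigma> ` {i \<in> {1..n}. (\<sigma> \<circ> p \<circ> inv \<sigma>) i = i} \<subseteq> {i \<in> {1..n}. p i = i}"
    proof (rule image_subsetI)
      fix i assume i: "i \<in> {i \<in> {1..n}. (\<sigma> \<circ> p \<circ> inv \<sigma>) i = i}"
      then have "inv \<sigma> (\<sigma> (p (inv \<sigma> i))) = inv \<sigma> i" by simp
      then have "p (inv \<sigma> i) = inv \<sigma> i" using permutes_inverses(2)[OF s] by simp
      then show "inv \<sigma> i \<in> {i \<in> {1..n}. p i = i}"
        using i permutes_in_image[OF permutes_inv[OF s], of i] by simp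
    qed
  qed
  then show ?thesis unfolding fixed_points_def by (simp add: bij_betw_same_card)
qed

definition peak_weight :: "real \<Rightarrow> nat \<Rightarrow> (nat \<Rightarrow> nat) \<Rightarrow> real" where
  "peak_weight e n \<pi> = weight e (peaks n \<pi>) (n - 1 - 2 * peaks n \<pi>)"

lemma configs_all:
  assumes "n \<ge> 1" "a \<ge> 1" and p: "p permutes {1..n}"
  shows "fact n * (real (card (configs p (2 * a) {1..n})) / real (2 * a) ^ n)
     = (\<Sum>\<tau> | \<tau> permutes {1..n}. peak_weight (1 / (2 * real a)\<^sup>2) n (\<tau> \<circ> p \<circ> inv \<tau>))"
proof -
  have "real (card (configs p (2 * a) {1..n})) = (\<Sum>\<tau> | \<tau> permutes {1..n}. real (card (enriched n (\<tau> \<circ> p \<circ> inv \<tau>) (2 * a))))"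
  proof -
    have "card (configs p (2 * a) {1..n}) = (\<Sum>\<tau> | \<tau> permutes {1..n}.
       card (enriched n (\<lambda>i. \<tau> (id (p (inv_into {1..n} id (inv \<tau> i))))) (2 * a)))"
    proof (rule card_configs_eq_sum_enriched)
      show "bij_betw id {1..n} {1..n}" by (rule bij_betw_id)
      show "p ` {1..n} \<subseteq> {1..n}" using permutes_image[OF p] by simp
      show "inj_on p {1..n}" by (rule permutes_inj_on[OF p])
    qed simp
    also have "\<dots> = (\<Sum>\<tau> | \<tau> permutes {1..n}. card (enriched n (\<tau> \<circ> p \<circ> inv \<tau>) (2 * a)))"
    proof (rule sum.cong[OF refl])
      fix \<tau> assume "\<tau> \<in> {\<tau>. \<tau> permutes {1..n}}"
      then have t: "\<tau> permutes {1..n}" by simp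
      have "\<tau> (id (p (inv_into {1..n} id (inv \<tau> i)))) = (\<tau> \<circ> p \<circ> inv \<tau>) i" if "i \<in> {1..n}" for i
      proof -
        have "inv \<tau> i \<in> {1..n}" using permutes_in_image[OF permutes_inv[OF t]] that by simp
        then have "inv_into {1..n} id (inv \<tau> i) = inv \<tau> i" using inv_into_f_f[of id "{1..n}"] by simp
        then show ?thesis by simp
      qed
      then have "enriched n (\<lambda>i. \<tau> (id (p (inv_into {1..n} id (inv \<tau> i))))) (2 * a) = enriched n (\<tau> \<circ> p \<circ> inv \<tau>) (2 * a)"
        by (rule enriched_cong)
      then show "card (enriched n (\<lambda>i. \<tau> (id (p (inv_into {1..n} id (inv \<tau> i))))) (2 * a))
         = card (enriched n (\<tau> \<circ> p \<circ> inv \<tau>) (2 * a))" by simp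
    qed
    finally show ?thesis by simp
  qed
  then have "fact n * real (card (configs p (2 * a) {1..n}))
     = (\<Sum>\<tau> | \<tau> permutes {1..n}. fact n * real (card (enriched n (\<tau> \<circ> p \<circ> inv \<tau>) (2 * a))))"
    by (simp add: sum_distrib_left)
  also have "\<dots> = (\<Sum>\<tau> | \<tau> permutes {1..n}. (2 * real a) ^ n * peak_weight (1 / (2 * real a)\<^sup>2) n (\<tau> \<circ> p \<circ> inv \<tau>))"
  proof (rule sum.cong[OF refl])
    fix \<tau> assume "\<tau> \<in> {\<tau>. \<tau> permutes {1..n}}"
    then have t: "\<tau> permutes {1..n}" by simp
    have "\<tau> \<circ> p \<circ> inv \<tau> permutes {1..n}"
      using permutes_compose[OF permutes_inv[OF t] permutes_compose[OF p t]] .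
    then have "inj_on (\<tau> \<circ> p \<circ> inv \<tau>) {1..n}" by (rule permutes_inj_on)
    then show "fact n * real (card (enriched n (\<tau> \<circ> p \<circ> inv \<tau>) (2 * a)))
      = (2 * real a) ^ n * peak_weight (1 / (2 * real a)\<^sup>2) n (\<tau> \<circ> p \<circ> inv \<tau>)"
      unfolding peak_weight_def by (rule card_enriched_weight[OF assms(1) _ assms(2)])
  qed
  also have "\<dots> = (2 * real a) ^ n * (\<Sum>\<tau> | \<tau> permutes {1..n}. peak_weight (1 / (2 * real a)\<^sup>2) n (\<tau> \<circ> p \<circ> inv \<tau>))"
    by (simp add: sum_distrib_left)
  finally show ?thesis using assms(2) by (simp add: field_simps)
qed

text \<open>Every conjugate of the identity is the identity, so all relabellings contribute equally
  and there are no peaks. The empty set stands apart because \<open>weight\<close> is indexed by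
  \<open>card F - 1\<close>, a truncated difference.\<close>

lemma configs_fixed:
  assumes fin: "finite F" and fixed: "\<And>x. x \<in> F \<Longrightarrow> p x = x" and a: "a \<ge> 1"
  shows "real (card (configs p (2 * a) F)) / real (2 * a) ^ card F
     = (if card F = 0 then 1 else weight (1 / (2 * real a)\<^sup>2) 0 (card F - 1))"
proof (cases "card F = 0")
  case True
  then have "F = {}" using fin by simp
  then have "configs p (2 * a) F = {(\<lambda>_. undefined, {})}" by (auto simp: configs_def strict_lin_def)
  then show ?thesis using True by simp
next
  case False
  define m where "m = card F"
  have m: "m \<ge> 1" using False by (simp add: m_def)
  obtain \<beta> where b: "bij_betw \<beta> F {1..m}" using finite_same_card_bij[OF fin, of "{1..m}"] unfolding m_def by (metis card_atLeastAtMost diff_Suc_1 finite_atLeastAtMost)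
  have "card (configs p (2 * a) F) = (\<Sum>\<tau> | \<tau> permutes {1..m}.
       card (enriched m (\<lambda>i. \<tau> (\<beta> (p (inv_into F \<beta> (inv \<tau> i))))) (2 * a)))"
    using fixed by (intro card_configs_eq_sum_enriched[OF fin b]) (auto simp: inj_on_def)
  also have "\<dots> = (\<Sum>\<tau> | \<tau> permutes {1..m}. card (enriched m (\<lambda>i. i) (2 * a)))"
  proof (rule sum.cong[OF refl])
    fix \<tau> assume "\<tau> \<in> {\<tau>. \<tau> permutes {1..m}}"
    then have t: "\<tau> permutes {1..m}" by simp
    have "\<tau> (\<beta> (p (inv_into F \<beta> (inv \<tau> i)))) = i" if "i \<in> {1..m}" for i
    proof -
      have 1: "inv \<tau> i \<in> {1..m}" using permutes_in_image[OF permutes_inv[OF t]] that by simp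
      have "inv_into F \<beta> (inv \<tau> i) \<in> F" using bij_betw_apply[OF bij_betw_inv_into[OF b] 1] .
      then have "p (inv_into F \<beta> (inv \<tau> i)) = inv_into F \<beta> (inv \<tau> i)" by (rule fixed)
      then show ?thesis using bij_betw_inv_into_right[OF b 1] permutes_inverses(1)[OF t] by simp
    qed
    then have "enriched m (\<lambda>i. \<tau> (\<beta> (p (inv_into F \<beta> (inv \<tau> i))))) (2 * a) = enriched m (\<lambda>i. i) (2 * a)"
      by (rule enriched_cong)
    then show "card (enriched m (\<lambda>i. \<tau> (\<beta> (p (inv_into F \<beta> (inv \<tau> i))))) (2 * a)) = card (enriched m (\<lambda>i. i) (2 * a))"
      by simp
  qed
  also have "\<dots> = fact m * card (enriched m (\<lambda>i. i) (2 * a))"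
    using card_permutations[of "{1..m}" m] by simp
  finally have "real (card (configs p (2 * a) F)) = fact m * real (card (enriched m (\<lambda>i. i) (2 * a)))"
    by simp
  also have "\<dots> = (2 * real a) ^ m * weight (1 / (2 * real a)\<^sup>2) (peaks m (\<lambda>i. i)) (m - 1 - 2 * peaks m (\<lambda>i. i))"
    by (rule card_enriched_weight[OF m _ a]) simp
  also have "peaks m (\<lambda>i. i) = 0" by (simp add: peaks_def)
  finally show ?thesis using False a by (simp add: m_def)
qed

text \<open>The normalised number of configurations on \<open>{1..n}\<close> is the mean weight over
  the class, and on the fixed points it is \<open>w\<close>. Comparing the two is where the cycle
  type drops out.\<close>

lemma mean_peak_weight_bounds:
  assumes n: "n \<ge> 1" and a: "a \<ge> 1" and C: "conj_class n C"
  defines "e \<equiv> 1 / (2 * real a)\<^sup>2" and "m \<equiv> fixed_points n (SOME p. p \<in> C)"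
    and "\<delta> \<equiv> 2 * real n / (2 * real a)\<^sup>2 + 1 / (2 * real a)"
  defines "w \<equiv> if m = 0 then 1 else weight e 0 (m - 1)"
  shows "finite C" "C \<noteq> {}" "\<And>\<pi>. \<pi> \<in> C \<Longrightarrow> \<pi> permutes {1..n}" "m \<le> n"
    "(\<Sum>\<pi>\<in>C. peak_weight e n \<pi>) / card C \<le> (1 + \<delta>) ^ n * w"
    "(1 - real n * \<delta>) * w \<le> (\<Sum>\<pi>\<in>C. peak_weight e n \<pi>) / card C"
proof -
  obtain p where p: "p permutes {1..n}" and Ceq: "C = {\<sigma> \<circ> p \<circ> inv \<sigma> | \<sigma>. \<sigma> permutes {1..n}}"
    using C by (auto simp: conj_class_def)
  note sc = sum_conjugates[OF p Ceq]
  show fin: "finite C" and ne: "C \<noteq> {}" by (rule sc(1,2))+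
  show perm: "\<pi> permutes {1..n}" if pi: "\<pi> \<in> C" for \<pi>
  proof -
    obtain t where t: "t permutes {1..n}" "\<pi> = t \<circ> p \<circ> inv t" using pi unfolding Ceq by blast
    show ?thesis unfolding t(2) using permutes_compose[OF permutes_inv[OF t(1)] permutes_compose[OF p t(1)]] .
  qed
  have "(SOME p. p \<in> C) \<in> C" using ne by (simp add: some_in_eq)
  then obtain t where t: "t permutes {1..n}" "(SOME p. p \<in> C) = t \<circ> p \<circ> inv t" unfolding Ceq by blast
  have m: "m = card {x \<in> {1..n}. p x = x}"
    unfolding m_def t(2) fixed_points_conjugate[OF t(1)] by (simp add: fixed_points_def)
  show "m \<le> n" unfolding m using card_mono[of "{1..n}" "{x \<in> {1..n}. p x = x}"] by (metis (no_types, lifting) card_atLeastAtMost diff_Suc_1 finite_atLeastAtMost mem_Collect_eq subsetI)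
  let ?g = "\<lambda>T. real (card (configs p (2 * a) T)) / real (2 * a) ^ card T"
  have gF: "?g {x \<in> {1..n}. p x = x} = w"
    unfolding w_def e_def m by (rule configs_fixed) (use a in auto)
  have cC: "real (card C) > 0" using fin ne by (simp add: card_gt_0_iff)
  have gS: "?g {1..n} = (\<Sum>\<pi>\<in>C. peak_weight e n \<pi>) / card C"
  proof -
    have "fact n * (real (card C) * ?g {1..n}) = real (card C) * (fact n * ?g {1..n})" by (simp only: mult_ac)
    also have "\<dots> = fact n * (\<Sum>\<pi>\<in>C. peak_weight e n \<pi>)"
      using sc(3)[of "peak_weight e n"] configs_all[OF n a p] unfolding e_def by simp
    finally have "real (card C) * ?g {1..n} = (\<Sum>\<pi>\<in>C. peak_weight e n \<pi>)" by (simp only: mult_cancel_left fact_nonzero simp_thms)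
    then show ?thesis using cC by (simp add: field_simps)
  qed
  have \<delta>: "\<delta> = 2 * real n / (real (2 * a))\<^sup>2 + 1 / real (2 * a)" by (simp add: \<delta>_def)
  have K: "2 * a \<ge> 1" using a by simp
  have inv: "p ` {1..n} \<subseteq> {1..n}" using permutes_image[OF p] by simp
  note b = card_configs_fixed_points[OF permutes_inj[OF p] K \<delta> _ inv]
  have b1: "?g {1..n} \<le> (1 + \<delta>) ^ card {1..n} * ?g {x \<in> {1..n}. p x = x}" by (rule b(1)) simp_all
  have b2: "(1 - real (card {1..n}) * \<delta>) * ?g {x \<in> {1..n}. p x = x} \<le> ?g {1..n}" by (rule b(2)) simp_all
  show "(\<Sum>\<pi>\<in>C. peak_weight e n \<pi>) / card C \<le> (1 + \<delta>) ^ n * w"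
    using b1 unfolding gF gS by simp
  show "(1 - real n * \<delta>) * w \<le> (\<Sum>\<pi>\<in>C. peak_weight e n \<pi>) / card C"
    using b2 unfolding gF gS by simp
qed

section \<open>Laplace transforms and weak convergence\<close>

text \<open>Holds for either sign of \<open>z\<close>. It bounds the transforms on a compact subset
  of the half plane by their values at two positive reals.\<close>

lemma exp_laplace_interp:
  fixes l s u z :: real
  assumes "l \<le> s" "s \<le> u"
  shows "exp (- s * z) \<le> exp (- l * z) + exp (- u * z)"
proof (cases "z \<ge> 0")
  case True
  then have "- s * z \<le> - l * z" using assms by (simp add: mult_right_mono)
  then have "exp (- s * z) \<le> exp (- l * z)" by simp
  then show ?thesis by (simp add: add_increasing2)
next
  case False
  then have "- s * z \<le> - u * z" using assms by (simp add: mult_right_mono_neg)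
  then have "exp (- s * z) \<le> exp (- u * z)" by simp
  then show ?thesis by (simp add: add_increasing)
qed

text \<open>Montel's theorem and the identity theorem extend the convergence to the half plane
  \<open>Re z > 0\<close>; the second moment of \<open>1 - exp (- d * Z)\<close> controls the passage to its boundary.\<close>

lemma laplace_convergence_imp_char_convergence:
  fixes C :: "nat \<Rightarrow> 'a set" and Z :: "nat \<Rightarrow> 'a \<Rightarrow> real" and v :: real
  assumes fin: "\<And>n. finite (C n)" and ne: "\<And>n. C n \<noteq> {}"
    and conv: "\<And>s. s > 0 \<Longrightarrow> (\<lambda>n. (\<Sum>x\<in>C n. exp (- s * Z n x)) / card (C n)) \<longlonglongrightarrow> exp (s\<^sup>2 * v / 2)"
  shows "(\<lambda>n. (\<Sum>x\<in>C n. exp (\<i> * of_real (t * Z n x))) / of_nat (card (C n))) \<longlonglongrightarrow> of_real (exp (- t\<^sup>2 * v / 2))"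
proof -
  define f where "f = (\<lambda>n s. (\<Sum>x\<in>C n. exp (- s * Z n x)) / real (card (C n)))"
  define F where "F = (\<lambda>n z. (\<Sum>x\<in>C n. exp (- z * of_real (Z n x))) / of_nat (card (C n)) :: complex)"
  define G where "G = (\<lambda>z. exp (z\<^sup>2 * of_real v / 2) :: complex)"
  define S where "S = {z. Re z > 0}"
  have c0: "real (card (C n)) > 0" for n using fin ne by (simp add: card_gt_0_iff)
  have fconv: "(\<lambda>n. f n s) \<longlonglongrightarrow> exp (s\<^sup>2 * v / 2)" if "s > 0" for s
    using conv[OF that] by (simp add: f_def)
  have opS: "open S" unfolding S_def by (rule open_halfspace_Re_gt)
  have conS: "connected S" unfolding S_def by (intro convex_connected convex_halfspace_Re_gt)
  have holF: "F n holomorphic_on S" for n unfolding F_def by (intro holomorphic_intros) (use c0[of n] in auto)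
  have holG: "G holomorphic_on S" unfolding G_def by (intro holomorphic_intros) auto
  have Fr: "F n (of_real s) = of_real (f n s)" for n s
    unfolding F_def f_def by (simp add: exp_of_real[symmetric])
  have Fle: "norm (F n z) \<le> f n (Re z)" for n z
  proof -
    have "norm (\<Sum>x\<in>C n. exp (- z * of_real (Z n x))) \<le> (\<Sum>x\<in>C n. exp (- Re z * Z n x))"
      by (rule sum_norm_le) (simp add: norm_exp_eq_Re)
    then show ?thesis unfolding F_def f_def by (simp add: norm_divide divide_right_mono)
  qed
  have finterp: "f n s \<le> f n l + f n u" if "l \<le> s" "s \<le> u" for n l s u
  proof -
    have "(\<Sum>x\<in>C n. exp (- s * Z n x)) \<le> (\<Sum>x\<in>C n. exp (- l * Z n x)) + (\<Sum>x\<in>C n. exp (- u * Z n x))"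
      unfolding sum.distrib[symmetric] by (rule sum_mono) (rule exp_laplace_interp[OF that])
    then show ?thesis unfolding f_def add_divide_distrib[symmetric] by (rule divide_right_mono) simp
  qed
  have fbd: "\<exists>B. \<forall>n. f n s \<le> B" if "s > 0" for s
  proof -
    have "Bseq (\<lambda>n. f n s)" using convergentI[OF fconv[OF that]] by (rule convergent_imp_Bseq)
    then obtain B where "\<And>n. norm (f n s) \<le> B" unfolding Bseq_def by blast
    then have "\<forall>n. f n s \<le> B" by (metis abs_le_D1 real_norm_def)
    then show ?thesis by blast
  qed
  have bounded: "\<exists>B. \<forall>h\<in>range F. \<forall>z\<in>K. norm (h z) \<le> B" if K: "compact K" "K \<subseteq> S" for K
  proof (cases "K = {}")
    case False
    have "compact (Re ` K)" by (intro compact_continuous_image K continuous_intros)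
    moreover have "Re ` K \<noteq> {}" using False by simp
    ultimately obtain l u where l: "l \<in> Re ` K" "\<And>s. s \<in> Re ` K \<Longrightarrow> l \<le> s"
      and u: "u \<in> Re ` K" "\<And>s. s \<in> Re ` K \<Longrightarrow> s \<le> u"
      by (metis compact_attains_inf compact_attains_sup)
    have "l > 0" "u > 0" using l(1) u(1) K(2) by (auto simp: S_def)
    then obtain B1 B2 where B: "\<And>n. f n l \<le> B1" "\<And>n. f n u \<le> B2" using fbd by metis
    have "norm (F n z) \<le> B1 + B2" if "z \<in> K" for n z
    proof -
      have "f n (Re z) \<le> f n l + f n u" using l(2) u(2) that by (intro finterp) auto
      then show ?thesis using Fle[of n z] B(1)[of n] B(2)[of n] by linarith
    qed
    then show ?thesis by (intro exI[of _ "B1 + B2"]) auto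
  qed auto
  have Fconv: "(\<lambda>n. F n z) \<longlonglongrightarrow> G z" if z: "z \<in> S" for z
  proof (rule ccontr)
    assume "\<not> ?thesis"
    \<comment> \<open>Failure of convergence at \<open>z\<close> gives a subsequence
      \<open>r\<close> staying \<open>\<epsilon>\<close> away from \<open>G z\<close>. Montel
      extracts from it a further subsequence with a holomorphic limit; that limit agrees with
      \<open>G\<close> on the positive reals and therefore at \<open>z\<close>.\<close>
    then obtain \<epsilon> where eps: "\<epsilon> > 0" "\<And>N. \<exists>n\<ge>N. \<not> dist (F n z) (G z) < \<epsilon>"
      unfolding lim_sequentially by blast
    then have "\<exists>\<^sub>\<infinity>n. \<not> dist (F n z) (G z) < \<epsilon>" unfolding INFM_nat_le by blast
    then have inf: "infinite {n. \<not> dist (F n z) (G z) < \<epsilon>}" by (simp add: frequently_cofinite)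
    define r where "r = enumerate {n. \<not> dist (F n z) (G z) < \<epsilon>}"
    have r: "strict_mono r" "\<And>n. \<not> dist (F (r n) z) (G z) < \<epsilon>"
      unfolding r_def using strict_mono_enumerate[OF inf] enumerate_in_set[OF inf] by auto
    obtain g q where g: "g holomorphic_on S" and q: "strict_mono (q :: nat \<Rightarrow> nat)"
      and lim: "\<And>x. x \<in> S \<Longrightarrow> ((\<lambda>n. (F \<circ> r) (q n) x) \<longlongrightarrow> g x) sequentially"
      by (rule Montel[OF opS, of "range F" "F \<circ> r"]) (use holF bounded in auto)
    have real: "g (of_real s) = G (of_real s)" if "s > 0" for s
    proof -
      have "(\<lambda>n. f (r (q n)) s) \<longlonglongrightarrow> exp (s\<^sup>2 * v / 2)"
        using LIMSEQ_subseq_LIMSEQ[OF fconv[OF that] strict_mono_o[OF r(1) q]] by (simp add: o_def)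
      then have "(\<lambda>n. complex_of_real (f (r (q n)) s)) \<longlonglongrightarrow> of_real (exp (s\<^sup>2 * v / 2))"
        by (rule tendsto_of_real)
      then have "(\<lambda>n. (F \<circ> r) (q n) (of_real s)) \<longlonglongrightarrow> G (of_real s)"
        by (simp add: Fr G_def exp_of_real[symmetric])
      moreover have "(\<lambda>n. (F \<circ> r) (q n) (of_real s)) \<longlonglongrightarrow> g (of_real s)"
        using that by (intro lim) (simp add: S_def)
      ultimately show ?thesis using LIMSEQ_unique by blast
    qed
    have "g z - G z = 0"
    proof (rule analytic_continuation[of "\<lambda>z. g z - G z" S "of_real ` {0<..}" 1])
      show "(\<lambda>z. g z - G z) holomorphic_on S" by (intro holomorphic_on_diff g holG)
      show "complex_of_real ` {0<..} \<subseteq> S" by (auto simp: S_def)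
      show "(1::complex) islimpt complex_of_real ` {0<..}"
        unfolding islimpt_approachable
      proof (intro allI impI)
        fix e :: real assume e: "e > 0"
        have "complex_of_real (1 + e / 2) \<in> complex_of_real ` {0<..}" using e by (intro imageI) simp
        moreover have "complex_of_real (1 + e / 2) \<noteq> 1 \<and> dist (complex_of_real (1 + e / 2)) 1 < e"
          using e by (simp add: dist_norm norm_divide)
        ultimately show "\<exists>x'\<in>complex_of_real ` {0<..}. x' \<noteq> 1 \<and> dist x' 1 < e" by blast
      qed
    qed (use opS conS z real in \<open>auto simp: S_def\<close>)
    then have "(\<lambda>n. F (r (q n)) z) \<longlonglongrightarrow> G z" using lim[OF z] by simp
    then have "eventually (\<lambda>n. dist (F (r (q n)) z) (G z) < \<epsilon>) sequentially" using eps(1) by (rule tendstoD)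
    then show False using r(2) by (auto simp: eventually_sequentially)
  qed
  define X where "X = (\<lambda>n. (\<Sum>x\<in>C n. exp (\<i> * of_real (t * Z n x))) / of_nat (card (C n)))"
  \<comment> \<open>The difference of the two integrands has modulus
    \<open>\<bar>1 - exp (- d * Z)\<bar>\<close>, and
    \<open>u \<le> \<eta> / 2 + u ^ 2 / (2 * \<eta>)\<close> reduces it to a square. The mean of
    that square is \<open>1 - 2 * f n d + f n (2 * d)\<close>, which uses real arguments only and is
    small in the limit for small \<open>d\<close>.\<close>
  have bdry: "norm (X n - F n (Complex d (- t))) \<le> \<eta> / 2 + (1 - 2 * f n d + f n (2 * d)) / (2 * \<eta>)"
    if "\<eta> > 0" for n d \<eta>
  proof -
    let ?b = "\<lambda>x. exp (- d * Z n x)"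
    have "norm ((\<Sum>x\<in>C n. exp (\<i> * of_real (t * Z n x))) - (\<Sum>x\<in>C n. exp (- Complex d (- t) * of_real (Z n x))))
       \<le> (\<Sum>x\<in>C n. \<eta> / 2 + (1 - 2 * ?b x + exp (- (2 * d) * Z n x)) / (2 * \<eta>))"
      unfolding sum_subtractf[symmetric]
    proof (rule sum_norm_le)
      fix x
      have e: "exp (- Complex d (- t) * of_real (Z n x)) = of_real (?b x) * exp (\<i> * of_real (t * Z n x))"
        unfolding exp_of_real[symmetric] exp_add[symmetric] by (simp add: complex_eq_iff Complex_eq algebra_simps)
      have "norm (exp (\<i> * of_real (t * Z n x)) - exp (- Complex d (- t) * of_real (Z n x)))
         = norm (of_real (1 - ?b x) * exp (\<i> * of_real (t * Z n x)))"
        unfolding e by (simp add: algebra_simps)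
      also have "\<dots> = \<bar>1 - ?b x\<bar>" by (simp add: norm_mult del: of_real_diff of_real_mult)
      also have "\<dots> \<le> \<eta> / 2 + (1 - ?b x)\<^sup>2 / (2 * \<eta>)"
      proof -
        have "0 \<le> (\<eta> - \<bar>1 - ?b x\<bar>)\<^sup>2" by simp
        also have "\<dots> = \<eta>\<^sup>2 - 2 * \<eta> * \<bar>1 - ?b x\<bar> + (1 - ?b x)\<^sup>2" by (simp add: power2_diff)
        finally show ?thesis using that by (simp add: field_simps power2_eq_square)
      qed
      also have "(1 - ?b x)\<^sup>2 = 1 - 2 * ?b x + exp (- (2 * d) * Z n x)"
      proof -
        have "exp (- (2 * d) * Z n x) = (?b x)\<^sup>2" by (simp add: exp_double[symmetric] algebra_simps)
        then show ?thesis by (simp add: power2_diff)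
      qed
      finally show "norm (exp (\<i> * of_real (t * Z n x)) - exp (- Complex d (- t) * of_real (Z n x)))
         \<le> \<eta> / 2 + (1 - 2 * ?b x + exp (- (2 * d) * Z n x)) / (2 * \<eta>)" .
    qed
    also have "\<dots> = real (card (C n)) * (\<eta> / 2 + (1 - 2 * f n d + f n (2 * d)) / (2 * \<eta>))"
    proof -
      have "(\<Sum>x\<in>C n. \<eta> / 2 + (1 - 2 * ?b x + exp (- (2 * d) * Z n x)) / (2 * \<eta>))
        = real (card (C n)) * (\<eta> / 2) + (real (card (C n)) - 2 * (\<Sum>x\<in>C n. ?b x) + (\<Sum>x\<in>C n. exp (- (2 * d) * Z n x))) / (2 * \<eta>)"
        by (simp only: sum.distrib sum_subtractf sum_divide_distrib[symmetric] sum_distrib_left[symmetric]) simp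
      also have "\<dots> = real (card (C n)) * (\<eta> / 2 + (1 - 2 * f n d + f n (2 * d)) / (2 * \<eta>))"
        using c0[of n] that unfolding f_def by (simp add: field_simps)
      finally show ?thesis .
    qed
    finally show ?thesis
      unfolding X_def F_def diff_divide_distrib[symmetric]
      using c0[of n] by (simp add: norm_divide field_simps)
  qed
  have "(\<lambda>n. X n) \<longlonglongrightarrow> of_real (exp (- t\<^sup>2 * v / 2))"
  proof (rule tendstoI)
    fix \<epsilon> :: real assume e: "\<epsilon> > 0"
    \<comment> \<open>Half of \<open>\<epsilon>\<close>, so that the four parts of the final
      estimate, two quarters besides \<open>\<epsilon> / 4 + \<epsilon> / 8\<close> from the
      boundary bound, stay below \<open>\<epsilon>\<close>.\<close>
    define \<eta> where "\<eta> = \<epsilon> / 2"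
    have eta: "\<eta> > 0" using e by (simp add: \<eta>_def)
    have "((\<lambda>d. 1 - 2 * exp (d\<^sup>2 * v / 2) + exp ((2 * d)\<^sup>2 * v / 2)) \<longlongrightarrow> 1 - 2 * exp (0\<^sup>2 * v / 2) + exp ((2 * 0)\<^sup>2 * v / 2)) (at_right 0)"
      by (intro tendsto_intros) auto
    then have "((\<lambda>d. 1 - 2 * exp (d\<^sup>2 * v / 2) + exp ((2 * d)\<^sup>2 * v / 2)) \<longlongrightarrow> 0) (at_right 0)" by simp
    then have 1: "eventually (\<lambda>d. 1 - 2 * exp (d\<^sup>2 * v / 2) + exp ((2 * d)\<^sup>2 * v / 2) < \<eta> * \<epsilon> / 4) (at_right 0)"
      using eta e by (intro order_tendstoD) auto
    have "((\<lambda>d. G (of_real d - \<i> * of_real t)) \<longlongrightarrow> G (of_real 0 - \<i> * of_real t)) (at_right 0)"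
      unfolding G_def by (intro tendsto_intros) auto
    moreover have "G (of_real 0 - \<i> * of_real t) = of_real (exp (- t\<^sup>2 * v / 2))"
      by (simp add: G_def power_mult_distrib exp_of_real[symmetric])
    ultimately have "((\<lambda>d. G (of_real d - \<i> * of_real t)) \<longlongrightarrow> of_real (exp (- t\<^sup>2 * v / 2))) (at_right 0)"
      by (simp only:)
    then have 2: "eventually (\<lambda>d. dist (G (of_real d - \<i> * of_real t)) (of_real (exp (- t\<^sup>2 * v / 2))) < \<epsilon> / 4) (at_right 0)"
      by (rule tendstoD) (use e in simp)
    have 3: "eventually (\<lambda>d::real. d > 0) (at_right 0)" by (rule eventually_at_right_less)
    obtain d where d: "d > 0" "1 - 2 * exp (d\<^sup>2 * v / 2) + exp ((2 * d)\<^sup>2 * v / 2) < \<eta> * \<epsilon> / 4"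
      "dist (G (of_real d - \<i> * of_real t)) (of_real (exp (- t\<^sup>2 * v / 2))) < \<epsilon> / 4"
      using eventually_happens[OF eventually_conj[OF 1 eventually_conj[OF 2 3]]] by auto
    have z: "of_real d - \<i> * of_real t = Complex d (- t)" by (simp add: complex_eq_iff)
    have "(\<lambda>n. 1 - 2 * f n d + f n (2 * d)) \<longlonglongrightarrow> 1 - 2 * exp (d\<^sup>2 * v / 2) + exp ((2 * d)\<^sup>2 * v / 2)"
      using d(1) by (intro tendsto_intros fconv) auto
    then have 4: "eventually (\<lambda>n. 1 - 2 * f n d + f n (2 * d) < \<eta> * \<epsilon> / 4) sequentially"
      using d(2) by (rule order_tendstoD)
    have "(\<lambda>n. F n (Complex d (- t))) \<longlonglongrightarrow> G (Complex d (- t))"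
      by (rule Fconv) (use d(1) in \<open>simp add: S_def\<close>)
    then have 5: "eventually (\<lambda>n. dist (F n (Complex d (- t))) (G (Complex d (- t))) < \<epsilon> / 4) sequentially"
      using e by (intro tendstoD) auto
    from 4 5 show "eventually (\<lambda>n. dist (X n) (of_real (exp (- t\<^sup>2 * v / 2))) < \<epsilon>) sequentially"
    proof eventually_elim
      case (elim n)
      have "(1 - 2 * f n d + f n (2 * d)) / (2 * \<eta>) \<le> (\<eta> * \<epsilon> / 4) / (2 * \<eta>)"
        using elim(1) eta by (intro divide_right_mono) auto
      also have "\<dots> = \<epsilon> / 8" using eta by simp
      finally have q: "(1 - 2 * f n d + f n (2 * d)) / (2 * \<eta>) \<le> \<epsilon> / 8" .
      have "\<eta> / 2 = \<epsilon> / 4" by (simp add: \<eta>_def)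
      then have "dist (X n) (F n (Complex d (- t))) \<le> \<epsilon> / 4 + \<epsilon> / 8"
        using bdry[OF eta, of n d] q unfolding dist_norm by linarith
      moreover have "dist (X n) (of_real (exp (- t\<^sup>2 * v / 2))) \<le> dist (X n) (F n (Complex d (- t)))
         + dist (F n (Complex d (- t))) (G (Complex d (- t))) + dist (G (Complex d (- t))) (of_real (exp (- t\<^sup>2 * v / 2)))"
        by (meson add_right_mono dist_triangle order_trans)
      ultimately show ?case using elim(2) d(3) e unfolding z by linarith
    qed
  qed
  then show ?thesis by (simp add: X_def)
qed

section \<open>Peaks of a random element of a conjugacy class\<close>

definition mean :: "'a set \<Rightarrow> ('a \<Rightarrow> real) \<Rightarrow> real" where
  "mean A f = (\<Sum>x\<in>A. f x) / real (card A)"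

lemma mean_mono: "(\<And>x. x \<in> A \<Longrightarrow> f x \<le> g x) \<Longrightarrow> mean A f \<le> mean A g"
  unfolding mean_def by (intro divide_right_mono sum_mono) auto

lemma mean_nonneg: "(\<And>x. x \<in> A \<Longrightarrow> 0 \<le> f x) \<Longrightarrow> 0 \<le> mean A f"
  unfolding mean_def by (intro divide_nonneg_nonneg sum_nonneg) auto

lemma mean_cmult: "mean A (\<lambda>x. c * f x) = c * mean A f"
  unfolding mean_def by (simp add: sum_distrib_left)

lemma mean_add: "mean A (\<lambda>x. f x + g x) = mean A f + mean A g"
  unfolding mean_def by (simp add: sum.distrib add_divide_distrib)

lemma mean_diff: "mean A (\<lambda>x. f x - g x) = mean A f - mean A g"
  unfolding mean_def by (simp add: sum_subtractf diff_divide_distrib)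

lemma mean_const: "finite A \<Longrightarrow> A \<noteq> {} \<Longrightarrow> mean A (\<lambda>x. c) = c"
  unfolding mean_def by simp

lemma mean_abs: "\<bar>mean A f\<bar> \<le> mean A (\<lambda>x. \<bar>f x\<bar>)"
  unfolding mean_def by (simp add: abs_divide divide_right_mono)

lemma mean_exp_perturb:
  assumes "\<And>x. x \<in> A \<Longrightarrow> \<bar>u x - v x\<bar> \<le> \<eta>"
  shows "mean A (\<lambda>x. exp (u x)) \<le> exp \<eta> * mean A (\<lambda>x. exp (v x))"
    "exp (- \<eta>) * mean A (\<lambda>x. exp (v x)) \<le> mean A (\<lambda>x. exp (u x))"
proof -
  show "mean A (\<lambda>x. exp (u x)) \<le> exp \<eta> * mean A (\<lambda>x. exp (v x))"
    unfolding mean_cmult[symmetric] exp_add[symmetric]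
    by (rule mean_mono) (use assms in \<open>force simp: abs_le_iff\<close>)
  show "exp (- \<eta>) * mean A (\<lambda>x. exp (v x)) \<le> mean A (\<lambda>x. exp (u x))"
    unfolding mean_cmult[symmetric] exp_add[symmetric]
    by (rule mean_mono) (use assms in \<open>force simp: abs_le_iff\<close>)
qed

definition quad :: "real \<Rightarrow> real" where
  "quad x = - 3 / 10 + 3 / 2 * x - 2 * x\<^sup>2"

lemma quad_bound:
  assumes "0 \<le> x" "x \<le> 1"
  shows "\<bar>quad x\<bar> \<le> 2"
proof -
  have "quad x = - 3 / 10 + x * (3 / 2 - 2 * x)" by (simp add: quad_def power2_eq_square algebra_simps)
  moreover have "\<bar>x * (3 / 2 - 2 * x)\<bar> \<le> 1 * (3 / 2)"
    unfolding abs_mult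
  proof (rule mult_mono)
    show "\<bar>3 / 2 - 2 * x\<bar> \<le> 3 / 2" using assms by (intro abs_leI; linarith)
  qed (use assms in auto)
  ultimately show ?thesis by linarith
qed

lemma quad_lipschitz:
  assumes "0 \<le> x" "x \<le> 1" "0 \<le> y" "y \<le> 1"
  shows "\<bar>quad x - quad y\<bar> \<le> 3 * \<bar>x - y\<bar>"
proof -
  have "quad x - quad y = (3 / 2 - 2 * (x + y)) * (x - y)" by (simp add: quad_def power2_eq_square field_simps)
  moreover have "\<bar>3 / 2 - 2 * (x + y)\<bar> \<le> 3"
  proof (rule abs_leI)
    show "3 / 2 - 2 * (x + y) \<le> 3" using assms by simp
    show "- (3 / 2 - 2 * (x + y)) \<le> 3" using assms by simp
  qed
  ultimately show ?thesis by (simp add: abs_mult mult_right_mono)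
qed

locale conj_class_sequence =
  fixes C :: "nat \<Rightarrow> (nat \<Rightarrow> nat) set" and \<alpha> :: real
  assumes conj: "\<And>n. n \<ge> 1 \<Longrightarrow> conj_class n (C n)"
    and lim: "(\<lambda>n. alpha1 n (C n)) \<longlonglongrightarrow> \<alpha>"
begin

definition \<mu> :: "nat \<Rightarrow> real" where "\<mu> n = (1 - alpha1 n (C n) ^ 3) / 3"

definition dev :: "nat \<Rightarrow> (nat \<Rightarrow> nat) \<Rightarrow> real" where
  "dev n \<pi> = real (peaks n \<pi>) - \<mu> n * real n"

definition peak_frac :: "nat \<Rightarrow> (nat \<Rightarrow> nat) \<Rightarrow> real" where
  "peak_frac n \<pi> = real (peaks n \<pi>) / real n"

lemma finite_C: "n \<ge> 1 \<Longrightarrow> finite (C n)" and C_nonempty: "n \<ge> 1 \<Longrightarrow> C n \<noteq> {}"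
  using mean_peak_weight_bounds(1,2)[of n 1 "C n"] conj by auto

lemma alpha1_bounds:
  assumes "n \<ge> 1"
  shows "0 \<le> alpha1 n (C n)" "alpha1 n (C n) \<le> 1"
  using mean_peak_weight_bounds(4)[of n 1 "C n"] conj[OF assms] assms by (auto simp: alpha1_def)

lemma peaks_bound:
  assumes "n \<ge> 1" "\<pi> \<in> C n"
  shows "2 * peaks n \<pi> + 1 \<le> n"
  using mean_peak_weight_bounds(3)[OF assms(1) order_refl conj[OF assms(1)] assms(2)]
  by (intro even_fps_eq_enriched_fps(1)[OF assms(1)] permutes_inj_on)

lemma mu_bounds: "n \<ge> 1 \<Longrightarrow> 0 \<le> \<mu> n" "n \<ge> 1 \<Longrightarrow> \<mu> n \<le> 1"
proof -
  assume n: "n \<ge> 1"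
  have "alpha1 n (C n) ^ 3 \<le> 1" "0 \<le> alpha1 n (C n) ^ 3"
    using alpha1_bounds[OF n] by (auto simp: power_le_one)
  then show "0 \<le> \<mu> n" "\<mu> n \<le> 1" by (simp_all add: \<mu>_def field_simps del: zero_le_power_eq)
qed

lemma frac_bounds: "n \<ge> 1 \<Longrightarrow> \<pi> \<in> C n \<Longrightarrow> 0 \<le> peak_frac n \<pi>" "n \<ge> 1 \<Longrightarrow> \<pi> \<in> C n \<Longrightarrow> peak_frac n \<pi> \<le> 1"
  using peaks_bound[of n \<pi>] by (auto simp: peak_frac_def)

lemma dev_frac: "n \<ge> 1 \<Longrightarrow> dev n \<pi> = real n * (peak_frac n \<pi> - \<mu> n)"
  by (simp add: dev_def peak_frac_def algebra_simps)

lemma dev_bound: "n \<ge> 1 \<Longrightarrow> \<pi> \<in> C n \<Longrightarrow> \<bar>dev n \<pi>\<bar> \<le> real n"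
proof -
  assume n: "n \<ge> 1" and pi: "\<pi> \<in> C n"
  have "\<bar>peak_frac n \<pi> - \<mu> n\<bar> \<le> 1" using frac_bounds[OF n pi] mu_bounds[OF n] by linarith
  then have "real n * \<bar>peak_frac n \<pi> - \<mu> n\<bar> \<le> real n * 1" by (intro mult_left_mono) auto
  then show ?thesis by (simp add: dev_frac[OF n] abs_mult)
qed

text \<open>Here \<open>h = e * n ^ 2\<close>. On the class the leading exponent is
  \<open>e * (n ^ 3 / 3 - k * n ^ 2)\<close>, on the \<open>m\<close> fixed points it is
  \<open>e * m ^ 3 / 3\<close>; the difference is exactly \<open>- h * dev n \<pi>\<close>, which is
  the source of the centring. \<open>b\<close> is the second-order term of the identity on the fixed
  points, \<open>E\<close> is twice the error of \<open>weight_asymp\<close> (once for each side),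
  and \<open>2 * h + sqrt h\<close> is \<open>n * \<delta>\<close>.\<close>

lemma mean_exp_bounds:
  assumes n: "n \<ge> 1" and a: "a \<ge> 1" and h: "h = (real n)\<^sup>2 / (2 * real a)\<^sup>2" and h8: "h \<le> 1 / 8"
  defines "E \<equiv> 10 * real n * h ^ 3 + 60 * h" and "b \<equiv> 3 / 10 * (h\<^sup>2 * real n) * alpha1 n (C n) ^ 5"
  defines "M \<equiv> mean (C n) (\<lambda>\<pi>. exp (- h * dev n \<pi> + h\<^sup>2 * real n * quad (peak_frac n \<pi>)))"
  shows "M \<le> exp (E + (2 * h + sqrt h) - b)" "(1 - (2 * h + sqrt h)) * exp (- E - b) \<le> M"
proof -
  define e where "e = 1 / (2 * real a)\<^sup>2"
  define m where "m = fixed_points n (SOME p. p \<in> C n)"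
  define w where "w = (if m = 0 then 1 else weight e 0 (m - 1))"
  define \<delta> where "\<delta> = 2 * real n / (2 * real a)\<^sup>2 + 1 / (2 * real a)"
  define D where "D = 5 * real n * h ^ 3 + 30 * h"
  note b5 = mean_peak_weight_bounds[OF n a conj[OF n], folded e_def m_def \<delta>_def, folded w_def]
  have e0: "0 \<le> e" by (simp add: e_def)
  have he: "h = e * (real n)\<^sup>2" by (simp add: h e_def)
  have h0: "0 \<le> h" by (simp add: h)
  have nR: "real n > 0" using n by simp
  have am: "alpha1 n (C n) = real m / real n" by (simp add: alpha1_def m_def)
  have nd: "real n * \<delta> = 2 * h + sqrt h"
  proof -
    have "sqrt h = real n / (2 * real a)" unfolding h power_divide[symmetric] by simp
    then show ?thesis unfolding \<delta>_def h by (simp add: field_simps power2_eq_square)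
  qed
  have \<delta>0: "\<delta> \<ge> 0" by (simp add: \<delta>_def)
  \<comment> \<open>The identity on \<open>m\<close> points is the case of 0 peaks. As
    \<open>m \<le> n\<close>, its error is covered by the one at length \<open>n\<close>.\<close>
  have lw: "w > 0 \<and> \<bar>ln w - (e * real m ^ 3 / 3 - b)\<bar> \<le> D"
  proof (cases "m = 0")
    case True
    have "0 \<le> D" using h0 by (simp add: D_def)
    then show ?thesis using True by (simp add: w_def b_def am)
  next
    case False
    have mn: "real m \<le> real n" using b5(4) by simp
    have hm: "e * (real m)\<^sup>2 \<le> h" unfolding he using mn by (intro mult_left_mono power_mono e0) auto
    have "5 * real m * (e * (real m)\<^sup>2) ^ 3 + 30 * (e * (real m)\<^sup>2) \<le> D"
      unfolding D_def using mn hm e0 h0 by (intro add_mono mult_mono power_mono) auto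
    moreover have "e\<^sup>2 * (- 3 / 10 * real m ^ 5) = - b"
      unfolding b_def am he using nR by (simp add: field_simps eval_nat_numeral)
    moreover have "e * (real m)\<^sup>2 \<le> 1 / 8" using hm h8 by linarith
    ultimately show ?thesis
      using weight_asymp[OF e0, of m 0] False by (simp add: w_def)
  qed
  have ew: "exp (- D) \<le> w * exp (- (e * real m ^ 3 / 3) + b)" "w * exp (- (e * real m ^ 3 / 3) + b) \<le> exp D"
  proof -
    have "w * exp (- (e * real m ^ 3 / 3) + b) = exp (ln w - (e * real m ^ 3 / 3 - b))"
    proof -
      have "ln w - (e * real m ^ 3 / 3 - b) = ln w + (- (e * real m ^ 3 / 3) + b)" by simp
      then show ?thesis using lw by (simp only: exp_add[of "ln w"] exp_ln)
    qed
    then show "exp (- D) \<le> w * exp (- (e * real m ^ 3 / 3) + b)" "w * exp (- (e * real m ^ 3 / 3) + b) \<le> exp D"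
      using lw by (auto simp: abs_le_iff)
  qed
  define W where "W = (\<lambda>\<pi>. ln (peak_weight e n \<pi>) - e * real m ^ 3 / 3)"
  have pert: "\<bar>(- h * dev n \<pi> + h\<^sup>2 * real n * quad (peak_frac n \<pi>)) - W \<pi>\<bar> \<le> D" if "\<pi> \<in> C n" for \<pi>
  proof -
    let ?p = "peaks n \<pi>"
    have "\<bar>ln (peak_weight e n \<pi>) - (e * (real n ^ 3 / 3 - real ?p * (real n)\<^sup>2)
        + e\<^sup>2 * (- 3 / 10 * real n ^ 5 + 3 / 2 * real ?p * real n ^ 4 - 2 * (real ?p)\<^sup>2 * real n ^ 3))\<bar> \<le> D"
      using weight_asymp(2)[OF e0 _ peaks_bound[OF n that]] h8 unfolding peak_weight_def D_def he by simp
    moreover have "- h * dev n \<pi> = e * (real n ^ 3 / 3 - real ?p * (real n)\<^sup>2) - e * real m ^ 3 / 3"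
      unfolding he dev_def \<mu>_def am using nR by (simp add: field_simps eval_nat_numeral)
    moreover have "h\<^sup>2 * real n * quad (peak_frac n \<pi>)
       = e\<^sup>2 * (- 3 / 10 * real n ^ 5 + 3 / 2 * real ?p * real n ^ 4 - 2 * (real ?p)\<^sup>2 * real n ^ 3)"
      unfolding he quad_def peak_frac_def using nR by (simp add: field_simps eval_nat_numeral)
    ultimately show ?thesis unfolding W_def by linarith
  qed
  have W: "mean (C n) (\<lambda>\<pi>. exp (W \<pi>)) = exp (- (e * real m ^ 3 / 3)) * ((\<Sum>\<pi>\<in>C n. peak_weight e n \<pi>) / card (C n))"
  proof -
    have "mean (C n) (\<lambda>\<pi>. exp (W \<pi>)) = mean (C n) (\<lambda>\<pi>. exp (- (e * real m ^ 3 / 3)) * peak_weight e n \<pi>)"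
      unfolding mean_def
    proof (intro arg_cong2[where f = "(/)"] sum.cong refl)
      fix \<pi> assume "\<pi> \<in> C n"
      then have "peak_weight e n \<pi> > 0"
        using weight_asymp(1)[OF e0 _ peaks_bound[OF n]] h8 unfolding peak_weight_def he by simp
      moreover have "W \<pi> = - (e * real m ^ 3 / 3) + ln (peak_weight e n \<pi>)" by (simp add: W_def)
      ultimately show "exp (W \<pi>) = exp (- (e * real m ^ 3 / 3)) * peak_weight e n \<pi>"
        by (simp only: exp_add exp_ln)
    qed
    then show ?thesis by (simp add: mean_cmult) (simp add: mean_def)
  qed
  have split: "exp (- (e * real m ^ 3 / 3)) = exp (- (e * real m ^ 3 / 3) + b) * exp (- b)"
    by (simp add: mult_exp_exp)
  have DE: "D + D = E" by (simp add: D_def E_def)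
  have up: "mean (C n) (\<lambda>\<pi>. exp (W \<pi>)) \<le> exp (2 * h + sqrt h + D - b)"
  proof -
    have "(1 + \<delta>) ^ n \<le> exp \<delta> ^ n" using \<delta>0 by (intro power_mono exp_ge_add_one_self) auto
    also have "\<dots> = exp (2 * h + sqrt h)" by (simp add: exp_of_nat_mult[symmetric] nd)
    finally have 1: "(1 + \<delta>) ^ n \<le> exp (2 * h + sqrt h)" .
    have "mean (C n) (\<lambda>\<pi>. exp (W \<pi>)) \<le> exp (- (e * real m ^ 3 / 3)) * ((1 + \<delta>) ^ n * w)"
      unfolding W by (intro mult_left_mono b5(5)) auto
    also have "\<dots> = (1 + \<delta>) ^ n * (w * exp (- (e * real m ^ 3 / 3) + b)) * exp (- b)"
      unfolding split by (simp only: mult_ac)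
    also have "\<dots> \<le> exp (2 * h + sqrt h) * exp D * exp (- b)"
      using 1 ew(2) lw \<delta>0 by (intro mult_right_mono mult_mono) auto
    also have "\<dots> = exp (2 * h + sqrt h + D - b)" by (simp add: mult_exp_exp)
    finally show ?thesis .
  qed
  have lo: "(1 - (2 * h + sqrt h)) * exp (- D - b) \<le> mean (C n) (\<lambda>\<pi>. exp (W \<pi>))" if "2 * h + sqrt h \<le> 1"
  proof -
    have "(1 - (2 * h + sqrt h)) * exp (- D - b) = (1 - real n * \<delta>) * (exp (- D)) * exp (- b)"
      unfolding nd by (simp add: mult_exp_exp mult.assoc)
    also have "\<dots> \<le> (1 - real n * \<delta>) * (w * exp (- (e * real m ^ 3 / 3) + b)) * exp (- b)"
      using that ew(1) by (intro mult_right_mono mult_left_mono) (auto simp: nd)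
    also have "\<dots> = exp (- (e * real m ^ 3 / 3)) * ((1 - real n * \<delta>) * w)"
      unfolding split by (simp only: mult_ac)
    also have "\<dots> \<le> mean (C n) (\<lambda>\<pi>. exp (W \<pi>))"
      unfolding W by (intro mult_left_mono b5(6)) auto
    finally show ?thesis .
  qed
  note mp = mean_exp_perturb[of "C n", OF pert]
  have "M \<le> exp D * mean (C n) (\<lambda>\<pi>. exp (W \<pi>))" unfolding M_def by (rule mp(1))
  also have "\<dots> \<le> exp D * exp (2 * h + sqrt h + D - b)" by (intro mult_left_mono up) auto
  also have "\<dots> = exp (E + (2 * h + sqrt h) - b)" unfolding DE[symmetric] mult_exp_exp by (simp add: algebra_simps)
  finally show "M \<le> exp (E + (2 * h + sqrt h) - b)" .
  show "(1 - (2 * h + sqrt h)) * exp (- E - b) \<le> M"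
  proof (cases "2 * h + sqrt h \<le> 1")
    case True
    have "(1 - (2 * h + sqrt h)) * exp (- E - b) = exp (- D) * ((1 - (2 * h + sqrt h)) * exp (- D - b))"
    proof -
      have "exp (- E - b) = exp (- D) * exp (- D - b)"
        unfolding DE[symmetric] mult_exp_exp by (simp add: algebra_simps)
      then show ?thesis by (simp only: mult_ac)
    qed
    also have "\<dots> \<le> exp (- D) * mean (C n) (\<lambda>\<pi>. exp (W \<pi>))" by (intro mult_left_mono lo True) auto
    also have "\<dots> \<le> M" unfolding M_def by (rule mp(2))
    finally show ?thesis .
  next
    case False
    then have "(1 - (2 * h + sqrt h)) * exp (- E - b) \<le> 0" by (intro mult_nonpos_nonneg) auto
    moreover have "0 \<le> M" unfolding M_def by (rule mean_nonneg) simp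
    ultimately show ?thesis by linarith
  qed
qed

text \<open>Only tilts \<open>n ^ 2 / (2 * a) ^ 2\<close> with an integer \<open>a\<close> come from
  counting words. Rounding \<open>a\<close> up keeps \<open>h \<le> t\<close>, and the gap is small
  even after multiplication by \<open>n\<close>, the a priori bound on the deviation.\<close>

lemma rounding:
  assumes n: "n \<ge> 1" and t: "t > 0"
  defines "a \<equiv> nat \<lceil>real n / (2 * sqrt t)\<rceil>"
  defines "h \<equiv> (real n)\<^sup>2 / (2 * real a)\<^sup>2"
  shows "a \<ge> 1" "0 \<le> h" "h \<le> t" "real n * (t - h) \<le> 4 * t * sqrt t"
proof -
  define X where "X = real n / sqrt t"
  define A where "A = 2 * real a"
  have X: "X > 0" using n t by (simp add: X_def)
  have ra: "real a = of_int \<lceil>X / 2\<rceil>"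
  proof -
    have "a = nat \<lceil>X / 2\<rceil>" by (simp add: a_def X_def mult.commute)
    moreover have "0 \<le> \<lceil>X / 2\<rceil>" using X by (simp add: le_ceiling_iff)
    ultimately show ?thesis by simp
  qed
  have c: "X / 2 \<le> of_int \<lceil>X / 2\<rceil>" "of_int \<lceil>X / 2\<rceil> < X / 2 + 1"
    using ceiling_correct[of "X / 2"] by linarith+
  have A: "X \<le> A" "A \<le> X + 2" using c unfolding A_def ra by linarith+
  have A0: "A > 0" using A X by linarith
  then show "a \<ge> 1" by (simp add: A_def)
  show "0 \<le> h" by (simp add: h_def)
  have tX: "t = (real n)\<^sup>2 / X\<^sup>2" using n t by (simp add: X_def power_divide)
  show ht: "h \<le> t" unfolding h_def A_def[symmetric] tX
    using A X by (intro divide_left_mono power_mono) (auto intro!: mult_pos_pos)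
  have r1: "X / A \<le> 1" "0 \<le> X / A" using A A0 X by auto
  have "h = t * (X / A)\<^sup>2" unfolding h_def A_def[symmetric] tX using X by (simp add: power_divide)
  then have "t - h = t * ((1 - X / A) * (1 + X / A))" by (simp add: power2_eq_square algebra_simps)
  also have "\<dots> \<le> t * ((1 - X / A) * 2)" using r1 t by (intro mult_left_mono) auto
  also have "\<dots> \<le> t * (2 / X * 2)"
  proof -
    have "1 - X / A = (A - X) / A" using A0 by (simp add: diff_divide_distrib)
    also have "\<dots> \<le> 2 / X" using A A0 X by (intro frac_le) auto
    finally show ?thesis using t by (intro mult_left_mono mult_right_mono) auto
  qed
  finally have "real n * (t - h) \<le> real n * (t * (2 / X * 2))" by (intro mult_left_mono) auto
  also have "\<dots> = 4 * t * sqrt t" using n t by (simp add: X_def)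
  finally show "real n * (t - h) \<le> 4 * t * sqrt t" .
qed

section \<open>Limits of the tilted averages\<close>

lemma tilt_limit:
  assumes tpos: "\<And>n. n \<ge> 1 \<Longrightarrow> t n > 0" and t0: "t \<longlonglongrightarrow> 0" and ts: "(\<lambda>n. (t n)\<^sup>2 * real n) \<longlonglongrightarrow> \<sigma>"
  shows "(\<lambda>n. mean (C n) (\<lambda>\<pi>. exp (- t n * dev n \<pi> + (t n)\<^sup>2 * real n * quad (peak_frac n \<pi>))))
           \<longlonglongrightarrow> exp (- (3 / 10 * \<sigma> * \<alpha> ^ 5))"
proof -
  define a where "a = (\<lambda>n. nat \<lceil>real n / (2 * sqrt (t n))\<rceil>)"
  define h where "h = (\<lambda>n. (real n)\<^sup>2 / (2 * real (a n))\<^sup>2)"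
  have rd: "a n \<ge> 1" "0 \<le> h n" "h n \<le> t n" "real n * (t n - h n) \<le> 4 * t n * sqrt (t n)" if "n \<ge> 1" for n
    using rounding[OF that tpos[OF that]] unfolding a_def h_def by auto
  have ev: "eventually (\<lambda>n::nat. n \<ge> 1) sequentially" by (rule eventually_ge_at_top)
  have h0: "h \<longlonglongrightarrow> 0"
    by (rule tendsto_sandwich[OF _ _ tendsto_const t0]) (auto intro: eventually_mono[OF ev] rd)
  have sq0: "(\<lambda>n. sqrt (t n)) \<longlonglongrightarrow> 0" using tendsto_real_sqrt[OF t0] by simp
  have diff0: "(\<lambda>n. (t n)\<^sup>2 * real n - (h n)\<^sup>2 * real n) \<longlonglongrightarrow> 0"
  proof (rule tendsto_sandwich[OF _ _ tendsto_const])
    show "eventually (\<lambda>n. (t n)\<^sup>2 * real n - (h n)\<^sup>2 * real n \<le> (4 * t n * sqrt (t n)) * (2 * t n)) sequentially"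
      using ev
    proof eventually_elim
      case (elim n)
      have "(t n)\<^sup>2 * real n - (h n)\<^sup>2 * real n = (real n * (t n - h n)) * (t n + h n)"
        by (simp add: power2_eq_square algebra_simps)
      also have "\<dots> \<le> (4 * t n * sqrt (t n)) * (2 * t n)"
        by (intro mult_mono[OF rd(4)[OF elim]]) (use rd[OF elim] in auto)
      finally show ?case .
    qed
    show "eventually (\<lambda>n. 0 \<le> (t n)\<^sup>2 * real n - (h n)\<^sup>2 * real n) sequentially"
      using ev
    proof eventually_elim
      case (elim n)
      have "(h n)\<^sup>2 \<le> (t n)\<^sup>2" using rd[OF elim] by (intro power_mono) auto
      then show ?case by (simp add: mult_right_mono)
    qed
    have "(\<lambda>n. (4 * t n * sqrt (t n)) * (2 * t n)) \<longlonglongrightarrow> (4 * 0 * 0) * (2 * 0)"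
      by (intro tendsto_intros t0 sq0)
    then show "(\<lambda>n. (4 * t n * sqrt (t n)) * (2 * t n)) \<longlonglongrightarrow> 0" by simp
  qed
  have hs: "(\<lambda>n. (h n)\<^sup>2 * real n) \<longlonglongrightarrow> \<sigma>" using tendsto_diff[OF ts diff0] by simp
  have sqh: "(\<lambda>n. sqrt (h n)) \<longlonglongrightarrow> 0" using tendsto_real_sqrt[OF h0] by simp
  define E where "E = (\<lambda>n. 10 * real n * h n ^ 3 + 60 * h n)"
  define b where "b = (\<lambda>n. 3 / 10 * ((h n)\<^sup>2 * real n) * alpha1 n (C n) ^ 5)"
  have E0: "E \<longlonglongrightarrow> 0"
  proof -
    have "(\<lambda>n. 10 * ((h n)\<^sup>2 * real n) * h n + 60 * h n) \<longlonglongrightarrow> 10 * \<sigma> * 0 + 60 * 0"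
      by (intro tendsto_intros hs h0)
    then show ?thesis unfolding E_def by (simp add: power2_eq_square power3_eq_cube mult_ac)
  qed
  have blim: "b \<longlonglongrightarrow> 3 / 10 * \<sigma> * \<alpha> ^ 5" unfolding b_def by (intro tendsto_intros hs lim)
  define \<eta> where "\<eta> = (\<lambda>n. 4 * t n * sqrt (t n) + 2 * ((t n)\<^sup>2 * real n - (h n)\<^sup>2 * real n))"
  have eta0: "\<eta> \<longlonglongrightarrow> 0"
  proof -
    have "\<eta> \<longlonglongrightarrow> 4 * 0 * 0 + 2 * 0" unfolding \<eta>_def by (intro tendsto_intros t0 sq0 diff0)
    then show ?thesis by simp
  qed
  define Mt where "Mt = (\<lambda>n. mean (C n) (\<lambda>\<pi>. exp (- t n * dev n \<pi> + (t n)\<^sup>2 * real n * quad (peak_frac n \<pi>))))"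
  define Mh where "Mh = (\<lambda>n. mean (C n) (\<lambda>\<pi>. exp (- h n * dev n \<pi> + (h n)\<^sup>2 * real n * quad (peak_frac n \<pi>))))"
  have pert: "Mt n \<le> exp (\<eta> n) * Mh n" "exp (- \<eta> n) * Mh n \<le> Mt n" if n: "n \<ge> 1" for n
  proof -
    have p: "\<bar>(- t n * dev n \<pi> + (t n)\<^sup>2 * real n * quad (peak_frac n \<pi>))
       - (- h n * dev n \<pi> + (h n)\<^sup>2 * real n * quad (peak_frac n \<pi>))\<bar> \<le> \<eta> n" if pi: "\<pi> \<in> C n" for \<pi>
    proof -
      have eq: "(- t n * dev n \<pi> + (t n)\<^sup>2 * real n * quad (peak_frac n \<pi>)) - (- h n * dev n \<pi> + (h n)\<^sup>2 * real n * quad (peak_frac n \<pi>))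
        = (h n - t n) * dev n \<pi> + ((t n)\<^sup>2 * real n - (h n)\<^sup>2 * real n) * quad (peak_frac n \<pi>)"
        by (simp add: algebra_simps)
      have "\<bar>(h n - t n) * dev n \<pi>\<bar> \<le> (t n - h n) * real n"
        unfolding abs_mult using rd[OF n] dev_bound[OF n pi] by (intro mult_mono) auto
      moreover have "(h n)\<^sup>2 \<le> (t n)\<^sup>2" using rd[OF n] by (intro power_mono) auto
      then have "0 \<le> (t n)\<^sup>2 * real n - (h n)\<^sup>2 * real n" by (simp add: mult_right_mono)
      then have "\<bar>((t n)\<^sup>2 * real n - (h n)\<^sup>2 * real n) * quad (peak_frac n \<pi>)\<bar> \<le> ((t n)\<^sup>2 * real n - (h n)\<^sup>2 * real n) * 2"
        unfolding abs_mult using quad_bound[OF frac_bounds[OF n pi]] by (intro mult_mono) auto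
      ultimately show ?thesis unfolding eq \<eta>_def using rd(4)[OF n] by (simp add: mult.commute)
    qed
    show "Mt n \<le> exp (\<eta> n) * Mh n" "exp (- \<eta> n) * Mh n \<le> Mt n"
      unfolding Mt_def Mh_def using mean_exp_perturb[of "C n", OF p] by auto
  qed
  have h8: "eventually (\<lambda>n. h n \<le> 1 / 8) sequentially"
    using order_tendstoD(2)[OF h0, of "1 / 8"] by (auto elim: eventually_mono)
  have "Mt \<longlonglongrightarrow> exp (- (3 / 10 * \<sigma> * \<alpha> ^ 5))"
  proof (rule tendsto_sandwich)
    show "eventually (\<lambda>n. exp (- \<eta> n) * ((1 - (2 * h n + sqrt (h n))) * exp (- E n - b n)) \<le> Mt n) sequentially"
      using ev h8
    proof eventually_elim
      case (elim n)
      have "(1 - (2 * h n + sqrt (h n))) * exp (- E n - b n) \<le> Mh n"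
        unfolding Mh_def E_def b_def by (rule mean_exp_bounds(2)[OF elim(1) rd(1)[OF elim(1)] _ elim(2)]) (simp add: h_def)
      then have "exp (- \<eta> n) * ((1 - (2 * h n + sqrt (h n))) * exp (- E n - b n)) \<le> exp (- \<eta> n) * Mh n"
        by (intro mult_left_mono) auto
      then show ?case using pert(2)[OF elim(1)] by linarith
    qed
    show "eventually (\<lambda>n. Mt n \<le> exp (\<eta> n) * exp (E n + (2 * h n + sqrt (h n)) - b n)) sequentially"
      using ev h8
    proof eventually_elim
      case (elim n)
      have "Mh n \<le> exp (E n + (2 * h n + sqrt (h n)) - b n)"
        unfolding Mh_def E_def b_def by (rule mean_exp_bounds(1)[OF elim(1) rd(1)[OF elim(1)] _ elim(2)]) (simp add: h_def)
      then have "exp (\<eta> n) * Mh n \<le> exp (\<eta> n) * exp (E n + (2 * h n + sqrt (h n)) - b n)"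
        by (intro mult_left_mono) auto
      then show ?case using pert(1)[OF elim(1)] by linarith
    qed
    have "(\<lambda>n. exp (- \<eta> n) * ((1 - (2 * h n + sqrt (h n))) * exp (- E n - b n)))
       \<longlonglongrightarrow> exp (- 0) * ((1 - (2 * 0 + 0)) * exp (- 0 - 3 / 10 * \<sigma> * \<alpha> ^ 5))"
      by (intro tendsto_intros eta0 h0 sqh E0 blim)
    then show "(\<lambda>n. exp (- \<eta> n) * ((1 - (2 * h n + sqrt (h n))) * exp (- E n - b n)))
       \<longlonglongrightarrow> exp (- (3 / 10 * \<sigma> * \<alpha> ^ 5))" by simp
    have "(\<lambda>n. exp (\<eta> n) * exp (E n + (2 * h n + sqrt (h n)) - b n))
       \<longlonglongrightarrow> exp 0 * exp (0 + (2 * 0 + 0) - 3 / 10 * \<sigma> * \<alpha> ^ 5)"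
      by (intro tendsto_intros eta0 h0 sqh E0 blim)
    then show "(\<lambda>n. exp (\<eta> n) * exp (E n + (2 * h n + sqrt (h n)) - b n))
       \<longlonglongrightarrow> exp (- (3 / 10 * \<sigma> * \<alpha> ^ 5))" by simp
  qed
  then show ?thesis by (simp add: Mt_def)
qed

text \<open>The case \<open>t = \<tau> / n\<close> of \<open>tilt_limit\<close>, with limit
  parameter 0: at this scale the quadratic term vanishes and only the deviation of the peak fraction
  from \<open>\<mu> n\<close> is left in the exponent.\<close>

lemma concentration_laplace:
  assumes "\<tau> > 0"
  shows "(\<lambda>n. mean (C n) (\<lambda>\<pi>. exp (- \<tau> * (peak_frac n \<pi> - \<mu> n)))) \<longlonglongrightarrow> 1"
proof -
  have ev: "eventually (\<lambda>n::nat. n \<ge> 1) sequentially" by (rule eventually_ge_at_top)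
  have inv0: "(\<lambda>n. 1 / real n) \<longlonglongrightarrow> 0" by (rule lim_1_over_n)
  define t where "t = (\<lambda>n. \<tau> / real n)"
  have t0: "t \<longlonglongrightarrow> 0" using tendsto_mult_left[OF inv0, of \<tau>] by (simp add: t_def)
  have sq: "(t n)\<^sup>2 * real n = \<tau>\<^sup>2 * (1 / real n)" for n
    by (cases "n = 0") (auto simp: t_def power2_eq_square)
  have ts: "(\<lambda>n. (t n)\<^sup>2 * real n) \<longlonglongrightarrow> 0"
    unfolding sq using tendsto_mult_left[OF inv0, of "\<tau>\<^sup>2"] by simp
  define M where "M = (\<lambda>n. mean (C n) (\<lambda>\<pi>. exp (- t n * dev n \<pi> + (t n)\<^sup>2 * real n * quad (peak_frac n \<pi>))))"
  define Y where "Y = (\<lambda>n. mean (C n) (\<lambda>\<pi>. exp (- \<tau> * (peak_frac n \<pi> - \<mu> n))))"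
  have Mlim: "M \<longlonglongrightarrow> 1"
    using tilt_limit[of t 0, OF _ t0 ts] assms by (simp add: M_def t_def)
  have eta: "(\<lambda>n. 2 * ((t n)\<^sup>2 * real n)) \<longlonglongrightarrow> 0" using tendsto_mult_left[OF ts, of 2] by simp
  have pert: "Y n \<le> exp (2 * ((t n)\<^sup>2 * real n)) * M n" "exp (- (2 * ((t n)\<^sup>2 * real n))) * M n \<le> Y n" if n: "n \<ge> 1" for n
  proof -
    have p: "\<bar>- \<tau> * (peak_frac n \<pi> - \<mu> n) - (- t n * dev n \<pi> + (t n)\<^sup>2 * real n * quad (peak_frac n \<pi>))\<bar> \<le> 2 * ((t n)\<^sup>2 * real n)"
      if pi: "\<pi> \<in> C n" for \<pi>
    proof -
      have "t n * dev n \<pi> = \<tau> * (peak_frac n \<pi> - \<mu> n)" using n by (simp add: t_def dev_frac)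
      then have eq: "- \<tau> * (peak_frac n \<pi> - \<mu> n) - (- t n * dev n \<pi> + (t n)\<^sup>2 * real n * quad (peak_frac n \<pi>))
         = - ((t n)\<^sup>2 * real n * quad (peak_frac n \<pi>))" by simp
      have "(t n)\<^sup>2 * real n * \<bar>quad (peak_frac n \<pi>)\<bar> \<le> (t n)\<^sup>2 * real n * 2"
        using quad_bound[OF frac_bounds[OF n pi]] by (intro mult_left_mono) auto
      then show ?thesis unfolding eq by (simp add: abs_mult)
    qed
    show "Y n \<le> exp (2 * ((t n)\<^sup>2 * real n)) * M n" "exp (- (2 * ((t n)\<^sup>2 * real n))) * M n \<le> Y n"
      unfolding Y_def M_def using mean_exp_perturb[of "C n", OF p] by auto
  qed
  have "Y \<longlonglongrightarrow> 1"
  proof (rule tendsto_sandwich)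
    show "eventually (\<lambda>n. exp (- (2 * ((t n)\<^sup>2 * real n))) * M n \<le> Y n) sequentially"
      using ev by eventually_elim (rule pert)
    show "eventually (\<lambda>n. Y n \<le> exp (2 * ((t n)\<^sup>2 * real n)) * M n) sequentially"
      using ev by eventually_elim (rule pert)
    have "(\<lambda>n. exp (- (2 * ((t n)\<^sup>2 * real n))) * M n) \<longlonglongrightarrow> exp (- 0) * 1" by (intro tendsto_intros eta Mlim)
    then show "(\<lambda>n. exp (- (2 * ((t n)\<^sup>2 * real n))) * M n) \<longlonglongrightarrow> 1" by simp
    have "(\<lambda>n. exp (2 * ((t n)\<^sup>2 * real n)) * M n) \<longlonglongrightarrow> exp 0 * 1" by (intro tendsto_intros eta Mlim)
    then show "(\<lambda>n. exp (2 * ((t n)\<^sup>2 * real n)) * M n) \<longlonglongrightarrow> 1" by simp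
  qed
  then show ?thesis by (simp add: Y_def)
qed

lemma second_moment_limit: "(\<lambda>n. mean (C n) (\<lambda>\<pi>. (peak_frac n \<pi> - \<mu> n)\<^sup>2)) \<longlonglongrightarrow> 0"
proof -
  have ev: "eventually (\<lambda>n::nat. n \<ge> 1) sequentially" by (rule eventually_ge_at_top)
  define Y where "Y = (\<lambda>\<tau> n. mean (C n) (\<lambda>\<pi>. exp (- \<tau> * (peak_frac n \<pi> - \<mu> n))))"
  \<comment> \<open>Only positive tilts are available, so the square is dominated by a combination
    of two of them. With \<open>u = exp (- y)\<close> it is
    \<open>u ^ 4 - 4 * u + 3 = (u - 1) ^ 2 * (u ^ 2 + 2 * u + 3)\<close>, a double zero at
    \<open>y = 0\<close>, and its mean tends to \<open>1 - 4 + 3 = 0\<close>. The bound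
    \<open>y \<le> 1\<close> yields
    \<open>\<bar>y\<bar> \<le> 2 * \<bar>u - 1\<bar>\<close>.\<close>
  have pw: "y\<^sup>2 \<le> 4 / 3 * (exp (- 4 * y) - 4 * exp (- 1 * y) + 3)" if "y \<le> 1" for y :: real
  proof -
    define u where "u = exp (- y)"
    have u0: "u > 0" by (simp add: u_def)
    have "exp (- 4 * y) = u ^ 4" by (simp add: u_def exp_of_nat_mult[symmetric])
    then have k: "exp (- 4 * y) - 4 * exp (- 1 * y) + 3 = (u - 1)\<^sup>2 * (u\<^sup>2 + 2 * u + 3)"
      by (simp add: u_def[symmetric] power2_eq_square algebra_simps eval_nat_numeral)
    have "(u - 1)\<^sup>2 * 3 \<le> (u - 1)\<^sup>2 * (u\<^sup>2 + 2 * u + 3)" using u0 by (intro mult_left_mono) auto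
    moreover have "y\<^sup>2 \<le> 4 * (u - 1)\<^sup>2"
    proof -
      have "\<bar>y\<bar> \<le> \<bar>2 * (u - 1)\<bar>"
      proof (cases "y \<ge> 0")
        case True
        have "exp (- y) * (1 + y) \<le> exp (- y) * exp y" by (intro mult_left_mono exp_ge_add_one_self) auto
        then have "u * (1 + y) \<le> 1" by (simp add: u_def mult_exp_exp)
        then have "u \<le> 1 / (1 + y)" using True by (simp add: pos_le_divide_eq)
        also have "\<dots> \<le> 1 - y / 2"
        proof -
          have "y * y \<le> 1 * y" using that True by (intro mult_right_mono)
          then have "1 \<le> (1 - y / 2) * (1 + y)" by (simp add: algebra_simps)
          then show ?thesis using True by (simp add: pos_divide_le_eq)
        qed
        finally have "y \<le> 2 * (1 - u)" by simp
        then show ?thesis using True by (simp add: abs_if)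
      next
        case False
        have "1 + (- y) \<le> u" unfolding u_def by (rule exp_ge_add_one_self)
        then show ?thesis using False by (simp add: abs_if)
      qed
      then have "y\<^sup>2 \<le> (2 * (u - 1))\<^sup>2" by (rule abs_le_square_iff[THEN iffD1])
      then show ?thesis unfolding power_mult_distrib by simp
    qed
    ultimately show ?thesis unfolding k by simp
  qed
  show ?thesis
  proof (rule tendsto_sandwich[OF _ _ tendsto_const])
    show "eventually (\<lambda>n. 0 \<le> mean (C n) (\<lambda>\<pi>. (peak_frac n \<pi> - \<mu> n)\<^sup>2)) sequentially"
      by (auto intro!: mean_nonneg always_eventually)
    show "eventually (\<lambda>n. mean (C n) (\<lambda>\<pi>. (peak_frac n \<pi> - \<mu> n)\<^sup>2) \<le> 4 / 3 * (Y 4 n - 4 * Y 1 n + 3)) sequentially"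
      using ev
    proof eventually_elim
      case (elim n)
      have "mean (C n) (\<lambda>\<pi>. (peak_frac n \<pi> - \<mu> n)\<^sup>2)
         \<le> mean (C n) (\<lambda>\<pi>. 4 / 3 * (exp (- 4 * (peak_frac n \<pi> - \<mu> n)) - 4 * exp (- 1 * (peak_frac n \<pi> - \<mu> n)) + 3))"
      proof (rule mean_mono)
        fix \<pi> assume pi: "\<pi> \<in> C n"
        have "peak_frac n \<pi> - \<mu> n \<le> 1" using frac_bounds(2)[OF elim pi] mu_bounds(1)[OF elim] by linarith
        then show "(peak_frac n \<pi> - \<mu> n)\<^sup>2 \<le> 4 / 3 * (exp (- 4 * (peak_frac n \<pi> - \<mu> n)) - 4 * exp (- 1 * (peak_frac n \<pi> - \<mu> n)) + 3)" by (rule pw)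
      qed
      also have "\<dots> = 4 / 3 * (Y 4 n - 4 * Y 1 n + 3)"
        unfolding Y_def by (simp only: mean_cmult mean_add mean_diff mean_const[OF finite_C[OF elim] C_nonempty[OF elim]])
      finally show ?case .
    qed
    have "(\<lambda>n. 4 / 3 * (Y 4 n - 4 * Y 1 n + 3)) \<longlonglongrightarrow> 4 / 3 * (1 - 4 * 1 + 3)"
      unfolding Y_def by (intro tendsto_intros concentration_laplace) auto
    then show "(\<lambda>n. 4 / 3 * (Y 4 n - 4 * Y 1 n + 3)) \<longlonglongrightarrow> 0" by simp
  qed
qed

text \<open>At \<open>t = s / sqrt n\<close> the exponent still contains the random term
  \<open>s ^ 2 * quad (peak_frac n \<pi>)\<close>. Concentration allows
  \<open>quad (\<mu> n)\<close> in its place, a constant that can be divided out. The exponent of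
  the limit is then \<open>- s ^ 2 * (quad x0 + 3 / 10 * \<alpha> ^ 5)\<close>.\<close>

lemma laplace_limit:
  assumes s: "s > 0"
  shows "(\<lambda>n. mean (C n) (\<lambda>\<pi>. exp (- s * (dev n \<pi> / sqrt (real n)))))
     \<longlonglongrightarrow> exp (s\<^sup>2 * (2 / 45 + 1 / 9 * \<alpha> ^ 3 - 3 / 5 * \<alpha> ^ 5 + 4 / 9 * \<alpha> ^ 6) / 2)"
proof -
  have ev: "eventually (\<lambda>n::nat. n \<ge> 1) sequentially" by (rule eventually_ge_at_top)
  define Z where "Z = (\<lambda>n \<pi>. dev n \<pi> / sqrt (real n))"
  define Y where "Y = (\<lambda>n \<pi>. peak_frac n \<pi> - \<mu> n)"
  have tilted: "(\<lambda>n. mean (C n) (\<lambda>\<pi>. exp (- s * Z n \<pi> + s\<^sup>2 * quad (peak_frac n \<pi>)))) \<longlonglongrightarrow> exp (- (3 / 10 * s\<^sup>2 * \<alpha> ^ 5))"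
    if "s > 0" for s
  proof -
    define t where "t = (\<lambda>n. s / sqrt (real n))"
    have "(\<lambda>n. 1 / sqrt (real n)) \<longlonglongrightarrow> 0"
      using tendsto_real_sqrt[OF lim_1_over_n[where 'a = real]] by (simp add: real_sqrt_divide)
    then have t0: "t \<longlonglongrightarrow> 0" using tendsto_mult_left[of "\<lambda>n. 1 / sqrt (real n)" 0 sequentially s] by (simp add: t_def)
    have sq: "(t n)\<^sup>2 * real n = s\<^sup>2" if "n \<ge> 1" for n using that by (simp add: t_def power_divide)
    have ts: "(\<lambda>n. (t n)\<^sup>2 * real n) \<longlonglongrightarrow> s\<^sup>2"
      by (rule tendsto_eventually[OF eventually_mono[OF ev sq]])
    have "(\<lambda>n. mean (C n) (\<lambda>\<pi>. exp (- t n * dev n \<pi> + (t n)\<^sup>2 * real n * quad (peak_frac n \<pi>)))) \<longlonglongrightarrow> exp (- (3 / 10 * s\<^sup>2 * \<alpha> ^ 5))"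
      by (rule tilt_limit[OF _ t0 ts]) (use that in \<open>simp add: t_def\<close>)
    moreover have "eventually (\<lambda>n. mean (C n) (\<lambda>\<pi>. exp (- t n * dev n \<pi> + (t n)\<^sup>2 * real n * quad (peak_frac n \<pi>)))
       = mean (C n) (\<lambda>\<pi>. exp (- s * Z n \<pi> + s\<^sup>2 * quad (peak_frac n \<pi>)))) sequentially"
      using ev by eventually_elim (simp add: sq, simp add: t_def Z_def)
    ultimately show ?thesis by (rule Lim_transform_eventually)
  qed
  \<comment> \<open>The remainder \<open>R\<close> is split into a square of
    \<open>exp (- s * Z)\<close> and a square of the deviation; the former is the transform at
    \<open>2 * s\<close>, bounded because \<open>quad\<close> is.\<close>
  have bdd: "\<exists>B. \<forall>n\<ge>1. mean (C n) (\<lambda>\<pi>. exp (- (2 * s) * Z n \<pi>)) \<le> B"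
  proof -
    have "Bseq (\<lambda>n. mean (C n) (\<lambda>\<pi>. exp (- (2 * s) * Z n \<pi> + (2 * s)\<^sup>2 * quad (peak_frac n \<pi>))))"
      using convergentI[OF tilted[of "2 * s"]] s by (intro convergent_imp_Bseq) auto
    then obtain B where B: "\<And>n. norm (mean (C n) (\<lambda>\<pi>. exp (- (2 * s) * Z n \<pi> + (2 * s)\<^sup>2 * quad (peak_frac n \<pi>)))) \<le> B"
      unfolding Bseq_def by blast
    have "mean (C n) (\<lambda>\<pi>. exp (- (2 * s) * Z n \<pi>)) \<le> exp ((2 * s)\<^sup>2 * 2) * B" if n: "n \<ge> 1" for n
    proof -
      have "mean (C n) (\<lambda>\<pi>. exp (- (2 * s) * Z n \<pi>))
         \<le> exp ((2 * s)\<^sup>2 * 2) * mean (C n) (\<lambda>\<pi>. exp (- (2 * s) * Z n \<pi> + (2 * s)\<^sup>2 * quad (peak_frac n \<pi>)))"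
      proof (rule mean_exp_perturb(1))
        fix \<pi> assume pi: "\<pi> \<in> C n"
        have "(2 * s)\<^sup>2 * \<bar>quad (peak_frac n \<pi>)\<bar> \<le> (2 * s)\<^sup>2 * 2"
          using quad_bound[OF frac_bounds[OF n pi]] by (intro mult_left_mono) auto
        then show "\<bar>- (2 * s) * Z n \<pi> - (- (2 * s) * Z n \<pi> + (2 * s)\<^sup>2 * quad (peak_frac n \<pi>))\<bar> \<le> (2 * s)\<^sup>2 * 2"
          by (simp add: abs_mult)
      qed
      also have "\<dots> \<le> exp ((2 * s)\<^sup>2 * 2) * B" using B[of n] by (intro mult_left_mono) auto
      finally show ?thesis .
    qed
    then show ?thesis by blast
  qed
  then obtain B where B: "\<And>n. n \<ge> 1 \<Longrightarrow> mean (C n) (\<lambda>\<pi>. exp (- (2 * s) * Z n \<pi>)) \<le> B" by blast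
  define V where "V = (\<lambda>n. mean (C n) (\<lambda>\<pi>. (Y n \<pi>)\<^sup>2))"
  have V0: "V \<longlonglongrightarrow> 0" using second_moment_limit by (simp add: V_def Y_def)
  have Vn: "0 \<le> V n" for n unfolding V_def by (rule mean_nonneg) simp
  \<comment> \<open>From the Lipschitz constant 3 of \<open>quad\<close> and \<open>\<bar>exp r -
    1\<bar> \<le> \<bar>r\<bar> * exp \<bar>r\<bar>\<close>, where
    \<open>\<bar>r\<bar> \<le> 3 * s ^ 2\<close>.\<close>
  define D where "D = 3 * s\<^sup>2 * exp (3 * s\<^sup>2)"
  have D0: "D \<ge> 0" by (simp add: D_def)
  define r where "r = (\<lambda>n \<pi>. s\<^sup>2 * (quad (peak_frac n \<pi>) - quad (\<mu> n)))"
  define R where "R = (\<lambda>n. mean (C n) (\<lambda>\<pi>. exp (- s * Z n \<pi>) * (exp (r n \<pi>) - 1)))"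
  \<comment> \<open>The weight that balances the two squares: \<open>\<eta>\<close> tends to 0 and
    \<open>V / \<eta>\<close> is at most \<open>sqrt V\<close>. The summand \<open>1 / n\<close>
    keeps it positive when the second moment vanishes.\<close>
  define \<eta> where "\<eta> = (\<lambda>n. sqrt (V n) + 1 / real n)"
  have eta0: "\<eta> \<longlonglongrightarrow> 0"
  proof -
    have "\<eta> \<longlonglongrightarrow> sqrt 0 + 0" unfolding \<eta>_def by (intro tendsto_intros tendsto_real_sqrt V0 lim_1_over_n)
    then show ?thesis by simp
  qed
  have Rbound: "\<bar>R n\<bar> \<le> D / 2 * (\<eta> n * B + sqrt (V n))" if n: "n \<ge> 1" for n
  proof -
    have en: "\<eta> n > 0" using n Vn[of n] by (auto simp: \<eta>_def intro!: add_nonneg_pos)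
    have "\<bar>R n\<bar> \<le> mean (C n) (\<lambda>\<pi>. \<bar>exp (- s * Z n \<pi>) * (exp (r n \<pi>) - 1)\<bar>)" unfolding R_def by (rule mean_abs)
    also have "\<dots> \<le> mean (C n) (\<lambda>\<pi>. D / 2 * (\<eta> n * exp (- (2 * s) * Z n \<pi>) + 1 / \<eta> n * (Y n \<pi>)\<^sup>2))"
    proof (rule mean_mono)
      fix \<pi> assume pi: "\<pi> \<in> C n"
      define y where "y = \<bar>Y n \<pi>\<bar>"
      have y: "0 \<le> y" "y \<le> 1" using frac_bounds[OF n pi] mu_bounds[OF n] unfolding y_def Y_def by linarith+
      have rb: "\<bar>r n \<pi>\<bar> \<le> 3 * s\<^sup>2 * y"
      proof -
        have "s\<^sup>2 * \<bar>quad (peak_frac n \<pi>) - quad (\<mu> n)\<bar> \<le> s\<^sup>2 * (3 * y)"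
          unfolding y_def Y_def using quad_lipschitz frac_bounds[OF n pi] mu_bounds[OF n] by (intro mult_left_mono) auto
        then show ?thesis by (simp add: r_def abs_mult)
      qed
      have "\<bar>exp (r n \<pi>) - 1\<bar> \<le> \<bar>r n \<pi>\<bar> * exp \<bar>r n \<pi>\<bar>"
      proof (cases "r n \<pi> \<ge> 0")
        case True
        have "1 + (- r n \<pi>) \<le> exp (- r n \<pi>)" by (rule exp_ge_add_one_self)
        then have "(1 - r n \<pi>) * exp (r n \<pi>) \<le> exp (- r n \<pi>) * exp (r n \<pi>)" by (intro mult_right_mono) auto
        then have "exp (r n \<pi>) - 1 \<le> r n \<pi> * exp (r n \<pi>)" by (simp add: algebra_simps mult_exp_exp)
        then show ?thesis using True by simp
      next
        case False
        have "1 + r n \<pi> \<le> exp (r n \<pi>)" by (rule exp_ge_add_one_self)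
        moreover have "- r n \<pi> * 1 \<le> - r n \<pi> * exp (- r n \<pi>)" using False by (intro mult_left_mono) auto
        ultimately have "1 - exp (r n \<pi>) \<le> - r n \<pi> * exp (- r n \<pi>)" by linarith
        moreover have "\<bar>exp (r n \<pi>) - 1\<bar> = 1 - exp (r n \<pi>)" "\<bar>r n \<pi>\<bar> = - r n \<pi>" using False by auto
        ultimately show ?thesis by (simp only:)
      qed
      also have "\<dots> \<le> (3 * s\<^sup>2 * y) * exp (3 * s\<^sup>2)"
      proof (rule mult_mono[OF rb])
        have "3 * s\<^sup>2 * y \<le> 3 * s\<^sup>2 * 1" using y by (intro mult_left_mono) auto
        then show "exp \<bar>r n \<pi>\<bar> \<le> exp (3 * s\<^sup>2)" using rb by simp
      qed (use y in auto)
      finally have er: "\<bar>exp (r n \<pi>) - 1\<bar> \<le> D * y" by (simp add: D_def mult_ac)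
      define u where "u = exp (- s * Z n \<pi>)"
      have u0: "u > 0" by (simp add: u_def)
      have uu: "exp (- (2 * s) * Z n \<pi>) = u\<^sup>2" by (simp add: u_def exp_double[symmetric] mult.assoc)
      have "\<bar>u * (exp (r n \<pi>) - 1)\<bar> \<le> u * (D * y)"
        unfolding abs_mult using er u0 by (intro mult_mono) auto
      also have "\<dots> = D * (u * y)" by (simp add: mult_ac)
      also have "\<dots> \<le> D * ((\<eta> n * u\<^sup>2 + 1 / \<eta> n * y\<^sup>2) / 2)"
      proof (rule mult_left_mono[OF _ D0])
        have "0 \<le> (\<eta> n * u - y)\<^sup>2 / \<eta> n" using en by simp
        also have "\<dots> = \<eta> n * u\<^sup>2 + 1 / \<eta> n * y\<^sup>2 - 2 * (u * y)"
          using en by (simp add: field_simps power2_eq_square)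
        finally show "u * y \<le> (\<eta> n * u\<^sup>2 + 1 / \<eta> n * y\<^sup>2) / 2" by simp
      qed
      finally show "\<bar>exp (- s * Z n \<pi>) * (exp (r n \<pi>) - 1)\<bar>
         \<le> D / 2 * (\<eta> n * exp (- (2 * s) * Z n \<pi>) + 1 / \<eta> n * (Y n \<pi>)\<^sup>2)"
        unfolding uu u_def[symmetric] by (simp add: y_def)
    qed
    also have "\<dots> = D / 2 * (\<eta> n * mean (C n) (\<lambda>\<pi>. exp (- (2 * s) * Z n \<pi>)) + 1 / \<eta> n * V n)"
      unfolding V_def by (simp only: mean_cmult mean_add)
    also have "\<dots> \<le> D / 2 * (\<eta> n * B + sqrt (V n))"
    proof (intro mult_left_mono add_mono B n)
      have "sqrt (V n) * sqrt (V n) \<le> sqrt (V n) * \<eta> n"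
        using Vn[of n] by (intro mult_left_mono) (auto simp: \<eta>_def)
      then have "V n \<le> sqrt (V n) * \<eta> n" using Vn[of n] by simp
      then show "1 / \<eta> n * V n \<le> sqrt (V n)" using en by (simp add: field_simps)
    qed (use en D0 in auto)
    finally show ?thesis .
  qed
  have R0: "R \<longlonglongrightarrow> 0"
  proof (rule tendsto_rabs_zero_cancel, rule tendsto_sandwich[OF _ _ tendsto_const])
    show "eventually (\<lambda>n. \<bar>R n\<bar> \<le> D / 2 * (\<eta> n * B + sqrt (V n))) sequentially"
      using ev by eventually_elim (rule Rbound)
    have "(\<lambda>n. D / 2 * (\<eta> n * B + sqrt (V n))) \<longlonglongrightarrow> D / 2 * (0 * B + sqrt 0)"
      by (intro tendsto_intros eta0 tendsto_real_sqrt V0)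
    then show "(\<lambda>n. D / 2 * (\<eta> n * B + sqrt (V n))) \<longlonglongrightarrow> 0" by simp
  qed simp
  define x0 where "x0 = (1 - \<alpha> ^ 3) / 3"
  have mulim: "\<mu> \<longlonglongrightarrow> x0" unfolding \<mu>_def x0_def by (intro tendsto_intros lim) auto
  have qlim: "(\<lambda>n. quad (\<mu> n)) \<longlonglongrightarrow> quad x0" unfolding quad_def by (intro tendsto_intros mulim)
  have eq: "mean (C n) (\<lambda>\<pi>. exp (- s * Z n \<pi>))
     = exp (- (s\<^sup>2 * quad (\<mu> n))) * mean (C n) (\<lambda>\<pi>. exp (- s * Z n \<pi> + s\<^sup>2 * quad (peak_frac n \<pi>))) - R n" for n
  proof -
    have pw: "exp (- s * Z n \<pi>) = exp (- (s\<^sup>2 * quad (\<mu> n))) * exp (- s * Z n \<pi> + s\<^sup>2 * quad (peak_frac n \<pi>))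
        - exp (- s * Z n \<pi>) * (exp (r n \<pi>) - 1)" for \<pi>
    proof -
      have "exp (- (s\<^sup>2 * quad (\<mu> n))) * exp (- s * Z n \<pi> + s\<^sup>2 * quad (peak_frac n \<pi>)) = exp (- s * Z n \<pi>) * exp (r n \<pi>)"
        unfolding mult_exp_exp r_def by (simp add: algebra_simps)
      then show ?thesis by (simp add: algebra_simps)
    qed
    have "mean (C n) (\<lambda>\<pi>. exp (- s * Z n \<pi>)) = mean (C n) (\<lambda>\<pi>. exp (- (s\<^sup>2 * quad (\<mu> n))) * exp (- s * Z n \<pi> + s\<^sup>2 * quad (peak_frac n \<pi>))
        - exp (- s * Z n \<pi>) * (exp (r n \<pi>) - 1))" 
      unfolding mean_def by (intro arg_cong2[where f = "(/)"] sum.cong refl pw)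
    then show ?thesis by (simp only: mean_diff mean_cmult R_def)
  qed
  have "(\<lambda>n. exp (- (s\<^sup>2 * quad (\<mu> n))) * mean (C n) (\<lambda>\<pi>. exp (- s * Z n \<pi> + s\<^sup>2 * quad (peak_frac n \<pi>))) - R n)
     \<longlonglongrightarrow> exp (- (s\<^sup>2 * quad x0)) * exp (- (3 / 10 * s\<^sup>2 * \<alpha> ^ 5)) - 0"
    by (intro tendsto_intros qlim tilted[OF s] R0)
  then have "(\<lambda>n. mean (C n) (\<lambda>\<pi>. exp (- s * Z n \<pi>))) \<longlonglongrightarrow> exp (- (s\<^sup>2 * quad x0)) * exp (- (3 / 10 * s\<^sup>2 * \<alpha> ^ 5)) - 0"
    unfolding eq .
  moreover have "exp (- (s\<^sup>2 * quad x0)) * exp (- (3 / 10 * s\<^sup>2 * \<alpha> ^ 5)) - 0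
    = exp (s\<^sup>2 * (2 / 45 + 1 / 9 * \<alpha> ^ 3 - 3 / 5 * \<alpha> ^ 5 + 4 / 9 * \<alpha> ^ 6) / 2)"
    unfolding mult_exp_exp quad_def x0_def by (simp add: field_simps eval_nat_numeral)
  ultimately show ?thesis by (simp add: Z_def)
qed

end

section \<open>Characteristic functions and the conclusion\<close>

lemma char_normal_measure:
  assumes "v \<ge> 0"
  shows "char (normal_measure v) t = of_real (exp (- t\<^sup>2 * v / 2))"
proof (cases "v = 0")
  case True
  then show ?thesis by (simp add: normal_measure_def char_def integral_return)
next
  case False
  define \<sigma> where "\<sigma> = sqrt v"
  have sg: "\<sigma> > 0" "\<sigma>\<^sup>2 = v" using assms False by (auto simp: \<sigma>_def)
  define M where "M = density lborel (normal_density 0 \<sigma>)"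
  have M: "normal_measure v = M" using False by (simp add: normal_measure_def M_def \<sigma>_def)
  interpret prob_space M unfolding M_def by (rule prob_space_normal_density[OF sg(1)])
  have "distributed M lborel (\<lambda>x. x) (normal_density 0 \<sigma>)"
    unfolding distributed_def M_def by (auto simp: distr_id2)
  then have "distributed M lborel (\<lambda>x. (x - 0) / \<sigma>) std_normal_density"
    unfolding normal_standard_normal_convert[OF sg(1)] .
  then have std: "distr M lborel (\<lambda>x. x / \<sigma>) = std_normal_distribution"
    by (simp add: distributed_def)
  have "char M t = (CLINT x|M. iexp (t * \<sigma> * (x / \<sigma>)))" using sg by (simp add: char_def)
  also have "\<dots> = (CLINT y|distr M lborel (\<lambda>x. x / \<sigma>). iexp (t * \<sigma> * y))"
    by (subst integral_distr) (auto simp: M_def)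
  also have "\<dots> = char std_normal_distribution (t * \<sigma>)" unfolding std char_def ..
  also have "\<dots> = of_real (exp (- t\<^sup>2 * v / 2))"
    unfolding char_std_normal_distribution by (simp add: power_mult_distrib sg)
  finally show ?thesis unfolding M .
qed

lemma real_distribution_normal_measure:
  assumes "v \<ge> 0"
  shows "real_distribution (normal_measure v)"
proof (cases "v = 0")
  case True
  then show ?thesis
    by (auto simp: normal_measure_def real_distribution_def real_distribution_axioms_def intro!: prob_space_return)
next
  case False
  then show ?thesis using assms prob_space_normal_density[of "sqrt v" 0]
    by (simp add: normal_measure_def real_distribution_def real_distribution_axioms_def)
qed

lemma char_pmf_of_set:
  assumes "finite A" "A \<noteq> {}"
  shows "char (distr (measure_pmf (pmf_of_set A)) borel Z) t
     = (\<Sum>x\<in>A. exp (\<i> * of_real (t * Z x))) / of_nat (card A)"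
proof -
  have "char (distr (measure_pmf (pmf_of_set A)) borel Z) t = (CLINT x|measure_pmf (pmf_of_set A). iexp (t * Z x))"
    unfolding char_def by (subst integral_distr) auto
  also have "\<dots> = (\<Sum>x\<in>A. pmf (pmf_of_set A) x *\<^sub>R iexp (t * Z x))"
    by (rule integral_measure_pmf) (use assms in auto)
  also have "\<dots> = (\<Sum>x\<in>A. exp (\<i> * of_real (t * Z x)) / of_nat (card A))"
    by (rule sum.cong[OF refl]) (use assms in \<open>simp add: scaleR_conv_of_real\<close>)
  finally show ?thesis by (simp add: sum_divide_distrib)
qed

text \<open>The polynomial has a double root at \<open>\<alpha> = 1\<close>, and the cofactor is
  positive on the unit interval. So the variance vanishes only for \<open>\<alpha> = 1\<close>, the
  case of the point mass in \<open>normal_measure\<close>.\<close>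

lemma limit_variance_nonneg:
  assumes "(\<alpha>::real) \<in> {0..1}"
  shows "0 \<le> 2/45 + 1/9 * \<alpha> ^ 3 - 3/5 * \<alpha> ^ 5 + 4/9 * \<alpha> ^ 6"
proof -
  have "2/45 + 1/9 * \<alpha> ^ 3 - 3/5 * \<alpha> ^ 5 + 4/9 * \<alpha> ^ 6
     = (1 - \<alpha>)\<^sup>2 * (20 * \<alpha> ^ 4 + 13 * \<alpha> ^ 3 + 6 * \<alpha>\<^sup>2 + 4 * \<alpha> + 2) / 45"
    by (simp add: field_simps eval_nat_numeral)
  also have "\<dots> \<ge> 0" using assms by simp
  finally show ?thesis .
qed

theorem theorem1p1:
  fixes C :: "nat \<Rightarrow> (nat \<Rightarrow> nat) set" and \<alpha> :: real
  assumes "\<forall>n\<ge>1. conj_class n (C n)"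
    and "\<alpha> \<in> {0..1}"
    and "(\<lambda>n. alpha1 n (C n)) \<longlonglongrightarrow> \<alpha>"
  shows "weak_conv_m
           (\<lambda>n. distr (measure_pmf (pmf_of_set (C n))) borel
                   (\<lambda>p. (real (peaks n p) - (1 - alpha1 n (C n) ^ 3) / 3 * real n) / sqrt (real n)))
           (normal_measure (2/45 + 1/9 * \<alpha> ^ 3 - 3/5 * \<alpha> ^ 5 + 4/9 * \<alpha> ^ 6))"
proof -
  interpret conj_class_sequence C \<alpha> using assms by unfold_locales auto
  define v where "v = 2/45 + 1/9 * \<alpha> ^ 3 - 3/5 * \<alpha> ^ 5 + 4/9 * \<alpha> ^ 6"
  have v: "v \<ge> 0" unfolding v_def by (rule limit_variance_nonneg[OF assms(2)])
  define Z where "Z = (\<lambda>n p. (real (peaks n p) - (1 - alpha1 n (C n) ^ 3) / 3 * real n) / sqrt (real n))"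
  have Zdev: "Z n p = dev n p / sqrt (real n)" for n p by (simp add: Z_def dev_def \<mu>_def)
  have char: "(\<lambda>n. char (distr (measure_pmf (pmf_of_set (C n))) borel (Z n)) t) \<longlonglongrightarrow> char (normal_measure v) t" for t
  proof -
    \<comment> \<open>Shifted by one, since nothing is assumed about \<open>C 0\<close>; the shift
      is undone at the level of limits. The continuity theorem asks for probability measures at
      every index, and \<open>measure_pmf\<close> is one even at 0.\<close>
    have "(\<lambda>n. (\<Sum>x\<in>C (Suc n). exp (\<i> * of_real (t * Z (Suc n) x))) / of_nat (card (C (Suc n)))) \<longlonglongrightarrow> of_real (exp (- t\<^sup>2 * v / 2))"
    proof (rule laplace_convergence_imp_char_convergence)
      show "finite (C (Suc n))" "C (Suc n) \<noteq> {}" for n using finite_C C_nonempty by auto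
      fix s :: real assume s: "s > 0"
      show "(\<lambda>n. (\<Sum>x\<in>C (Suc n). exp (- s * Z (Suc n) x)) / card (C (Suc n))) \<longlonglongrightarrow> exp (s\<^sup>2 * v / 2)"
        using LIMSEQ_Suc[OF laplace_limit[OF s]] unfolding mean_def Zdev v_def .
    qed
    then have "(\<lambda>n. char (distr (measure_pmf (pmf_of_set (C (Suc n)))) borel (Z (Suc n))) t) \<longlonglongrightarrow> char (normal_measure v) t"
      unfolding char_normal_measure[OF v] by (simp add: char_pmf_of_set[OF finite_C C_nonempty])
    then show ?thesis by (rule LIMSEQ_imp_Suc)
  qed
  have "weak_conv_m (\<lambda>n. distr (measure_pmf (pmf_of_set (C n))) borel (Z n)) (normal_measure v)"
  proof (rule levy_continuity[OF _ real_distribution_normal_measure[OF v] char])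
    fix n show "real_distribution (distr (measure_pmf (pmf_of_set (C n))) borel (Z n))"
      unfolding real_distribution_def real_distribution_axioms_def
      by (auto intro!: prob_space.prob_space_distr prob_space_measure_pmf)
  qed
  then show ?thesis by (simp add: Z_def v_def)
qed

end
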